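(* There is a one-sided error Monte Carlo algorithm (with no false positives) that, given an undirected graph $G=(V,E)$ with $n=|V|$, a set of terminals $T\subseteq V$, a number $b$, and a $k$-clique-expression of $G$, runs in time $3^k\cdot n^{O(1)}$ and determines, with high probability, whether there exists a connected subgraph $H$ of $G$ with exactly $b$ vertices that spans all of $T$ (i.e. $T\subseteq V(H)$).
   Context: A labeled graph is a graph together with a labeling function $\mathrm{lab}\colon V\to\mathbb N$. A clique-expression is a well-formed expression built from the operations: introduce $i(v)$ (a graph with a single vertex $v$ of label $i$); disjoint union $G_1\oplus G_2$; relabel $\rho_{i\to j}(G)$ (all vertices of label $i$ get label $j$); and join $\eta_{i,j}(G)$ for $i\neq j$ (add all edges between vertices of label $i$ and vertices of label $j$). It is a $k$-clique-expression ($k$-expression) of $G$ if the graph it constructs is isomorphic to $G$ and every labeled graph constructed at every subexpression uses only labels in $\{1,\dots,k\}$.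
   Formalization: The running time is shown as 3^k times a polynomial in n plus the bit lengths of the given k-clique-expression and of b, since neither is bounded in terms of n and both must be read; for b ≤ n and expressions of size polynomial in n this is 3^k·n^{O(1)}. *)

theory Defs
  imports "HOL-Probability.Probability" "HOL-Library.Log_Nat"
begin

section \<open>Undirected graphs\<close>

type_synonym 'v ugraph = "'v set \<times> 'v set set"

definition simple_graph :: "'v ugraph \<Rightarrow> bool" where
  "simple_graph G \<longleftrightarrow> finite (fst G) \<and> (\<forall>e \<in> snd G. e \<subseteq> fst G \<and> card e = 2)"

definition subgraph :: "'v ugraph \<Rightarrow> 'v ugraph \<Rightarrow> bool" where
  "subgraph H G \<longleftrightarrow> simple_graph H \<and> fst H \<subseteq> fst G \<and> snd H \<subseteq> snd G"

text \<open>As usual, the graph without vertices does not count as connected.\<close>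

definition connected_graph :: "'v ugraph \<Rightarrow> bool" where
  "connected_graph G \<longleftrightarrow> fst G \<noteq> {} \<and>
     (\<forall>u \<in> fst G. \<forall>v \<in> fst G. (u, v) \<in> {(x, y). {x, y} \<in> snd G}\<^sup>*)"

definition graph_isomorphism :: "('v \<Rightarrow> 'w) \<Rightarrow> 'v ugraph \<Rightarrow> 'w ugraph \<Rightarrow> bool" where
  "graph_isomorphism \<phi> G G' \<longleftrightarrow> bij_betw \<phi> (fst G) (fst G') \<and>
     (\<forall>u \<in> fst G. \<forall>v \<in> fst G. {u, v} \<in> snd G \<longleftrightarrow> {\<phi> u, \<phi> v} \<in> snd G')"

definition isomorphic :: "'v ugraph \<Rightarrow> 'w ugraph \<Rightarrow> bool" where
  "isomorphic G G' \<longleftrightarrow> (\<exists>\<phi>. graph_isomorphism \<phi> G G')"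

section \<open>Clique-expressions\<close>

datatype 'v cexpr =
    Introduce nat 'v
  | Oplus "'v cexpr" "'v cexpr"
  | Relabel nat nat "'v cexpr"
  | Join nat nat "'v cexpr"

text \<open>
  The labeled graph constructed by an expression has vertex set \<open>cverts\<close>, edge set \<open>cedges\<close>
  and labeling function \<open>clab\<close>, which is meaningful on \<open>cverts\<close> only.
\<close>

fun cverts :: "'v cexpr \<Rightarrow> 'v set" where
  "cverts (Introduce i v) = {v}"
| "cverts (Oplus t u) = cverts t \<union> cverts u"
| "cverts (Relabel i j t) = cverts t"
| "cverts (Join i j t) = cverts t"

fun clab :: "'v cexpr \<Rightarrow> 'v \<Rightarrow> nat" where
  "clab (Introduce i v) x = i"
| "clab (Oplus t u) x = (if x \<in> cverts t then clab t x else clab u x)"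
| "clab (Relabel i j t) x = (if clab t x = i then j else clab t x)"
| "clab (Join i j t) x = clab t x"

fun cedges :: "'v cexpr \<Rightarrow> 'v set set" where
  "cedges (Introduce i v) = {}"
| "cedges (Oplus t u) = cedges t \<union> cedges u"
| "cedges (Relabel i j t) = cedges t"
| "cedges (Join i j t) = cedges t \<union>
     {{x, y} | x y. x \<in> cverts t \<and> y \<in> cverts t \<and> clab t x = i \<and> clab t y = j}"

definition cgraph :: "'v cexpr \<Rightarrow> 'v ugraph" where
  "cgraph t = (cverts t, cedges t)"

fun well_formed :: "'v cexpr \<Rightarrow> bool" where
  "well_formed (Introduce i v) \<longleftrightarrow> True"
| "well_formed (Oplus t u) \<longleftrightarrow> well_formed t \<and> well_formed u \<and> cverts t \<inter> cverts u = {}"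
| "well_formed (Relabel i j t) \<longleftrightarrow> well_formed t"
| "well_formed (Join i j t) \<longleftrightarrow> well_formed t \<and> i \<noteq> j"

fun subexprs :: "'v cexpr \<Rightarrow> 'v cexpr set" where
  "subexprs (Introduce i v) = {Introduce i v}"
| "subexprs (Oplus t u) = insert (Oplus t u) (subexprs t \<union> subexprs u)"
| "subexprs (Relabel i j t) = insert (Relabel i j t) (subexprs t)"
| "subexprs (Join i j t) = insert (Join i j t) (subexprs t)"

definition k_expression :: "nat \<Rightarrow> 'v cexpr \<Rightarrow> 'w ugraph \<Rightarrow> bool" where
  "k_expression k t G \<longleftrightarrow> well_formed t \<and> isomorphic (cgraph t) G \<and>
     (\<forall>s \<in> subexprs t. clab s ` cverts s \<subseteq> {1..k})"

section \<open>Randomized random access machines\<close>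

text \<open>
  The machine model is the random access machine with the logarithmic cost measure: each
  elementary operation is charged one unit plus the bit length (\<open>floorlog 2\<close>) of the number it
  produces. Programs are structured, and the memory is divided into arrays of natural numbers,
  of which a program can mention only finitely many. A scalar variable is entry 0 of an array.
\<close>

type_synonym name = string

type_synonym state = "name \<Rightarrow> nat \<Rightarrow> nat"

datatype aexp =
    Const nat
  | Load name aexp
  | Add aexp aexp
  | Sub aexp aexp
  | Mul aexp aexp
  | Quot aexp aexp
  | Rem aexp aexp

fun aval :: "aexp \<Rightarrow> state \<Rightarrow> nat" where
  "aval (Const m) s = m"
| "aval (Load x a) s = s x (aval a s)"
| "aval (Add a b) s = aval a s + aval b s"
| "aval (Sub a b) s = aval a s - aval b s"
| "aval (Mul a b) s = aval a s * aval b s"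
| "aval (Quot a b) s = aval a s div aval b s"
| "aval (Rem a b) s = aval a s mod aval b s"

definition op_cost :: "nat \<Rightarrow> nat" where
  "op_cost m = 1 + floorlog 2 m"

fun acost :: "aexp \<Rightarrow> state \<Rightarrow> nat" where
  "acost (Const m) s = op_cost m"
| "acost (Load x a) s = acost a s + op_cost (aval (Load x a) s)"
| "acost (Add a b) s = acost a s + acost b s + op_cost (aval (Add a b) s)"
| "acost (Sub a b) s = acost a s + acost b s + op_cost (aval (Sub a b) s)"
| "acost (Mul a b) s = acost a s + acost b s + op_cost (aval (Mul a b) s)"
| "acost (Quot a b) s = acost a s + acost b s + op_cost (aval (Quot a b) s)"
| "acost (Rem a b) s = acost a s + acost b s + op_cost (aval (Rem a b) s)"

datatype com =
    Skip
  | Store name aexp aexp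
  | Toss name
  | Seq com com
  | If aexp com com
  | While aexp com

text \<open>
  \<open>big_step c s \<omega> m s' \<omega>'\<close>: started in state \<open>s\<close> with the infinite sequence \<open>\<omega>\<close> of coin tosses
  still to come, \<open>c\<close> halts at cost \<open>m\<close> in state \<open>s'\<close>, with \<open>\<omega>'\<close> being the unused coin tosses.
\<close>

inductive big_step ::
    "com \<Rightarrow> state \<Rightarrow> bool stream \<Rightarrow> nat \<Rightarrow> state \<Rightarrow> bool stream \<Rightarrow> bool" where
  Skip: "big_step Skip s \<omega> 1 s \<omega>"
| Store: "big_step (Store x a e) s \<omega> (1 + acost a s + acost e s)
            (s(x := (s x)(aval a s := aval e s))) \<omega>"
| Toss: "big_step (Toss x) s \<omega> 1 (s(x := (s x)(0 := of_bool (shd \<omega>)))) (stl \<omega>)"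
| Seq: "big_step (Seq p q) s \<omega> (m + m') s'' \<omega>''"
    if "big_step p s \<omega> m s' \<omega>'" "big_step q s' \<omega>' m' s'' \<omega>''"
| IfTrue: "big_step (If e p q) s \<omega> (1 + acost e s + m) s' \<omega>'"
    if "aval e s \<noteq> 0" "big_step p s \<omega> m s' \<omega>'"
| IfFalse: "big_step (If e p q) s \<omega> (1 + acost e s + m) s' \<omega>'"
    if "aval e s = 0" "big_step q s \<omega> m s' \<omega>'"
| WhileFalse: "big_step (While e p) s \<omega> (1 + acost e s) s \<omega>"
    if "aval e s = 0"
| WhileTrue: "big_step (While e p) s \<omega> (1 + acost e s + m + m') s'' \<omega>''"
    if "aval e s \<noteq> 0" "big_step p s \<omega> m s' \<omega>'" "big_step (While e p) s' \<omega>' m' s'' \<omega>''"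

text \<open>The time bound is a worst-case bound: it is required for every outcome of the coin tosses.\<close>

definition runs_within :: "com \<Rightarrow> state \<Rightarrow> nat \<Rightarrow> bool" where
  "runs_within A s m \<longleftrightarrow> (\<forall>\<omega>. \<exists>m' s' \<omega>'. big_step A s \<omega> m' s' \<omega>' \<and> m' \<le> m)"

definition accepts :: "com \<Rightarrow> state \<Rightarrow> bool stream \<Rightarrow> bool" where
  "accepts A s \<omega> \<longleftrightarrow> (\<exists>m s' \<omega>'. big_step A s \<omega> m s' \<omega>' \<and> s' ''out'' 0 \<noteq> 0)"

definition coin_tosses :: "bool stream measure" where
  "coin_tosses = stream_space (measure_pmf (bernoulli_pmf (1/2)))"

definition accept_prob :: "com \<Rightarrow> state \<Rightarrow> real" where
  "accept_prob A s = measure coin_tosses {\<omega>. accepts A s \<omega>}"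

section \<open>Presentation of the input to the machine\<close>

text \<open>Expressions are written in postfix notation, three numbers for each operation.\<close>

fun postfix :: "nat cexpr \<Rightarrow> nat list" where
  "postfix (Introduce i v) = [0, i, v]"
| "postfix (Oplus t u) = postfix t @ postfix u @ [1, 0, 0]"
| "postfix (Relabel i j t) = postfix t @ [2, i, j]"
| "postfix (Join i j t) = postfix t @ [3, i, j]"

text \<open>
  Neither the length of an expression of \<open>G\<close> nor a number given in binary is bounded in terms of
  the number \<open>n\<close> of vertices, and reading them takes time. Their \<open>bit_size\<close> therefore counts as
  part of the quantity in which running times are polynomial. If it is polynomial in \<open>n\<close>, as
  it is for expressions without superfluous operations, this is a polynomial in \<open>n\<close>.
\<close>

definition bit_size :: "nat list \<Rightarrow> nat" where
  "bit_size xs = (\<Sum>x\<leftarrow>xs. 1 + floorlog 2 x)"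

definition array_of :: "nat list \<Rightarrow> nat \<Rightarrow> nat" where
  "array_of xs i = (if i < length xs then xs ! i else 0)"

text \<open>
  The vertices of \<open>G\<close> are presented to the machine as the numbers below \<open>card (fst G)\<close>, by means
  of a numbering \<open>\<nu>\<close>. In \<open>input_state\<close>, the expression \<open>t\<close> is one over these numbers.
\<close>

definition input_state ::
    "nat ugraph \<Rightarrow> nat set \<Rightarrow> nat \<Rightarrow> nat \<Rightarrow> nat cexpr \<Rightarrow> (nat \<Rightarrow> nat) \<Rightarrow> state" where
  "input_state G T b k t \<nu> = (let n = card (fst G) in
     (\<lambda>x i. 0)
       (''n'' := array_of [n],
        ''b'' := array_of [b],
        ''k'' := array_of [k],
        ''adj'' := (\<lambda>i. of_bool (\<exists>u \<in> fst G. \<exists>v \<in> fst G. {u, v} \<in> snd G \<and> i = \<nu> u * n + \<nu> v)),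
        ''term'' := (\<lambda>i. of_bool (i \<in> \<nu> ` T)),
        ''len'' := array_of [length (postfix t)],
        ''expr'' := array_of (postfix t)))"

section \<open>The problem\<close>

definition steiner_solution :: "nat ugraph \<Rightarrow> nat set \<Rightarrow> nat \<Rightarrow> nat ugraph \<Rightarrow> bool" where
  "steiner_solution G T b H \<longleftrightarrow>
     subgraph H G \<and> connected_graph H \<and> card (fst H) = b \<and> T \<subseteq> fst H"

end

theory Submission
  imports Defs
begin

text \<open>
  A set \<open>X\<close> of vertices is connected iff the number of cuts \<open>L \<subseteq> X\<close> that no edge inside \<open>X\<close>
  crosses is 2 modulo 4. Cuts are counted along the clique-expression together with a
  nondeterministic choice of the label classes that are going to be joined with a class meeting
  \<open>X\<close> later on. The vertices of such a live class end up in the same component, so that only the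
  cuts matter that have all of them on one side. This leaves three states for every label: no
  live vertices, all of them in \<open>L\<close>, or none of them in \<open>L\<close>. A class can only be declared dead
  by a join with another live class, and at the end all classes have to be dead. Every choice
  hence uses only actual edges of the graph, and the choice that keeps a class alive exactly as
  long as such a join is still to come uses all of them.

  The tables store sums over all states below a given one. With this convention a disjoint
  union is a pointwise product, and relabeling and joining access a bounded number of
  entries. Several choices may belong to the same \<open>X\<close>. They are told apart by random weights: by the
  isolation lemma, with high probability exactly one choice of minimum weight has its number of
  cuts equal to 2 modulo 4. The table entries are numbers in base \<open>2 ^ len\<close> whose digit at position \<open>v\<close>
  counts the configurations of weight \<open>v\<close>, where the leading part of the weight is \<open>card X\<close>.
\<close>

section \<open>Cost of loop-free programs and counted loops\<close>

text \<open>An uncut set is a union of connected components, so a nonempty \<open>X\<close> with c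
  components has 2^c cuts: always an even number, and a multiple of 4 unless c = 1. Only choices
  need to be isolated, never individual cuts. Evaluating at \<open>2 ^ len\<close> packs all weights
  into one number; as \<open>len\<close> is three times the number of nodes, there are fewer than
  \<open>2 ^ len\<close> configurations and no digit carries.

  The size of the random weights is a compromise. With \<open>bits = lg * Suc d\<close> random bits
  each, \<open>2 ^ bits\<close> exceeds the number of choices times \<open>(n + 1) ^ d\<close>,
  which gives the error bound, yet it stays polynomial in \<open>len\<close> for fixed
  \<open>d\<close>, and so does the bit length of the packed numbers.

  Costs are logarithmic and must hold for all tosses, so every loop invariant determines the values
  of the variables exactly; from this follow a uniform bound \<open>2 ^ \<beta>\<close> on all
  memory cells and, with it, the cost of a round.\<close>

lemma big_step_deterministic:
  "big_step c s \<omega> m s' \<omega>' \<Longrightarrow> big_step c s \<omega> m2 s2 \<omega>2 \<Longrightarrow> s2 = s' \<and> \<omega>2 = \<omega>'"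
proof (induction arbitrary: m2 s2 \<omega>2 rule: big_step.induct)
  case (Seq p s \<omega> m s' \<omega>' q m' s'' \<omega>'')
  from Seq.prems show ?case
    by (cases rule: big_step.cases) (use Seq.IH in blast)+
next
  case (WhileTrue e s p \<omega> m s' \<omega>' m' s'' \<omega>'')
  from WhileTrue.prems show ?case
    by (cases rule: big_step.cases) (use WhileTrue.IH WhileTrue.hyps in blast)+
qed (erule big_step.cases; auto)+

fun loop_free :: "com \<Rightarrow> bool" where
  "loop_free (Seq p q) \<longleftrightarrow> loop_free p \<and> loop_free q"
| "loop_free (If e p q) \<longleftrightarrow> loop_free p \<and> loop_free q"
| "loop_free (While e p) \<longleftrightarrow> False"
| "loop_free _ \<longleftrightarrow> True"

text \<open>A functional semantics lets the simplifier execute loop bodies. The equation for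
  \<open>While\<close> is a placeholder.\<close>

fun run :: "com \<Rightarrow> state \<times> bool stream \<Rightarrow> state \<times> bool stream" where
  "run Skip \<sigma> = \<sigma>"
| "run (Store x a e) (s, \<omega>) = (s(x := (s x)(aval a s := aval e s)), \<omega>)"
| "run (Toss x) (s, \<omega>) = (s(x := (s x)(0 := of_bool (shd \<omega>))), stl \<omega>)"
| "run (Seq p q) \<sigma> = run q (run p \<sigma>)"
| "run (If e p q) \<sigma> = (if aval e (fst \<sigma>) \<noteq> 0 then run p \<sigma> else run q \<sigma>)"
| "run (While e p) \<sigma> = \<sigma>"

definition mem_bound :: "nat \<Rightarrow> state \<Rightarrow> bool" where
  "mem_bound \<beta> s \<longleftrightarrow> (\<forall>x i. s x i < 2 ^ \<beta>)"

text \<open>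
  Bit lengths add up under multiplication and grow by at most one under the other operations, so
  that \<open>growth e\<close> bounds the factor by which evaluating \<open>e\<close> enlarges them.
\<close>

fun growth :: "aexp \<Rightarrow> nat" where
  "growth (Const m) = Suc m"
| "growth (Load x a) = Suc (growth a)"
| "growth (Add a b) = Suc (growth a + growth b)"
| "growth (Sub a b) = Suc (growth a + growth b)"
| "growth (Mul a b) = Suc (growth a + growth b)"
| "growth (Quot a b) = Suc (growth a + growth b)"
| "growth (Rem a b) = Suc (growth a + growth b)"

lemma growth_pos: "growth e \<ge> 1"
  by (cases e) auto

lemma mem_boundD: "mem_bound \<beta> s \<Longrightarrow> s x i < 2 ^ \<beta>"
  by (simp add: mem_bound_def)

lemma mem_bound_mono: "mem_bound \<beta> s \<Longrightarrow> \<beta> \<le> \<beta>' \<Longrightarrow> mem_bound \<beta>' s"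
  unfolding mem_bound_def by (meson one_le_numeral order_less_le_trans power_increasing)

lemma less_power_mono: "x < 2 ^ a \<Longrightarrow> a \<le> b \<Longrightarrow> x < (2::nat) ^ b"
  by (meson one_le_numeral order_less_le_trans power_increasing)

lemma aval_less_power:
  assumes "mem_bound \<beta> s" "\<beta> \<ge> 1"
  shows "aval e s < 2 ^ (growth e * \<beta>)"
proof (induction e)
  case (Const m)
  have "m < 2 ^ Suc m"
    by (meson less_exp less_power_mono le_SucI order_refl)
  then show ?case using assms(2)
    by (auto intro: less_power_mono[of _ "Suc m"] simp del: power_Suc mult_Suc)
next
  case (Load x a)
  show ?case using less_power_mono[OF mem_boundD[OF assms(1)]] by simp
next
  case (Add a b)
  let ?g = "(growth a + growth b) * \<beta>"
  have "aval a s < 2 ^ ?g" "aval b s < 2 ^ ?g"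
    using Add.IH by (auto intro: less_power_mono simp: algebra_simps)
  then have "aval (Add a b) s < 2 ^ Suc ?g" by simp
  then show ?case
    by (rule less_power_mono) (use assms(2) in simp)
next
  case (Sub a b)
  show ?case
    using less_power_mono[OF le_less_trans[OF diff_le_self Sub.IH(1)], of "growth (Sub a b) * \<beta>"]
    by (simp add: algebra_simps)
next
  case (Mul a b)
  have "aval a s * aval b s < 2 ^ (growth a * \<beta>) * 2 ^ (growth b * \<beta>)"
    using Mul.IH by (intro mult_strict_mono) auto
  also have "\<dots> = 2 ^ ((growth a + growth b) * \<beta>)"
    by (simp add: power_add algebra_simps)
  finally have "aval (Mul a b) s < 2 ^ ((growth a + growth b) * \<beta>)" by simp
  then show ?case by (rule less_power_mono) simp
next
  case (Quot a b)
  have "aval (Quot a b) s < 2 ^ (growth a * \<beta>)"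
    using Quot.IH(1) by (auto intro: le_less_trans[OF div_le_dividend])
  then show ?case by (rule less_power_mono) (simp add: algebra_simps)
next
  case (Rem a b)
  have "aval (Rem a b) s < 2 ^ (growth a * \<beta>)"
    using Rem.IH(1) by (auto intro: le_less_trans[OF mod_less_eq_dividend])
  then show ?case by (rule less_power_mono) (simp add: algebra_simps)
qed

lemma op_cost_le: "m < 2 ^ \<beta> \<Longrightarrow> op_cost m \<le> Suc \<beta>"
  unfolding op_cost_def by (simp add: floorlog_leI)

text \<open>The quadratic form is closed under binary operations: 2(a+b+1)^2 exceeds 2a^2 + 2b^2 by
  at least a+b+2, which covers the charge for the operation at the root.\<close>

lemma acost_binary_le:
  fixes a b :: nat
  assumes "x \<le> 2 * a * a * \<beta>" "y \<le> 2 * b * b * \<beta>" "z \<le> Suc (Suc (a + b) * \<beta>)" "\<beta> \<ge> 1"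
  shows "x + y + z \<le> 2 * Suc (a + b) * Suc (a + b) * \<beta>"
proof -
  have "x + y + z \<le> 2 * a * a * \<beta> + 2 * b * b * \<beta> + (\<beta> + Suc (a + b) * \<beta>)"
    using assms by linarith
  also have "\<dots> \<le> 2 * Suc (a + b) * Suc (a + b) * \<beta>" by (simp add: algebra_simps)
  finally show ?thesis .
qed

lemma acost_le:
  assumes "mem_bound \<beta> s" "\<beta> \<ge> 1"
  shows "acost e s \<le> 2 * growth e * growth e * \<beta>"
proof -
  have op: "op_cost (aval e s) \<le> Suc (growth e * \<beta>)" for e
    by (intro op_cost_le aval_less_power assms)
  show ?thesis
  proof (induction e)
    case (Const m)
    have "acost (Const m) s \<le> Suc (growth (Const m) * \<beta>)" using op[of "Const m"] by simp
    also have "\<dots> \<le> 2 * growth (Const m) * \<beta>" using assms(2) by (simp add: algebra_simps)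
    also have "\<dots> \<le> 2 * growth (Const m) * growth (Const m) * \<beta>" by simp
    finally show ?case .
  next
    case (Load x a)
    then have "acost (Load x a) s \<le> 2 * growth a * growth a * \<beta> + Suc (growth (Load x a) * \<beta>)"
      using op[of "Load x a"] by simp
    also have "\<dots> \<le> 2 * growth (Load x a) * growth (Load x a) * \<beta>"
      using assms(2) by (simp add: algebra_simps)
    finally show ?case .
  next
    case (Add a b)
    show ?case using acost_binary_le[OF Add _ assms(2)] op[of "Add a b"] by simp
  next
    case (Sub a b)
    show ?case using acost_binary_le[OF Sub _ assms(2)] op[of "Sub a b"] by simp
  next
    case (Mul a b)
    show ?case using acost_binary_le[OF Mul _ assms(2)] op[of "Mul a b"] by simp
  next
    case (Quot a b)
    show ?case using acost_binary_le[OF Quot _ assms(2)] op[of "Quot a b"] by simp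
  next
    case (Rem a b)
    show ?case using acost_binary_le[OF Rem _ assms(2)] op[of "Rem a b"] by simp
  qed
qed

text \<open>Factors multiply along \<open>Seq\<close> because the second program starts from numbers
  that the first has already enlarged. Iterating a body would compound them exponentially, so loops
  are handled by invariants instead.\<close>

fun cgrowth :: "com \<Rightarrow> nat" where
  "cgrowth (Store x a e) = growth e"
| "cgrowth (Seq p q) = cgrowth p * cgrowth q"
| "cgrowth (If e p q) = cgrowth p + cgrowth q"
| "cgrowth _ = 1"

fun ctime :: "com \<Rightarrow> nat" where
  "ctime (Store x a e) = 1 + 2 * growth a * growth a + 2 * growth e * growth e"
| "ctime (Seq p q) = ctime p + ctime q * cgrowth p"
| "ctime (If e p q) = 1 + 2 * growth e * growth e + ctime p + ctime q"
| "ctime _ = 1"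

lemma cgrowth_pos: "cgrowth c \<ge> 1"
proof (induction c)
  case (Store x a e)
  show ?case using growth_pos[of e] by simp
qed auto

lemma loop_free_run:
  assumes "loop_free c" "mem_bound \<beta> s" "\<beta> \<ge> 1"
  shows "\<exists>m. big_step c s \<omega> m (fst (run c (s, \<omega>))) (snd (run c (s, \<omega>))) \<and>
           m \<le> ctime c * \<beta> \<and> mem_bound (cgrowth c * \<beta>) (fst (run c (s, \<omega>)))"
  using assms
proof (induction c arbitrary: s \<omega> \<beta>)
  case Skip
  then show ?case by (auto intro!: exI[of _ 1] big_step.Skip)
next
  case (Store x a e)
  have "mem_bound (growth e * \<beta>) (s(x := (s x)(aval a s := aval e s)))"
    using aval_less_power[OF Store(2,3), of e] mem_bound_mono[OF Store(2), of "growth e * \<beta>"]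
      growth_pos[of e] by (auto simp: mem_bound_def)
  moreover have "1 + acost a s + acost e s \<le> ctime (Store x a e) * \<beta>"
    using acost_le[OF Store(2,3), of a] acost_le[OF Store(2,3), of e] Store(3)
    by (simp add: algebra_simps)
  ultimately show ?case using big_step.Store[of x a e s \<omega>] by (auto simp del: fun_upd_apply)
next
  case (Toss x)
  have "mem_bound \<beta> (s(x := (s x)(0 := of_bool (shd \<omega>))))"
    using Toss(2) one_less_power[of "2::nat" \<beta>] Toss(3) by (auto simp: mem_bound_def of_bool_def)
  then show ?case using Toss(3) big_step.Toss[of x s \<omega>] by (auto simp del: fun_upd_apply)
next
  case (Seq p q)
  obtain s1 \<omega>1 where r: "run p (s, \<omega>) = (s1, \<omega>1)" by fastforce
  obtain m where m: "big_step p s \<omega> m s1 \<omega>1" "m \<le> ctime p * \<beta>" "mem_bound (cgrowth p * \<beta>) s1"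
    using Seq.IH(1)[of \<beta> s \<omega>] Seq.prems r by auto
  have pos: "cgrowth p * \<beta> \<ge> 1" using cgrowth_pos[of p] Seq.prems(3) by (simp add: Suc_le_eq)
  obtain m' where m': "big_step q s1 \<omega>1 m' (fst (run q (s1, \<omega>1))) (snd (run q (s1, \<omega>1)))"
      "m' \<le> ctime q * (cgrowth p * \<beta>)" "mem_bound (cgrowth q * (cgrowth p * \<beta>)) (fst (run q (s1, \<omega>1)))"
    using Seq.IH(2)[OF _ m(3) pos, of \<omega>1] Seq.prems by auto
  have "big_step (Seq p q) s \<omega> (m + m') (fst (run (Seq p q) (s, \<omega>))) (snd (run (Seq p q) (s, \<omega>)))"
    using big_step.Seq[OF m(1) m'(1)] r by simp
  moreover have "m + m' \<le> ctime (Seq p q) * \<beta>" using m(2) m'(2) by (simp add: algebra_simps)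
  moreover have "mem_bound (cgrowth (Seq p q) * \<beta>) (fst (run (Seq p q) (s, \<omega>)))"
    using m'(3) r by (simp add: algebra_simps)
  ultimately show ?case by blast
next
  case (If e p q)
  note e = acost_le[OF If.prems(2,3), of e]
  show ?case
  proof (cases "aval e s = 0")
    case False
    obtain m where m: "big_step p s \<omega> m (fst (run p (s, \<omega>))) (snd (run p (s, \<omega>)))"
      "m \<le> ctime p * \<beta>" "mem_bound (cgrowth p * \<beta>) (fst (run p (s, \<omega>)))"
      using If.IH(1)[of \<beta> s \<omega>] If.prems by auto
    have "1 + acost e s + m \<le> ctime (If e p q) * \<beta>"
      using e m(2) If.prems(3) by (simp add: algebra_simps)
    then show ?thesis
      using big_step.IfTrue[OF False m(1), of q] False mem_bound_mono[OF m(3), of "cgrowth (If e p q) * \<beta>"]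
      by auto
  next
    case True
    obtain m where m: "big_step q s \<omega> m (fst (run q (s, \<omega>))) (snd (run q (s, \<omega>)))"
      "m \<le> ctime q * \<beta>" "mem_bound (cgrowth q * \<beta>) (fst (run q (s, \<omega>)))"
      using If.IH(2)[of \<beta> s \<omega>] If.prems by auto
    have "1 + acost e s + m \<le> ctime (If e p q) * \<beta>"
      using e m(2) If.prems(3) by (simp add: algebra_simps)
    then show ?thesis
      using big_step.IfFalse[OF True m(1), of p] True mem_bound_mono[OF m(3), of "cgrowth (If e p q) * \<beta>"]
      by auto
  qed
qed simp

definition while_time :: "aexp \<Rightarrow> com \<Rightarrow> nat" where
  "while_time e p = 1 + 2 * growth e * growth e + ctime p"

text \<open>The invariant supplies the same bit length \<open>\<beta>\<close> at the start of every
  round, so the growth within one body never accumulates. Its index is the number of completed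
  rounds, which makes the round count exact.\<close>

lemma counted_while:
  assumes "loop_free p" "\<beta> \<ge> 1"
    and step: "\<And>i s \<omega>. i < n \<Longrightarrow> I i s \<omega> \<Longrightarrow>
      aval e s \<noteq> 0 \<and> I (Suc i) (fst (run p (s, \<omega>))) (snd (run p (s, \<omega>)))"
    and stop: "\<And>s \<omega>. I n s \<omega> \<Longrightarrow> aval e s = 0"
    and bound: "\<And>i s \<omega>. i \<le> n \<Longrightarrow> I i s \<omega> \<Longrightarrow> mem_bound \<beta> s"
    and init: "I 0 s \<omega>"
  shows "\<exists>m s' \<omega>'. big_step (While e p) s \<omega> m s' \<omega>' \<and> I n s' \<omega>' \<and>
           m \<le> while_time e p * \<beta> * Suc n"
proof -
  have "\<exists>m s' \<omega>'. big_step (While e p) s \<omega> m s' \<omega>' \<and> I n s' \<omega>' \<and>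
           m \<le> while_time e p * \<beta> * Suc (n - i)" if "i \<le> n" "I i s \<omega>" for i s \<omega>
    using that
  proof (induction "n - i" arbitrary: i s \<omega>)
    case 0
    then have "I n s \<omega>" "i = n" by auto
    moreover have "1 + acost e s \<le> while_time e p * \<beta>"
      using acost_le[OF bound[OF order_refl \<open>I n s \<omega>\<close>] assms(2), of e] assms(2)
      by (simp add: while_time_def algebra_simps)
    ultimately show ?case using big_step.WhileFalse[OF stop[OF \<open>I n s \<omega>\<close>], of p \<omega>] by auto
  next
    case (Suc r)
    then have i: "i < n" by linarith
    note st = step[OF i Suc.prems(2)] and bd = bound[OF Suc.prems]
    obtain m where m: "big_step p s \<omega> m (fst (run p (s, \<omega>))) (snd (run p (s, \<omega>)))" "m \<le> ctime p * \<beta>"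
      using loop_free_run[OF assms(1) bd assms(2), of \<omega>] by blast
    have r: "r = n - Suc i" using Suc.hyps(2) by linarith
    obtain m' s' \<omega>' where m': "big_step (While e p) (fst (run p (s, \<omega>))) (snd (run p (s, \<omega>))) m' s' \<omega>'"
       "I n s' \<omega>'" "m' \<le> while_time e p * \<beta> * Suc (n - Suc i)"
      using Suc.hyps(1)[of "Suc i" "fst (run p (s, \<omega>))" "snd (run p (s, \<omega>))", OF r] i st
      by auto
    have "1 + acost e s + m \<le> while_time e p * \<beta>"
      using acost_le[OF bd assms(2), of e] m(2) assms(2)
      by (simp add: while_time_def algebra_simps)
    then have "1 + acost e s + m + m' \<le> while_time e p * \<beta> * Suc (n - i)"
      using m'(3) Suc_diff_Suc[OF i, symmetric] by simp
    then show ?case using big_step.WhileTrue[OF _ m(1) m'(1)] st m'(2) by blast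
  qed
  from this[OF _ init] show ?thesis by simp
qed

section \<open>Partial solutions and their tables\<close>

primrec nodes :: "'v cexpr \<Rightarrow> nat" where
  "nodes (Introduce i v) = 1"
| "nodes (Oplus t u) = Suc (nodes t + nodes u)"
| "nodes (Relabel i j t) = Suc (nodes t)"
| "nodes (Join i j t) = Suc (nodes t)"

text \<open>
  Nodes are numbered in postfix order, with \<open>p\<close> the number of the first node of the expression.
  A set \<open>C\<close> of choices encodes by \<open>2 * q\<close> and \<open>2 * q + 1\<close> the decisions at node \<open>q\<close>: an introduced
  vertex is selected and live, or selected and dead; the first, respectively the second label
  class of a join dies.
\<close>

fun sel :: "'v cexpr \<Rightarrow> nat \<Rightarrow> nat set \<Rightarrow> 'v set" where
  "sel (Introduce i v) p C = (if 2 * p \<in> C \<or> 2 * p + 1 \<in> C then {v} else {})"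
| "sel (Oplus t u) p C = sel t p C \<union> sel u (p + nodes t) C"
| "sel (Relabel i j t) p C = sel t p C"
| "sel (Join i j t) p C = sel t p C"

fun live :: "'v cexpr \<Rightarrow> nat \<Rightarrow> nat set \<Rightarrow> nat \<Rightarrow> 'v set" where
  "live (Introduce i v) p C l = (if 2 * p \<in> C \<and> l = i then {v} else {})"
| "live (Oplus t u) p C l = live t p C l \<union> live u (p + nodes t) C l"
| "live (Relabel i j t) p C l =
     (if l = j then live t p C i \<union> live t p C j else if l = i then {} else live t p C l)"
| "live (Join i j t) p C l =
     (if l = i \<and> 2 * (p + nodes t) \<in> C \<or> l = j \<and> 2 * (p + nodes t) + 1 \<in> C then {}
      else live t p C l)"

fun used_edges :: "'v cexpr \<Rightarrow> nat \<Rightarrow> nat set \<Rightarrow> ('v \<times> 'v) set" where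
  "used_edges (Introduce i v) p C = {}"
| "used_edges (Oplus t u) p C = used_edges t p C \<union> used_edges u (p + nodes t) C"
| "used_edges (Relabel i j t) p C = used_edges t p C"
| "used_edges (Join i j t) p C = used_edges t p C \<union> live t p C i \<times> live t p C j"

fun valid :: "'v set \<Rightarrow> 'v cexpr \<Rightarrow> nat \<Rightarrow> nat set \<Rightarrow> bool" where
  "valid T (Introduce i v) p C \<longleftrightarrow>
     \<not> (2 * p \<in> C \<and> 2 * p + 1 \<in> C) \<and> (v \<in> T \<longrightarrow> 2 * p \<in> C \<or> 2 * p + 1 \<in> C)"
| "valid T (Oplus t u) p C \<longleftrightarrow> valid T t p C \<and> valid T u (p + nodes t) C \<and>
     2 * (p + nodes t + nodes u) \<notin> C \<and> 2 * (p + nodes t + nodes u) + 1 \<notin> C"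
| "valid T (Relabel i j t) p C \<longleftrightarrow> valid T t p C \<and>
     2 * (p + nodes t) \<notin> C \<and> 2 * (p + nodes t) + 1 \<notin> C"
| "valid T (Join i j t) p C \<longleftrightarrow> valid T t p C \<and>
     (live t p C i = {} \<or> live t p C j = {} \<longrightarrow>
        2 * (p + nodes t) \<notin> C \<and> 2 * (p + nodes t) + 1 \<notin> C)"

definition choices :: "'v cexpr \<Rightarrow> nat \<Rightarrow> nat set" where
  "choices t p = {2 * p..<2 * (p + nodes t)}"

definition uncut :: "('v \<times> 'v) set \<Rightarrow> 'v set \<Rightarrow> bool" where
  "uncut E L \<longleftrightarrow> (\<forall>(x, y) \<in> E. x \<in> L \<longleftrightarrow> y \<in> L)"

text \<open>The state 0 lies below the states 1 and 2, and \<open>admits\<close> holds if the class \<open>A\<close> is in a state below \<open>c\<close>.\<close>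

definition admits :: "nat \<Rightarrow> 'v set \<Rightarrow> 'v set \<Rightarrow> bool" where
  "admits c A L \<longleftrightarrow> (if c = 0 then A = {} else if c = 1 then A \<subseteq> L else A \<inter> L = {})"

definition configs :: "'v set \<Rightarrow> 'v cexpr \<Rightarrow> nat \<Rightarrow> (nat \<Rightarrow> nat) \<Rightarrow> (nat set \<times> 'v set) set" where
  "configs T t p s = {(C, L). C \<subseteq> choices t p \<and> L \<subseteq> sel t p C \<and> valid T t p C \<and>
     uncut (used_edges t p C) L \<and> (\<forall>l. admits (s l) (live t p C l) L)}"

definition weight_sum :: "(nat \<Rightarrow> nat) \<Rightarrow> (nat set \<times> 'v set) set \<Rightarrow> nat" where
  "weight_sum w A = (\<Sum>(C, L) \<in> A. \<Prod>u\<in>C. w u)"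

definition table :: "'v set \<Rightarrow> (nat \<Rightarrow> nat) \<Rightarrow> 'v cexpr \<Rightarrow> nat \<Rightarrow> (nat \<Rightarrow> nat) \<Rightarrow> nat" where
  "table T w t p s = weight_sum w (configs T t p s)"

section \<open>Locality of choices and recurrences for the tables\<close>

lemma nodes_pos: "nodes t > 0"
  by (cases t) auto

lemma choices_simps:
  "choices (Introduce i v) p = {2 * p, 2 * p + 1}"
  "choices (Oplus t u) p = choices t p \<union> choices u (p + nodes t) \<union>
     {2 * (p + nodes t + nodes u), 2 * (p + nodes t + nodes u) + 1}"
  "choices (Relabel i j t) p = choices t p \<union> {2 * (p + nodes t), 2 * (p + nodes t) + 1}"
  "choices (Join i j t) p = choices t p \<union> {2 * (p + nodes t), 2 * (p + nodes t) + 1}"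
  by (auto simp: choices_def)

lemma finite_choices: "finite (choices t p)"
  by (simp add: choices_def)

lemma root_not_in_choices:
  "2 * (p + nodes t) \<notin> choices t p" "2 * (p + nodes t) + 1 \<notin> choices t p"
  by (auto simp: choices_def)

lemma agree_Oplus:
  assumes "C \<inter> choices (Oplus t u) p = C' \<inter> choices (Oplus t u) p"
  shows "C \<inter> choices t p = C' \<inter> choices t p"
    "C \<inter> choices u (p + nodes t) = C' \<inter> choices u (p + nodes t)"
    "2 * (p + nodes t + nodes u) \<in> C \<longleftrightarrow> 2 * (p + nodes t + nodes u) \<in> C'"
    "2 * (p + nodes t + nodes u) + 1 \<in> C \<longleftrightarrow> 2 * (p + nodes t + nodes u) + 1 \<in> C'"
  using assms unfolding choices_simps by blast+

lemma agree_unary: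
  assumes "C \<inter> (choices t p \<union> {2 * (p + nodes t), 2 * (p + nodes t) + 1}) =
    C' \<inter> (choices t p \<union> {2 * (p + nodes t), 2 * (p + nodes t) + 1})"
  shows "C \<inter> choices t p = C' \<inter> choices t p"
    "2 * (p + nodes t) \<in> C \<longleftrightarrow> 2 * (p + nodes t) \<in> C'"
    "2 * (p + nodes t) + 1 \<in> C \<longleftrightarrow> 2 * (p + nodes t) + 1 \<in> C'"
  using assms by blast+

text \<open>Each expression owns a block of choice numbers and reads nothing else. Hence a choice
  set may be enlarged by decisions of other nodes, or restricted to the block, without changing what
  happens below.\<close>

lemma choices_cong:
  assumes "C \<inter> choices t p = C' \<inter> choices t p"
  shows sel_cong: "sel t p C = sel t p C'"
    and live_cong: "live t p C = live t p C'"
    and used_edges_cong: "used_edges t p C = used_edges t p C'"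
    and valid_cong: "valid T t p C = valid T t p C'"
proof -
  have "sel t p C = sel t p C' \<and> live t p C = live t p C' \<and> used_edges t p C = used_edges t p C' \<and>
      valid T t p C = valid T t p C'"
    using assms
  proof (induction t arbitrary: p)
    case (Introduce i v)
    then show ?case by (auto simp: choices_simps fun_eq_iff)
  next
    case (Oplus t u)
    note ag = agree_Oplus[OF Oplus.prems]
    show ?case using Oplus.IH(1)[OF ag(1)] Oplus.IH(2)[OF ag(2)] ag(3,4) by (simp add: fun_eq_iff)
  next
    case (Relabel i j t)
    note ag = agree_unary[OF Relabel.prems[unfolded choices_simps]]
    show ?case using Relabel.IH[OF ag(1)] ag(2,3) by (simp add: fun_eq_iff)
  next
    case (Join i j t)
    note ag = agree_unary[OF Join.prems[unfolded choices_simps]]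
    show ?case using Join.IH[OF ag(1)] ag(2,3) by (simp add: fun_eq_iff)
  qed
  then show "sel t p C = sel t p C'" "live t p C = live t p C'" "used_edges t p C = used_edges t p C'"
    "valid T t p C = valid T t p C'" by auto
qed

lemma sel_subset: "sel t p C \<subseteq> cverts t"
  by (induction t arbitrary: p) auto

lemma finite_cverts: "finite (cverts t)"
  by (induction t) auto

lemma live_subset: "live t p C l \<subseteq> sel t p C"
  by (induction t arbitrary: p l) (auto split: if_splits, blast+)

lemma used_edges_subset: "used_edges t p C \<subseteq> sel t p C \<times> sel t p C"
  by (induction t arbitrary: p) (use live_subset in fastforce)+

text \<open>Liveness is tracked by label, so it has to follow the labeling through relabelings. This
  makes used edges real and leaves absent labels without live vertices.\<close>

lemma live_clab: "well_formed t \<Longrightarrow> x \<in> live t p C l \<Longrightarrow> clab t x = l"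
proof (induction t arbitrary: p l)
  case (Oplus t u)
  have "x \<in> live t p C l \<or> x \<in> live u (p + nodes t) C l" using Oplus.prems by simp
  then show ?case
  proof
    assume "x \<in> live u (p + nodes t) C l"
    moreover from this have "x \<in> cverts u" using live_subset[of u] sel_subset[of u] by blast
    ultimately show ?thesis using Oplus by auto
  qed (use Oplus live_subset sel_subset in fastforce)
qed (auto split: if_splits)

lemma configs_subset: "configs T t p s \<subseteq> Pow (choices t p) \<times> Pow (cverts t)"
  using sel_subset by (fastforce simp: configs_def)

lemma finite_configs: "finite (configs T t p s)"
  by (rule finite_subset[OF configs_subset]) (simp add: finite_choices finite_cverts)

lemma pair_set_eqI: "(\<And>x y. (x, y) \<in> A \<longleftrightarrow> (x, y) \<in> B) \<Longrightarrow> A = B"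
  by auto

text \<open>The three terms are the three fates of \<open>v\<close>. Unselected, it contributes the
  empty configuration, unless it is a terminal. Selected and dead, it may lie on either side, hence
  the factor 2. Selected and live, its side is dictated by the state of \<open>i\<close>, which must
  not be 0.\<close>

lemma table_Introduce:
  "table T w (Introduce i v) p s =
     of_bool (v \<notin> T) + 2 * w (2 * p + 1) + (if s i = 0 then 0 else w (2 * p))"
proof -
  have C: "C \<subseteq> {2 * p, Suc (2 * p)} \<longleftrightarrow> C = {} \<or> C = {2 * p} \<or> C = {Suc (2 * p)} \<or> C = {2 * p, Suc (2 * p)}" for C
    by auto
  have "configs T (Introduce i v) p s =
     (if v \<in> T then {} else {({}, {})}) \<union> {({2 * p + 1}, {}), ({2 * p + 1}, {v})} \<union>
     (if s i = 0 then {} else {({2 * p}, if s i = 1 then {v} else {})})"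
    by (auto simp: configs_def choices_simps C uncut_def admits_def split: if_splits)
  then show ?thesis
    by (simp add: table_def weight_sum_def)
qed

lemma admits_empty [simp]: "admits c {} L"
  by (simp add: admits_def)

lemma admits_Un: "admits c (A \<union> B) L \<longleftrightarrow> admits c A L \<and> admits c B L"
  by (auto simp: admits_def)

text \<open>Class \<open>j\<close> becomes the union of the two old classes and class
  \<open>i\<close> becomes empty. Since \<open>admits\<close> turns a union into a conjunction, both
  old classes must lie below the state of \<open>j\<close>, and the state of \<open>i\<close>
  imposes nothing.\<close>

lemma table_Relabel: "table T w (Relabel i j t) p s = table T w t p (s(i := s j))"
proof -
  have ad: "(\<forall>l. admits (s l) (live (Relabel i j t) p C l) L) \<longleftrightarrow>
      (\<forall>l. admits ((s(i := s j)) l) (live t p C l) L)" for C L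
  proof
    assume l: "\<forall>l. admits (s l) (live (Relabel i j t) p C l) L"
    show "\<forall>l. admits ((s(i := s j)) l) (live t p C l) L"
    proof
      fix l
      show "admits ((s(i := s j)) l) (live t p C l) L"
        using spec[OF l, of l] spec[OF l, of j]
        by (cases "l = i"; cases "l = j"; simp add: admits_Un)
    qed
  next
    assume r: "\<forall>l. admits ((s(i := s j)) l) (live t p C l) L"
    show "\<forall>l. admits (s l) (live (Relabel i j t) p C l) L"
    proof
      fix l
      show "admits (s l) (live (Relabel i j t) p C l) L"
        using spec[OF r, of l] spec[OF r, of i]
        by (cases "l = i"; cases "l = j"; simp add: admits_Un split: if_splits)
    qed
  qed
  have ch: "C \<subseteq> choices (Relabel i j t) p \<and> valid T (Relabel i j t) p C \<longleftrightarrow>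
      C \<subseteq> choices t p \<and> valid T t p C" for C
    using root_not_in_choices[of p t] unfolding choices_simps valid.simps by blast
  have "configs T (Relabel i j t) p s = configs T t p (s(i := s j))"
  proof (rule pair_set_eqI)
    fix C L
    show "(C, L) \<in> configs T (Relabel i j t) p s \<longleftrightarrow> (C, L) \<in> configs T t p (s(i := s j))"
      using ch[of C] ad[of C L] unfolding configs_def mem_Collect_eq sel.simps used_edges.simps
      by (simp only: prod.case) blast
  qed
  then show ?thesis by (simp add: table_def)
qed

text \<open>This is where summing over all states below \<open>s\<close> pays off:
  \<open>admits\<close> for the union of two live classes splits into independent conditions on the
  two sides, so no convolution over pairs of states arises.\<close>

lemma table_Oplus:
  assumes "cverts t \<inter> cverts u = {}"
  shows "table T w (Oplus t u) p s = table T w t p s * table T w u (p + nodes t) s"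
proof -
  let ?q = "p + nodes t" and ?I = "choices t p" and ?J = "choices u (p + nodes t)"
  \<comment> \<open>\<open>?h\<close> glues two configurations and \<open>?g\<close> cuts one apart;
    they are inverse to each other because both the choice blocks and the vertex sets of the
    children are disjoint.\<close>
  let ?h = "\<lambda>((C, L), (C', L')). (C \<union> C', L \<union> L')"
  let ?g = "\<lambda>(C, L). ((C \<inter> ?I, L \<inter> cverts t), (C \<inter> ?J, L \<inter> cverts u))"
  have IJ: "?I \<inter> ?J = {}" by (auto simp: choices_def)
  have ex: "(C \<union> C', L \<union> L') \<in> configs T (Oplus t u) p s \<longleftrightarrow>
      (C, L) \<in> configs T t p s \<and> (C', L') \<in> configs T u ?q s"
    if sub: "C \<subseteq> ?I" "C' \<subseteq> ?J" "L \<subseteq> cverts t" "L' \<subseteq> cverts u" for C C' L L'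
  proof -
    let ?D = "C \<union> C'"
    have cg: "?D \<inter> ?I = C \<inter> ?I" "?D \<inter> ?J = C' \<inter> ?J" using sub IJ by auto
    note cong = sel_cong[OF cg(1)] sel_cong[OF cg(2)] live_cong[OF cg(1)] live_cong[OF cg(2)]
      used_edges_cong[OF cg(1)] used_edges_cong[OF cg(2)] valid_cong[OF cg(1)] valid_cong[OF cg(2)]
    have s1: "L \<union> L' \<subseteq> sel t p C \<union> sel u ?q C' \<longleftrightarrow> L \<subseteq> sel t p C \<and> L' \<subseteq> sel u ?q C'"
      using sub assms sel_subset[of t p C] sel_subset[of u ?q C'] by blast
    have mem: "x \<in> L \<union> L' \<longleftrightarrow> x \<in> L" if "x \<in> sel t p C" for x
      using that sub assms sel_subset[of t p C] by auto
    have mem': "x \<in> L \<union> L' \<longleftrightarrow> x \<in> L'" if "x \<in> sel u ?q C'" for x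
      using that sub assms sel_subset[of u ?q C'] by auto
    have e1: "uncut (used_edges t p C) (L \<union> L') \<longleftrightarrow> uncut (used_edges t p C) L"
      unfolding uncut_def using used_edges_subset[of t p C] mem by blast
    have e2: "uncut (used_edges u ?q C') (L \<union> L') \<longleftrightarrow> uncut (used_edges u ?q C') L'"
      unfolding uncut_def using used_edges_subset[of u ?q C'] mem' by blast
    have a1: "admits c (live t p C l) (L \<union> L') \<longleftrightarrow> admits c (live t p C l) L" for c l
      unfolding admits_def using live_subset[of t p C l] mem by auto
    have a2: "admits c (live u ?q C' l) (L \<union> L') \<longleftrightarrow> admits c (live u ?q C' l) L'" for c l
      unfolding admits_def using live_subset[of u ?q C' l] mem' by auto
    have un: "uncut (A \<union> B) M \<longleftrightarrow> uncut A M \<and> uncut B M" for A B and M :: "'a set"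
      by (auto simp: uncut_def)
    have ch: "?D \<subseteq> choices (Oplus t u) p" "2 * (p + nodes t + nodes u) \<notin> ?D"
        "2 * (p + nodes t + nodes u) + 1 \<notin> ?D"
      using sub by (auto simp: choices_def)
    show ?thesis
      unfolding configs_def mem_Collect_eq prod.case sel.simps valid.simps live.simps used_edges.simps
        cong s1 admits_Un un e1 e2 a1 a2
      using ch sub by auto
  qed
  have "table T w (Oplus t u) p s = (\<Sum>x\<in>configs T (Oplus t u) p s. \<Prod>v\<in>fst x. w v)"
    by (simp add: table_def weight_sum_def case_prod_beta)
  also have "\<dots> = (\<Sum>y\<in>configs T t p s \<times> configs T u ?q s. \<Prod>v\<in>fst (?h y). w v)"
  proof (rule sum.reindex_bij_witness[of _ ?h ?g])
    fix x assume x: "x \<in> configs T (Oplus t u) p s"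
    obtain C L where CL: "x = (C, L)" by fastforce
    have C: "C \<subseteq> choices (Oplus t u) p" "valid T (Oplus t u) p C" and L: "L \<subseteq> sel (Oplus t u) p C"
      using x CL by (auto simp: configs_def simp del: sel.simps valid.simps)
    have "C \<subseteq> ?I \<union> ?J" using C unfolding choices_simps valid.simps by blast
    moreover have "L \<subseteq> cverts t \<union> cverts u"
      using L sel_subset[of "Oplus t u" p C] by (metis cverts.simps(2) subset_trans)
    ultimately show g: "?h (?g x) = x" using CL by auto
    have "(C \<inter> ?I \<union> C \<inter> ?J, L \<inter> cverts t \<union> L \<inter> cverts u) \<in> configs T (Oplus t u) p s"
      using g x CL by simp
    then show "?g x \<in> configs T t p s \<times> configs T u ?q s"
      using CL ex[of "C \<inter> ?I" "C \<inter> ?J" "L \<inter> cverts t" "L \<inter> cverts u"] by simp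
    show "(\<Prod>v\<in>fst (?h (?g x)). w v) = (\<Prod>v\<in>fst x. w v)" using g by simp
  next
    fix y assume y: "y \<in> configs T t p s \<times> configs T u ?q s"
    obtain C L C' L' where CL: "y = ((C, L), (C', L'))" by (metis prod.exhaust)
    have sub: "C \<subseteq> ?I" "C' \<subseteq> ?J" "L \<subseteq> cverts t" "L' \<subseteq> cverts u"
      using y CL sel_subset by (fastforce simp: configs_def)+
    show "?h y \<in> configs T (Oplus t u) p s" using ex[OF sub] y CL by simp
    show "?g (?h y) = y" using sub IJ assms CL by auto
  qed
  also have "\<dots> = (\<Sum>y\<in>configs T t p s \<times> configs T u ?q s. (\<Prod>v\<in>fst (fst y). w v) * (\<Prod>v\<in>fst (snd y). w v))"
  proof (rule sum.cong[OF refl])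
    fix y assume y: "y \<in> configs T t p s \<times> configs T u ?q s"
    obtain C L C' L' where CL: "y = ((C, L), (C', L'))" by (metis prod.exhaust)
    have sub: "C \<subseteq> ?I" "C' \<subseteq> ?J" using y CL by (auto simp: configs_def)
    have "(\<Prod>v\<in>C \<union> C'. w v) = (\<Prod>v\<in>C. w v) * (\<Prod>v\<in>C'. w v)"
      using sub IJ finite_choices finite_subset by (intro prod.union_disjoint) blast+
    then show "(\<Prod>v\<in>fst (?h y). w v) = (\<Prod>v\<in>fst (fst y). w v) * (\<Prod>v\<in>fst (snd y). w v)"
      using CL by simp
  qed
  also have "\<dots> = table T w t p s * table T w u ?q s"
    by (simp add: table_def weight_sum_def case_prod_beta sum_product sum.cartesian_product)
  finally show ?thesis .
qed

text \<open>Separates the decisions \<open>D\<close> of the root from those below it. For a join,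
  \<open>D\<close> consists of its two death choices, so the sum has four terms.\<close>

lemma weight_sum_split:
  assumes "finite A" "finite I" "finite D" "I \<inter> D = {}" and sub: "\<And>C L. (C, L) \<in> A \<Longrightarrow> C \<subseteq> I \<union> D"
  shows "weight_sum w A = (\<Sum>B\<in>Pow D. (\<Prod>u\<in>B. w u) * weight_sum w {(C, L). C \<subseteq> I \<and> (C \<union> B, L) \<in> A})"
proof -
  let ?S = "\<lambda>B. {(C, L). C \<subseteq> I \<and> (C \<union> B, L) \<in> A}"
  have fin: "finite (?S B)" for B
  proof (rule finite_subset)
    show "?S B \<subseteq> Pow I \<times> snd ` A" by force
  qed (use assms in auto)
  have "weight_sum w A = (\<Sum>x\<in>A. \<Prod>u\<in>fst x. w u)"
    by (simp add: weight_sum_def case_prod_beta)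
  also have "\<dots> = (\<Sum>y\<in>Sigma (Pow D) ?S. (\<Prod>u\<in>fst y. w u) * (\<Prod>u\<in>fst (snd y). w u))"
  proof (rule sum.reindex_bij_witness[of _ "\<lambda>(B, (C, L)). (C \<union> B, L)" "\<lambda>(C, L). (C \<inter> D, (C \<inter> I, L))"])
    fix x assume "x \<in> A"
    moreover obtain C L where x: "x = (C, L)" by fastforce
    ultimately have C: "C \<subseteq> I \<union> D" "(C, L) \<in> A" using sub by auto
    then have eq: "C \<inter> I \<union> C \<inter> D = C" by blast
    show "(case case x of (C, L) \<Rightarrow> (C \<inter> D, C \<inter> I, L) of (B, C, L) \<Rightarrow> (C \<union> B, L)) = x"
      using eq x by simp
    show "(case x of (C, L) \<Rightarrow> (C \<inter> D, C \<inter> I, L)) \<in> Sigma (Pow D) ?S"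
      using eq x C by simp
    have "finite C" using C(1) assms(2,3) finite_subset by blast
    then have "prod w (C \<inter> D) * prod w (C \<inter> I) = prod w (C \<inter> D \<union> C \<inter> I)"
      using assms(4) by (intro prod.union_disjoint[symmetric]) auto
    then show "(\<Prod>u\<in>fst (case x of (C, L) \<Rightarrow> (C \<inter> D, C \<inter> I, L)). w u) *
         (\<Prod>u\<in>fst (snd (case x of (C, L) \<Rightarrow> (C \<inter> D, C \<inter> I, L))). w u) = (\<Prod>u\<in>fst x. w u)"
      using x eq by (simp add: Un_commute)
  next
    fix y assume y: "y \<in> Sigma (Pow D) ?S"
    obtain B C L where B: "y = (B, (C, L))" by (metis prod.exhaust)
    have "B \<subseteq> D" "C \<subseteq> I" "(C \<union> B, L) \<in> A" using y B by auto
    moreover from this have "(C \<union> B) \<inter> D = B" "(C \<union> B) \<inter> I = C" using assms(4) by blast+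
    ultimately show "(case y of (B, C, L) \<Rightarrow> (C \<union> B, L)) \<in> A"
        "(case case y of (B, C, L) \<Rightarrow> (C \<union> B, L) of (C, L) \<Rightarrow> (C \<inter> D, C \<inter> I, L)) = y"
      using B by auto
  qed
  also have "\<dots> = (\<Sum>B\<in>Pow D. \<Sum>x\<in>?S B. (\<Prod>u\<in>B. w u) * (\<Prod>u\<in>fst x. w u))"
    using assms(3) fin by (subst sum.Sigma) (auto simp: case_prod_beta)
  also have "\<dots> = (\<Sum>B\<in>Pow D. (\<Prod>u\<in>B. w u) * weight_sum w (?S B))"
    by (simp add: weight_sum_def case_prod_beta sum_distrib_left)
  finally show ?thesis .
qed

lemma weight_sum_Un:
  "finite A \<Longrightarrow> finite B \<Longrightarrow> weight_sum w (A \<union> B) + weight_sum w (A \<inter> B) = weight_sum w A + weight_sum w B"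
  unfolding weight_sum_def by (rule sum.union_inter)

text \<open>A nonzero state also admits an empty class, whereas a join constrains cuts and permits
  deaths only if both classes have live vertices.\<close>

definition joined :: "'v set \<Rightarrow> 'v cexpr \<Rightarrow> nat \<Rightarrow> nat \<Rightarrow> nat \<Rightarrow> (nat \<Rightarrow> nat) \<Rightarrow> (nat set \<times> 'v set) set" where
  "joined T t p i j s = {(C, L) \<in> configs T t p s. live t p C i \<noteq> {} \<and> live t p C j \<noteq> {}}"

lemma finite_joined: "finite (joined T t p i j s)"
  by (rule finite_subset[OF _ finite_configs]) (auto simp: joined_def)

text \<open>Inclusion-exclusion over the two events that a label class has no live vertex.\<close>

lemma weight_sum_joined:
  assumes "i \<noteq> j" "s i \<noteq> 0" "s j \<noteq> 0"
  shows "table T w t p s + table T w t p (s(i := 0, j := 0)) =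
    weight_sum w (joined T t p i j s) + (table T w t p (s(j := 0)) + table T w t p (s(i := 0)))"
proof -
  let ?c = "configs T t p" and ?J = "joined T t p i j s"
  have ad: "(\<forall>l. admits ((s'(a := 0)) l) (A l) L) \<longleftrightarrow> (\<forall>l. admits (s' l) (A l) L) \<and> A a = {}"
    for s' :: "nat \<Rightarrow> nat" and a and A :: "nat \<Rightarrow> 'a set" and L
    by (auto simp: admits_def)
  have sub: "?c (s'(a := 0)) = {(C, L) \<in> ?c s'. live t p C a = {}}" for s' a
    unfolding configs_def using ad[of s' a] by auto
  have un: "?c s = ?J \<union> (?c (s(j := 0)) \<union> ?c (s(i := 0)))"
    unfolding joined_def sub by auto
  have int: "?c (s(j := 0)) \<inter> ?c (s(i := 0)) = ?c (s(i := 0, j := 0))"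
    unfolding sub by auto
  have disj: "?J \<inter> (?c (s(j := 0)) \<union> ?c (s(i := 0))) = {}"
    unfolding joined_def sub by auto
  have "weight_sum w (?c s) = weight_sum w ?J + weight_sum w (?c (s(j := 0)) \<union> ?c (s(i := 0)))"
    using weight_sum_Un[OF finite_joined finite_UnI[OF finite_configs finite_configs],
        of w T t p i j s T t p "s(j := 0)" T t p "s(i := 0)"] un disj
    by (simp add: weight_sum_def)
  then show ?thesis
    using weight_sum_Un[OF finite_configs finite_configs, of w T t p "s(j := 0)" T t p "s(i := 0)"] int
    by (simp add: table_def)
qed

lemma uncut_Times:
  assumes "A \<noteq> {}" "B \<noteq> {}"
  shows "uncut (A \<times> B) L \<longleftrightarrow> admits 1 A L \<and> admits 1 B L \<or> admits 2 A L \<and> admits 2 B L"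
  using assms unfolding uncut_def admits_def by auto

lemma uncut_Times_empty: "A = {} \<or> B = {} \<Longrightarrow> uncut (A \<times> B) L"
  by (auto simp: uncut_def)

lemma uncut_Un: "uncut (A \<union> B) L \<longleftrightarrow> uncut A L \<and> uncut B L"
  by (auto simp: uncut_def)

lemma admits_exclusive: "admits 1 A L \<Longrightarrow> admits 2 A L \<Longrightarrow> A = {}"
  by (auto simp: admits_def)

text \<open>The cases are which of the two classes die. If none dies, all configurations of
  \<open>t\<close> survive except those with both classes nonempty on opposite sides; opposite sides
  mean states 1 and 2, i.e. \<open>s i * s j = 2\<close>. If exactly one dies, the state of the
  survivor fixes the common side of both. If both die, either side is possible. By
  inclusion-exclusion, \<open>f a b\<close> counts the configurations with both classes
  nonempty.\<close>

lemma table_Join: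
  fixes T :: "'v set" and w :: "nat \<Rightarrow> nat" and t :: "'v cexpr" and p :: nat
  assumes "i \<noteq> j" "s i < 3" "s j < 3"
  defines "f \<equiv> \<lambda>a b. table T w t p (s(i := a, j := b)) + table T w t p (s(i := 0, j := 0)) -
      (table T w t p (s(i := a, j := 0)) + table T w t p (s(i := 0, j := b)))"
  defines "\<alpha> \<equiv> w (2 * (p + nodes t))" and "\<beta> \<equiv> w (2 * (p + nodes t) + 1)"
  shows "table T w (Join i j t) p s =
    table T w t p s - of_bool (s i * s j = 2) * f (s i) (s j) +
      f 1 1 * (\<alpha> * of_bool (s j = 1) + \<beta> * of_bool (s i = 1) + \<alpha> * \<beta>) +
      f 2 2 * (\<alpha> * of_bool (s j = 2) + \<beta> * of_bool (s i = 2) + \<alpha> * \<beta>)"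
proof -
  let ?a = "2 * (p + nodes t)" and ?b = "2 * (p + nodes t) + 1"
  let ?J = "\<lambda>x y. joined T t p i j (s(i := x, j := y))"
  let ?A = "configs T (Join i j t) p s"
  let ?S = "\<lambda>D. {(C, L). C \<subseteq> choices t p \<and> (C \<union> D, L) \<in> ?A}"
  define base where "base C L \<longleftrightarrow> C \<subseteq> choices t p \<and> L \<subseteq> sel t p C \<and> valid T t p C \<and>
     uncut (used_edges t p C) L \<and> (\<forall>l. l \<noteq> i \<and> l \<noteq> j \<longrightarrow> admits (s l) (live t p C l) L)" for C L
  have f: "f x y = weight_sum w (?J x y)" if "x \<noteq> 0" "y \<noteq> 0" for x y
    using weight_sum_joined[of i j "s(i := x, j := y)" T w t p] that assms(1)
    by (simp add: f_def fun_upd_twist)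
  have c: "(C, L) \<in> configs T t p (s(i := x, j := y)) \<longleftrightarrow>
      base C L \<and> admits x (live t p C i) L \<and> admits y (live t p C j) L" for C L x y
    using assms(1) unfolding configs_def base_def by auto
  have J: "(C, L) \<in> ?J x y \<longleftrightarrow> base C L \<and> admits x (live t p C i) L \<and> admits y (live t p C j) L \<and>
      live t p C i \<noteq> {} \<and> live t p C j \<noteq> {}" for C L x y
    using c[of C L x y] by (auto simp: joined_def)
  have S: "(C, L) \<in> ?S D \<longleftrightarrow> base C L \<and> (live t p C i = {} \<or> live t p C j = {} \<longrightarrow> D = {}) \<and>
       uncut (live t p C i \<times> live t p C j) L \<and>
       (?a \<in> D \<or> admits (s i) (live t p C i) L) \<and> (?b \<in> D \<or> admits (s j) (live t p C j) L)"
    if D: "D \<subseteq> {?a, ?b}" for C D L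
  proof (cases "C \<subseteq> choices t p")
    case C: True
    have ag: "(C \<union> D) \<inter> choices t p = C \<inter> choices t p"
      using D root_not_in_choices[of p t] by auto
    have ab: "?a \<in> C \<union> D \<longleftrightarrow> ?a \<in> D" "?b \<in> C \<union> D \<longleftrightarrow> ?b \<in> D"
      using C root_not_in_choices[of p t] by auto
    have D': "D = {} \<longleftrightarrow> ?a \<notin> D \<and> ?b \<notin> D" using D by blast
    have ch: "C \<union> D \<subseteq> choices (Join i j t) p" using C D by (auto simp: choices_simps)
    have ad: "(\<forall>l. admits (s l) (if l = i \<and> ?a \<in> D \<or> l = j \<and> ?b \<in> D then {} else live t p C l) L) \<longleftrightarrow>
       (\<forall>l. l \<noteq> i \<and> l \<noteq> j \<longrightarrow> admits (s l) (live t p C l) L) \<and>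
       (?a \<in> D \<or> admits (s i) (live t p C i) L) \<and> (?b \<in> D \<or> admits (s j) (live t p C j) L)"
      using assms(1) by (auto split: if_splits)
    have "(C \<union> D, L) \<in> ?A \<longleftrightarrow> L \<subseteq> sel t p C \<and> valid T t p C \<and>
       (live t p C i = {} \<or> live t p C j = {} \<longrightarrow> D = {}) \<and>
       uncut (used_edges t p C) L \<and> uncut (live t p C i \<times> live t p C j) L \<and>
       (\<forall>l. admits (s l) (if l = i \<and> ?a \<in> D \<or> l = j \<and> ?b \<in> D then {} else live t p C l) L)"
      unfolding configs_def mem_Collect_eq prod.case sel.simps valid.simps live.simps used_edges.simps
        ab uncut_Un choices_cong[OF ag] D' using ch by blast
    then show ?thesis unfolding ad base_def using C by auto
  next
    case False
    then show ?thesis by (simp add: base_def)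
  qed
  have si: "s i = 0 \<or> s i = 1 \<or> s i = 2" "s j = 0 \<or> s j = 1 \<or> s j = 2" using assms(2,3) by auto
  have ad0: "admits 0 A L \<longleftrightarrow> A = {}" for A and L :: "'v set" by (simp add: admits_def)
  let ?li = "\<lambda>C. live t p C i" and ?lj = "\<lambda>C. live t p C j"
  have cs: "(C, L) \<in> configs T t p s \<longleftrightarrow> base C L \<and> admits (s i) (?li C) L \<and> admits (s j) (?lj C) L" for C L
    using c[of C L "s i" "s j"] by simp
  have iff: "uncut (?li C \<times> ?lj C) L \<longleftrightarrow> ?li C = {} \<or> ?lj C = {} \<or>
      admits 1 (?li C) L \<and> admits 1 (?lj C) L \<or> admits 2 (?li C) L \<and> admits 2 (?lj C) L" for C L
    using uncut_Times[of "?li C" "?lj C" L] uncut_Times_empty[of "?li C" "?lj C" L] by blast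
  have ex: "A \<noteq> {} \<Longrightarrow> \<not> (admits 1 A L \<and> admits 2 A L)" for A and L :: "'v set"
    using admits_exclusive by blast
  have emp: "{} \<subseteq> {?a, ?b}" "{?a} \<subseteq> {?a, ?b}" "{?b} \<subseteq> {?a, ?b}" "{?a, ?b} \<subseteq> {?a, ?b}" by auto
  have sets: "?S {} = configs T t p s - (if s i * s j = 2 then ?J (s i) (s j) else {})"
    "?S {?a} = (if s j = 0 then {} else ?J (s j) (s j))"
    "?S {?b} = (if s i = 0 then {} else ?J (s i) (s i))"
    "?S {?a, ?b} = ?J 1 1 \<union> ?J 2 2"
  proof (rule_tac [!] pair_set_eqI, goal_cases)
    case (1 C L)
    show ?case
      unfolding S[OF emp(1)] Diff_iff cs if_distrib[of "\<lambda>A. (C, L) \<in> A"] J iff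
      using si ex[of "?li C" L] ex[of "?lj C" L] by (elim disjE) (simp_all add: ad0; blast)+
  next
    case (2 C L)
    show ?case
      unfolding S[OF emp(2)] if_distrib[of "\<lambda>A. (C, L) \<in> A"] J iff
      using si(2) ex[of "?li C" L] ex[of "?lj C" L] by (elim disjE) (simp_all add: ad0; blast)+
  next
    case (3 C L)
    show ?case
      unfolding S[OF emp(3)] if_distrib[of "\<lambda>A. (C, L) \<in> A"] J iff
      using si(1) ex[of "?li C" L] ex[of "?lj C" L] by (elim disjE) (simp_all add: ad0; blast)+
  next
    case (4 C L)
    show ?case unfolding S[OF emp(4)] Un_iff J iff by simp blast
  qed
  have nz: "s i * s j = 2 \<Longrightarrow> s i \<noteq> 0 \<and> s j \<noteq> 0" using si by auto
  \<comment> \<open>This inclusion makes the truncated subtraction on natural numbers an exact set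
    difference.\<close>
  have "(if s i * s j = 2 then ?J (s i) (s j) else {}) \<subseteq> configs T t p s"
    by (auto simp: joined_def)
  then have S0: "weight_sum w (?S {}) = table T w t p s - of_bool (s i * s j = 2) * f (s i) (s j)"
    using f[of "s i" "s j"] nz unfolding sets(1) table_def weight_sum_def
    by (subst sum_diff_nat) (auto intro: finite_joined)
  have S1: "weight_sum w (?S {?a}) = f 1 1 * of_bool (s j = 1) + f 2 2 * of_bool (s j = 2)"
    unfolding sets(2) using si(2) f[of 1 1] f[of 2 2] by (auto simp: weight_sum_def simp del: fun_upd_triv)
  have S2: "weight_sum w (?S {?b}) = f 1 1 * of_bool (s i = 1) + f 2 2 * of_bool (s i = 2)"
    unfolding sets(3) using si(1) f[of 1 1] f[of 2 2] by (auto simp: weight_sum_def simp del: fun_upd_triv)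
  have "?J 1 1 \<inter> ?J 2 2 = {}"
  proof -
    have "\<not> ((C, L) \<in> ?J 1 1 \<and> (C, L) \<in> ?J 2 2)" for C L
      unfolding J using admits_exclusive by blast
    then show ?thesis by (metis disjoint_iff surj_pair)
  qed
  then have S3: "weight_sum w (?S {?a, ?b}) = f 1 1 + f 2 2"
    using weight_sum_Un[OF finite_joined finite_joined, of w T t p i j "s(i := 1, j := 1)" T t p i j "s(i := 2, j := 2)"]
      f[of 1 1] f[of 2 2] unfolding sets(4) by (simp add: weight_sum_def)
  have "table T w (Join i j t) p s = (\<Sum>B\<in>Pow {?a, ?b}. (\<Prod>u\<in>B. w u) * weight_sum w (?S B))"
    unfolding table_def
  proof (rule weight_sum_split[OF finite_configs finite_choices])
    show "choices t p \<inter> {?a, ?b} = {}" using root_not_in_choices[of p t] by blast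
    show "C \<subseteq> choices t p \<union> {?a, ?b}" if "(C, L) \<in> ?A" for C L
      using that by (auto simp: configs_def choices_simps)
  qed simp
  also have "Pow {?a, ?b} = {{}, {?a}, {?b}, {?a, ?b}}" by (auto simp: Pow_insert)
  also have "(\<Sum>B\<in>\<dots>. (\<Prod>u\<in>B. w u) * weight_sum w (?S B)) =
     weight_sum w (?S {}) + \<alpha> * weight_sum w (?S {?a}) + \<beta> * weight_sum w (?S {?b}) +
       \<alpha> * \<beta> * weight_sum w (?S {?a, ?b})"
    by (simp add: \<alpha>_def \<beta>_def doubleton_eq_iff insert_commute)
  finally show ?thesis unfolding S0 S1 S2 S3 by (simp add: algebra_simps)
qed

section \<open>Parity of the number of cuts\<close>

definition cuts :: "'v set \<Rightarrow> ('v \<times> 'v) set \<Rightarrow> 'v set set" where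
  "cuts X E = {L. L \<subseteq> X \<and> uncut E L}"

lemma finite_cuts: "finite X \<Longrightarrow> finite (cuts X E)"
  by (rule finite_subset[of _ "Pow X"]) (auto simp: cuts_def)

text \<open>Complementation within \<open>X\<close> exchanges the cuts that contain a fixed vertex
  with those that avoid it.\<close>

lemma even_card_cuts:
  assumes "finite X" "X \<noteq> {}" "E \<subseteq> X \<times> X"
  shows "even (card (cuts X E))"
proof -
  obtain x where x: "x \<in> X" using assms(2) by blast
  let ?A = "{L \<in> cuts X E. x \<in> L}" and ?B = "{L \<in> cuts X E. x \<notin> L}"
  have compl: "X - L \<in> cuts X E" if "L \<in> cuts X E" for L
    using that assms(3) unfolding cuts_def uncut_def by blast
  have "bij_betw (\<lambda>L. X - L) ?A ?B"
  proof (rule bij_betwI[of _ _ _ "\<lambda>L. X - L"])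
    show "(\<lambda>L. X - L) \<in> ?A \<rightarrow> ?B" using compl x by auto
    show "(\<lambda>L. X - L) \<in> ?B \<rightarrow> ?A" using compl x by auto
  qed (auto simp: cuts_def)
  then have "card ?A = card ?B" by (rule bij_betw_same_card)
  moreover have "card (cuts X E) = card ?A + card ?B"
    using finite_cuts[OF assms(1), of E]
    by (subst card_Un_disjoint[symmetric]) (auto intro: arg_cong[of _ _ card])
  ultimately show ?thesis by simp
qed

lemma card_cuts_Un:
  assumes "finite A" "finite B" "A \<inter> B = {}" "E \<subseteq> A \<times> A" "F \<subseteq> B \<times> B"
  shows "card (cuts (A \<union> B) (E \<union> F)) = card (cuts A E) * card (cuts B F)"
proof -
  have "bij_betw (\<lambda>(L, M). L \<union> M) (cuts A E \<times> cuts B F) (cuts (A \<union> B) (E \<union> F))"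
  proof (rule bij_betwI[of _ _ _ "\<lambda>L. (L \<inter> A, L \<inter> B)"])
    show "(\<lambda>(L, M). L \<union> M) \<in> cuts A E \<times> cuts B F \<rightarrow> cuts (A \<union> B) (E \<union> F)"
    proof clarify
      fix L M assume LM: "L \<in> cuts A E" "M \<in> cuts B F"
      have "x \<in> L \<union> M \<longleftrightarrow> y \<in> L \<union> M" if "(x, y) \<in> E \<union> F" for x y
        using that LM assms(3-5) unfolding cuts_def uncut_def by blast
      then show "L \<union> M \<in> cuts (A \<union> B) (E \<union> F)"
        using LM unfolding cuts_def uncut_def by blast
    qed
    show "(\<lambda>L. (L \<inter> A, L \<inter> B)) \<in> cuts (A \<union> B) (E \<union> F) \<rightarrow> cuts A E \<times> cuts B F"
    proof
      fix L assume L: "L \<in> cuts (A \<union> B) (E \<union> F)"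
      have "x \<in> L \<inter> A \<longleftrightarrow> y \<in> L \<inter> A" if "(x, y) \<in> E" for x y
        using that L assms(4) unfolding cuts_def uncut_def by blast
      moreover have "x \<in> L \<inter> B \<longleftrightarrow> y \<in> L \<inter> B" if "(x, y) \<in> F" for x y
        using that L assms(5) unfolding cuts_def uncut_def by blast
      ultimately show "(L \<inter> A, L \<inter> B) \<in> cuts A E \<times> cuts B F"
        unfolding cuts_def uncut_def by blast
    qed
  qed (use assms(3) in \<open>auto simp: cuts_def\<close>)
  from bij_betw_same_card[OF this] show ?thesis by (simp add: card_cartesian_product)
qed

lemma uncut_rtrancl:
  assumes "uncut E L" "(x, y) \<in> (E \<union> E\<inverse>)\<^sup>*"
  shows "x \<in> L \<longleftrightarrow> y \<in> L"
  using assms(2) by induction (use assms(1) in \<open>auto simp: uncut_def\<close>)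

lemma card_cuts_connected:
  assumes "X \<noteq> {}" "E \<subseteq> X \<times> X" "\<And>x y. x \<in> X \<Longrightarrow> y \<in> X \<Longrightarrow> (x, y) \<in> (E \<union> E\<inverse>)\<^sup>*"
  shows "card (cuts X E) = 2"
proof -
  have "L = {} \<or> L = X" if "L \<in> cuts X E" for L
    using that assms(3) uncut_rtrancl[of E L] unfolding cuts_def by blast
  moreover have "{} \<in> cuts X E" "X \<in> cuts X E"
    using assms(2) by (auto simp: cuts_def uncut_def)
  ultimately have "cuts X E = {{}, X}" by blast
  then show ?thesis using assms(1) by simp
qed

text \<open>The component of \<open>x\<close> and the rest of \<open>X\<close> are both nonempty,
  and no edge runs between them. The number of cuts is the product of their two numbers of cuts,
  each of which is even.\<close>

lemma card_cuts_disconnected: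
  assumes "finite X" "E \<subseteq> X \<times> X" "x \<in> X" "y \<in> X" "(x, y) \<notin> (E \<union> E\<inverse>)\<^sup>*"
  shows "4 dvd card (cuts X E)"
proof -
  define A where "A = {z \<in> X. (x, z) \<in> (E \<union> E\<inverse>)\<^sup>*}"
  have cl: "a \<in> A \<longleftrightarrow> b \<in> A" if "(a, b) \<in> E" for a b
  proof -
    have "(x, a) \<in> (E \<union> E\<inverse>)\<^sup>* \<longleftrightarrow> (x, b) \<in> (E \<union> E\<inverse>)\<^sup>*"
      using that by (meson UnI1 UnI2 converse_iff rtrancl.rtrancl_into_rtrancl)
    then show ?thesis using that assms(2) by (auto simp: A_def)
  qed
  have A: "A \<subseteq> X" "A \<noteq> {}" "X - A \<noteq> {}" "finite A"
    using assms finite_subset[of A X] by (auto simp: A_def)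
  let ?E = "E \<inter> A \<times> A" and ?F = "E \<inter> (X - A) \<times> (X - A)"
  have "E = ?E \<union> ?F" using cl assms(2) by blast
  then have "card (cuts X E) = card (cuts (A \<union> (X - A)) (?E \<union> ?F))"
    using A(1) by (simp add: Un_absorb1)
  also have "\<dots> = card (cuts A ?E) * card (cuts (X - A) ?F)"
    using A assms(1) by (intro card_cuts_Un) auto
  finally have "card (cuts X E) = card (cuts A ?E) * card (cuts (X - A) ?F)" .
  moreover have "even (card (cuts A ?E))" "even (card (cuts (X - A) ?F))"
    using A assms(1) by (auto intro!: even_card_cuts)
  ultimately show ?thesis using mult_dvd_mono[of 2 _ 2] by fastforce
qed

section \<open>Used edges against edges of the graph\<close>

lemma used_edges_cedges:
  "well_formed t \<Longrightarrow> (x, y) \<in> used_edges t p C \<Longrightarrow> {x, y} \<in> cedges t"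
proof (induction t arbitrary: p)
  case (Join i j t)
  show ?case
  proof (cases "(x, y) \<in> used_edges t p C")
    case False
    then have xy: "x \<in> live t p C i" "y \<in> live t p C j" using Join.prems by auto
    then have "x \<in> cverts t" "y \<in> cverts t" "clab t x = i" "clab t y = j"
      using live_subset[of t p C] sel_subset[of t p C] live_clab[of t] Join.prems by auto
    then show ?thesis by auto
  qed (use Join in auto)
qed auto

text \<open>
  The argument \<open>J\<close> of \<open>canonical\<close> is the set of labels that the context of \<open>t\<close> joins with some
  label class that meets \<open>X\<close>.
\<close>

fun canonical :: "'v set \<Rightarrow> 'v cexpr \<Rightarrow> nat \<Rightarrow> nat set \<Rightarrow> nat set" where
  "canonical X (Introduce i v) p J = (if v \<notin> X then {} else if i \<in> J then {2 * p} else {2 * p + 1})"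
| "canonical X (Oplus t u) p J = canonical X t p J \<union> canonical X u (p + nodes t) J"
| "canonical X (Relabel i j t) p J = canonical X t p {l. (if l = i then j else l) \<in> J}"
| "canonical X (Join i j t) p J =
     (let I = {l. \<exists>x \<in> X \<inter> cverts t. clab t x = l} in
      canonical X t p (J \<union> {l. l = i \<and> j \<in> I \<or> l = j \<and> i \<in> I}) \<union>
      (if i \<in> I \<and> j \<in> I then {2 * (p + nodes t) | x::unit. i \<notin> J} \<union> {2 * (p + nodes t) + 1 | x::unit. j \<notin> J}
       else {}))"

lemma canonical_subset: "canonical X t p J \<subseteq> choices t p"
proof (induction t arbitrary: p J)
  case (Join i j t)
  then show ?case by (auto simp: choices_simps Let_def split: if_splits)
qed (force simp: choices_simps split: if_splits)+

text \<open>The induction works because \<open>J\<close> describes liveness exactly: a class is live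
  in full if its label is in \<open>J\<close>, and has no live vertex otherwise. Below a join of two
  classes that both meet \<open>X\<close>, both labels belong to the set, so all edges of the join
  inside \<open>X\<close> are used and the deaths are legal; afterwards a class dies unless a later
  join still needs it.\<close>

lemma canonical_correct:
  assumes "well_formed t" "T \<inter> cverts t \<subseteq> X"
  shows "sel t p (canonical X t p J) = X \<inter> cverts t \<and>
     (\<forall>l. live t p (canonical X t p J) l = (if l \<in> J then {x \<in> X \<inter> cverts t. clab t x = l} else {})) \<and>
     valid T t p (canonical X t p J) \<and>
     (\<forall>x \<in> X. \<forall>y \<in> X. {x, y} \<in> cedges t \<longrightarrow>
        (x, y) \<in> used_edges t p (canonical X t p J) \<union> (used_edges t p (canonical X t p J))\<inverse>)"
  using assms
proof (induction t arbitrary: p J)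
  case (Introduce i v)
  then show ?case by auto
next
  case (Oplus t u)
  let ?C = "canonical X t p J" and ?D = "canonical X u (p + nodes t) J"
  let ?q = "p + nodes t" and ?r = "p + nodes t + nodes u"
  have dis: "choices t p \<inter> choices u ?q = {}" by (auto simp: choices_def)
  have ag: "(?C \<union> ?D) \<inter> choices t p = ?C \<inter> choices t p" "(?C \<union> ?D) \<inter> choices u ?q = ?D \<inter> choices u ?q"
    using canonical_subset[of X t p J] canonical_subset[of X u ?q J] dis by blast+
  have r: "2 * ?r \<notin> ?C \<union> ?D" "2 * ?r + 1 \<notin> ?C \<union> ?D"
    using canonical_subset[of X t p J] canonical_subset[of X u ?q J] by (auto simp: choices_def)
  have T: "T \<inter> cverts t \<subseteq> X" "T \<inter> cverts u \<subseteq> X" using Oplus.prems by auto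
  have wf: "well_formed t" "well_formed u" and d: "cverts t \<inter> cverts u = {}" using Oplus.prems by auto
  note IH = Oplus.IH(1)[OF wf(1) T(1), of p J] Oplus.IH(2)[OF wf(2) T(2), of ?q J]
  have lab: "{x \<in> X \<inter> cverts (Oplus t u). clab (Oplus t u) x = l} =
      {x \<in> X \<inter> cverts t. clab t x = l} \<union> {x \<in> X \<inter> cverts u. clab u x = l}" for l
    using d by auto
  show ?case
    unfolding canonical.simps sel.simps live.simps valid.simps used_edges.simps lab
      choices_cong[OF ag(1)] choices_cong[OF ag(2)] using IH r by auto
next
  case (Relabel i j t)
  \<comment> \<open>What is needed after a relabeling is pulled back to the labels before
    it.\<close>
  let ?J = "{l. (if l = i then j else l) \<in> J}"
  let ?C = "canonical X t p ?J"
  have "2 * (p + nodes t) \<notin> ?C" "2 * (p + nodes t) + 1 \<notin> ?C"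
    using canonical_subset[of X t p ?J] root_not_in_choices[of p t] by blast+
  moreover note Relabel.IH[of p ?J] Relabel.prems
  ultimately show ?case by auto
next
  case (Join i j t)
  define I where "I = {l. \<exists>x \<in> X \<inter> cverts t. clab t x = l}"
  define J' where "J' = J \<union> {l. l = i \<and> j \<in> I \<or> l = j \<and> i \<in> I}"
  let ?C = "canonical X t p J'" and ?a = "2 * (p + nodes t)" and ?b = "2 * (p + nodes t) + 1"
  \<comment> \<open>The dummy \<open>x::unit\<close> makes each comprehension a singleton or empty,
    depending on its condition.\<close>
  define D where "D = (if i \<in> I \<and> j \<in> I then {?a | x::unit. i \<notin> J} \<union> {?b | x::unit. j \<notin> J} else {})"
  have can: "canonical X (Join i j t) p J = ?C \<union> D"
    by (simp add: D_def J'_def I_def Let_def)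
  have ag: "(?C \<union> D) \<inter> choices t p = ?C \<inter> choices t p"
    using root_not_in_choices[of p t] by (auto simp: D_def)
  have ab: "?a \<in> ?C \<union> D \<longleftrightarrow> i \<in> I \<and> j \<in> I \<and> i \<notin> J" "?b \<in> ?C \<union> D \<longleftrightarrow> i \<in> I \<and> j \<in> I \<and> j \<notin> J"
    using canonical_subset[of X t p J'] root_not_in_choices[of p t] by (auto simp: D_def)
  have wf: "well_formed t" "i \<noteq> j" using Join.prems by auto
  have T: "T \<inter> cverts t \<subseteq> X" using Join.prems by simp
  note IH = Join.IH[OF wf(1) T, of p J']
  have lv: "live t p ?C l = (if l \<in> J' then {x \<in> X \<inter> cverts t. clab t x = l} else {})" for l
    using IH by blast
  have emp: "{x \<in> X \<inter> cverts t. clab t x = l} = {} \<longleftrightarrow> l \<notin> I" for l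
    by (auto simp: I_def)
  have J'_iff: "l \<in> J' \<longleftrightarrow> l \<in> J \<or> l = i \<and> j \<in> I \<or> l = j \<and> i \<in> I" for l
    by (simp add: J'_def)
  have lv': "(if l = i \<and> (i \<in> I \<and> j \<in> I \<and> i \<notin> J) \<or> l = j \<and> (i \<in> I \<and> j \<in> I \<and> j \<notin> J) then {} else live t p ?C l) =
     (if l \<in> J then {x \<in> X \<inter> cverts (Join i j t). clab (Join i j t) x = l} else {})" for l
    unfolding lv J'_iff cverts.simps clab.simps using emp[of l] by auto
  have vl: "live t p ?C i = {} \<or> live t p ?C j = {} \<longrightarrow>
     \<not> (i \<in> I \<and> j \<in> I \<and> i \<notin> J) \<and> \<not> (i \<in> I \<and> j \<in> I \<and> j \<notin> J)"
    unfolding lv J'_iff using emp by auto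
  have new: "(x, y) \<in> live t p ?C i \<times> live t p ?C j"
    if "x \<in> X" "y \<in> X" "x \<in> cverts t" "y \<in> cverts t" "clab t x = i" "clab t y = j" for x y
  proof -
    have "i \<in> I" "j \<in> I" using that by (auto simp: I_def)
    then show ?thesis using that unfolding lv J'_iff by auto
  qed
  have ed: "(x, y) \<in> (used_edges t p ?C \<union> live t p ?C i \<times> live t p ?C j) \<union>
      (used_edges t p ?C \<union> live t p ?C i \<times> live t p ?C j)\<inverse>"
    if xy: "x \<in> X" "y \<in> X" "{x, y} \<in> cedges (Join i j t)" for x y
  proof (cases "{x, y} \<in> cedges t")
    case True
    then show ?thesis using IH xy by blast
  next
    case False
    then obtain a b where "{x, y} = {a, b}" "a \<in> cverts t" "b \<in> cverts t" "clab t a = i" "clab t b = j"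
      using xy(3) by auto
    then show ?thesis using new[of a b] xy(1,2) by (auto simp: doubleton_eq_iff)
  qed
  show ?case
    unfolding can sel.simps live.simps valid.simps used_edges.simps ab choices_cong[OF ag] lv'
    using IH vl ed by simp
qed

section \<open>Counting selected vertices through the choices at introductions\<close>

fun intro_pos :: "'v cexpr \<Rightarrow> nat \<Rightarrow> nat set" where
  "intro_pos (Introduce i v) p = {p}"
| "intro_pos (Oplus t u) p = intro_pos t p \<union> intro_pos u (p + nodes t)"
| "intro_pos (Relabel i j t) p = intro_pos t p"
| "intro_pos (Join i j t) p = intro_pos t p"

lemma intro_pos_subset: "intro_pos t p \<subseteq> {p..<p + nodes t}"
  by (induction t arbitrary: p) fastforce+

lemma length_postfix: "length (postfix t) = 3 * nodes t"
  by (induction t) auto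

text \<open>The machine recognizes an introduction by its operation code 0; this ties that test to
  the structure of the expression.\<close>

lemma postfix_intro_pos:
  "q < nodes t \<Longrightarrow> postfix t ! (3 * q) = 0 \<longleftrightarrow> p + q \<in> intro_pos t p"
proof (induction t arbitrary: p q)
  case (Oplus t u)
  consider "q < nodes t" | "nodes t \<le> q" "q < nodes t + nodes u" | "q = nodes t + nodes u"
    using Oplus.prems by fastforce
  then show ?case
  proof cases
    case 1
    then have "p + q \<notin> intro_pos u (p + nodes t)" using intro_pos_subset[of u] by fastforce
    then show ?thesis using 1 Oplus.IH(1)[of q p] by (simp add: nth_append length_postfix)
  next
    case 2
    then have "p + q \<notin> intro_pos t p" using intro_pos_subset[of t] by fastforce
    moreover have "3 * q - 3 * nodes t = 3 * (q - nodes t)" "q - nodes t < nodes u" using 2 by auto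
    ultimately show ?thesis using 2 Oplus.IH(2)[of "q - nodes t" "p + nodes t"]
      by (simp add: nth_append length_postfix)
  next
    case 3
    then have "p + q \<notin> intro_pos t p" "p + q \<notin> intro_pos u (p + nodes t)"
      using intro_pos_subset[of t p] intro_pos_subset[of u "p + nodes t"] by fastforce+
    then show ?thesis using 3 by (simp add: nth_append length_postfix)
  qed
next
  case (Relabel i j t)
  then show ?case using intro_pos_subset[of t p]
    by (cases "q < nodes t") (fastforce simp: nth_append length_postfix less_Suc_eq)+
next
  case (Join i j t)
  then show ?case using intro_pos_subset[of t p]
    by (cases "q < nodes t") (fastforce simp: nth_append length_postfix less_Suc_eq)+
qed simp

text \<open>A valid choice set contains at most one of the two numbers of an introduction, so each
  selected vertex is counted once; death choices are filtered out by position. Weighting only the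
  choices at introductions therefore measures the size of \<open>X\<close>.\<close>

lemma card_intro_choices:
  assumes "well_formed t" "valid T t p C"
  shows "card {u \<in> C \<inter> choices t p. u div 2 \<in> intro_pos t p} = card (sel t p C)"
  using assms
proof (induction t arbitrary: p)
  case (Introduce i v)
  have eq: "{u \<in> C \<inter> choices (Introduce i v) p. u div 2 \<in> intro_pos (Introduce i v) p} = C \<inter> {2 * p, 2 * p + 1}"
    by (auto simp: choices_simps)
  have "2 * p \<notin> C \<or> 2 * p + 1 \<notin> C" using Introduce by simp
  then show ?case unfolding eq by (cases "2 * p \<in> C"; cases "2 * p + 1 \<in> C") auto
next
  case (Oplus t u)
  let ?q = "p + nodes t"
  have wf: "well_formed t" "well_formed u" "cverts t \<inter> cverts u = {}"
    and v: "valid T t p C" "valid T u ?q C" using Oplus.prems by auto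
  let ?A = "{z \<in> C \<inter> choices t p. z div 2 \<in> intro_pos t p}"
    and ?B = "{z \<in> C \<inter> choices u ?q. z div 2 \<in> intro_pos u ?q}"
  have "{z \<in> C \<inter> choices (Oplus t u) p. z div 2 \<in> intro_pos (Oplus t u) p} = ?A \<union> ?B"
    using intro_pos_subset[of t p] intro_pos_subset[of u ?q] by (fastforce simp: choices_def)
  moreover have "card (?A \<union> ?B) = card ?A + card ?B"
    by (rule card_Un_disjoint) (auto simp: choices_def)
  moreover have "card (sel t p C \<union> sel u ?q C) = card (sel t p C) + card (sel u ?q C)"
  proof (rule card_Un_disjoint)
    show "finite (sel t p C)" "finite (sel u ?q C)"
      using finite_subset[OF sel_subset finite_cverts] by blast+
    show "sel t p C \<inter> sel u ?q C = {}" using sel_subset[of t p C] sel_subset[of u ?q C] wf(3) by blast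
  qed
  ultimately show ?case using Oplus.IH(1)[OF wf(1) v(1)] Oplus.IH(2)[OF wf(2) v(2)] by simp
next
  case (Relabel i j t)
  have "{u \<in> C \<inter> choices (Relabel i j t) p. u div 2 \<in> intro_pos (Relabel i j t) p} =
      {u \<in> C \<inter> choices t p. u div 2 \<in> intro_pos t p}"
    using intro_pos_subset[of t p] by (fastforce simp: choices_def)
  then show ?case using Relabel by simp
next
  case (Join i j t)
  have "{u \<in> C \<inter> choices (Join i j t) p. u div 2 \<in> intro_pos (Join i j t) p} =
      {u \<in> C \<inter> choices t p. u div 2 \<in> intro_pos t p}"
    using intro_pos_subset[of t p] by (fastforce simp: choices_def)
  then show ?case using Join by simp
qed

section \<open>Isolation and coin tosses\<close>

fun block :: "(nat \<Rightarrow> bool) \<Rightarrow> nat \<Rightarrow> nat \<Rightarrow> nat" where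
  "block f a 0 = 0"
| "block f a (Suc l) = 2 * block f a l + of_bool (f (a + l))"

lemma block_less: "block f a l < 2 ^ l"
  by (induction l) (auto simp: of_bool_def)

lemma block_cong: "(\<And>i. a \<le> i \<Longrightarrow> i < a + l \<Longrightarrow> f i = g i) \<Longrightarrow> block f a l = block g a l"
  by (induction l) auto

lemma block_inj: "block f a l = block g a l \<Longrightarrow> i < l \<Longrightarrow> f (a + i) = g (a + i)"
proof (induction l)
  case (Suc l)
  have "f (a + l) = g (a + l) \<and> block f a l = block g a l"
    using Suc.prems(1) by (cases "f (a + l)"; cases "g (a + l)"; simp; presburger)
  then show ?case using Suc less_Suc_eq by auto
qed simp

definition isolated :: "nat set set \<Rightarrow> (nat \<Rightarrow> nat) \<Rightarrow> bool" where
  "isolated F r \<longleftrightarrow> (\<exists>A\<in>F. \<forall>B\<in>F. B \<noteq> A \<longrightarrow> sum r A < sum r B)"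

text \<open>
  If the minimum is attained both at a set containing \<open>u\<close> and at one not containing it, then the
  weight of \<open>u\<close> is determined by the other weights.
\<close>

lemma isolation:
  assumes "F \<noteq> {}" "\<And>A. A \<in> F \<Longrightarrow> A \<subseteq> {..<n}"
  shows "card {xs :: bool list. length xs = n * m \<and> \<not> isolated F (\<lambda>u. block (nth xs) (u * m) m)} * 2 ^ m
    \<le> n * 2 ^ (n * m)"
proof -
  define r where "r xs u = block (nth xs) (u * m) m" for xs :: "bool list" and u
  define amb where "amb u = {xs :: bool list. length xs = n * m \<and> (\<exists>A\<in>F. \<exists>B\<in>F. u \<in> A \<and> u \<notin> B \<and>
     sum (r xs) A = sum (r xs) B \<and> (\<forall>D\<in>F. sum (r xs) A \<le> sum (r xs) D))}" for u
  have finF: "finite F" by (rule finite_subset[of _ "Pow {..<n}"]) (use assms(2) in auto)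
  have finA: "finite A" if "A \<in> F" for A using assms(2)[OF that] finite_subset by blast
  have bad: "{xs. length xs = n * m \<and> \<not> isolated F (r xs)} \<subseteq> (\<Union>u<n. amb u)"
  proof clarify
    fix xs :: "bool list" assume xs: "length xs = n * m" "\<not> isolated F (r xs)"
    obtain A where A: "A \<in> F" "\<forall>D\<in>F. sum (r xs) A \<le> sum (r xs) D"
      using ex_min_if_finite[of "sum (r xs) ` F"] finF assms(1) by (auto simp: not_less)
    then obtain B where B: "B \<in> F" "B \<noteq> A" "\<not> sum (r xs) A < sum (r xs) B"
      using xs(2) unfolding isolated_def by blast
    then have B': "sum (r xs) B = sum (r xs) A" using A(2) by (simp add: order_antisym)
    obtain u where "u \<in> A \<and> u \<notin> B \<or> u \<in> B \<and> u \<notin> A" using B(2) by blast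
    moreover from this have "u < n" using A(1) B(1) assms(2) by blast
    ultimately show "xs \<in> (\<Union>u<n. amb u)"
      using A B(1) B' xs(1) unfolding amb_def mem_Collect_eq UN_iff by (metis lessThan_iff)
  qed
  have card_amb: "card (amb u) * 2 ^ m \<le> 2 ^ (n * m)" if u: "u < n" for u
  proof -
    have um: "u * m + m \<le> n * m"
      using u by (metis Suc_leI add.commute mult_Suc mult_le_mono1)
    \<comment> \<open>\<open>?g\<close> deletes the bits that encode the weight of \<open>u\<close>.
      Injectivity on \<open>amb u\<close> bounds its size by the number of strings that are
      \<open>m\<close> bits shorter.\<close>
    let ?g = "\<lambda>xs :: bool list. take (u * m) xs @ drop (u * m + m) xs"
    have "inj_on ?g (amb u)"
    proof (rule inj_onI)
      fix xs ys assume xs: "xs \<in> amb u" and ys: "ys \<in> amb u" and eq: "?g xs = ?g ys"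
      have len: "length xs = n * m" "length ys = n * m" using xs ys by (auto simp: amb_def)
      have td: "take (u * m) xs = take (u * m) ys" "drop (u * m + m) xs = drop (u * m + m) ys"
        using eq len by auto
      have out: "xs ! i = ys ! i" if i: "i < n * m" "i < u * m \<or> u * m + m \<le> i" for i
      proof (cases "i < u * m")
        case True
        then show ?thesis using arg_cong[OF td(1), of "\<lambda>zs. zs ! i"] by simp
      next
        case False
        then have "u * m + m + (i - (u * m + m)) = i" using i(2) by linarith
        then show ?thesis using arg_cong[OF td(2), of "\<lambda>zs. zs ! (i - (u * m + m))"] len um by simp
      qed
      have other: "r xs v = r ys v" if "v \<noteq> u" "v < n" for v
        unfolding r_def
      proof (rule block_cong)
        fix i assume i: "v * m \<le> i" "i < v * m + m"
        have "v * m + m \<le> n * m" using that(2) by (metis Suc_leI add.commute mult_Suc mult_le_mono1)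
        moreover have "i < u * m \<or> u * m + m \<le> i"
        proof (cases "v < u")
          case True
          then have "v * m + m \<le> u * m" by (metis Suc_leI add.commute mult_Suc mult_le_mono1)
          then show ?thesis using i by linarith
        next
          case False
          then have "u * m + m \<le> v * m" using that(1)
            by (metis Suc_leI add.commute mult_Suc mult_le_mono1 nat_neq_iff)
          then show ?thesis using i by linarith
        qed
        ultimately show "xs ! i = ys ! i" using i out by simp
      qed
      obtain A B where A: "A \<in> F" "B \<in> F" "u \<in> A" "u \<notin> B" "sum (r xs) A = sum (r xs) B"
        "\<And>D. D \<in> F \<Longrightarrow> sum (r xs) A \<le> sum (r xs) D"
        using xs unfolding amb_def by blast
      obtain A' B' where A': "A' \<in> F" "B' \<in> F" "u \<in> A'" "u \<notin> B'" "sum (r ys) A' = sum (r ys) B'"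
        "\<And>D. D \<in> F \<Longrightarrow> sum (r ys) A' \<le> sum (r ys) D"
        using ys unfolding amb_def by blast
      have same: "sum (r xs) D = sum (r ys) D" if "D \<in> F" "u \<notin> D" for D
        using that assms(2)[OF that(1)] by (intro sum.cong refl other) auto
      have sp: "sum (r xs) D = r xs u + sum (r ys) (D - {u}) \<and> sum (r ys) D = r ys u + sum (r ys) (D - {u})"
        if "D \<in> F" "u \<in> D" for D
      proof -
        have "sum (r xs) (D - {u}) = sum (r ys) (D - {u})"
          using assms(2)[OF that(1)] by (intro sum.cong refl other) auto
        then show ?thesis using that finA[OF that(1)] by (simp add: sum.remove)
      qed
      \<comment> \<open>For both strings, the minimum over sets avoiding \<open>u\<close> equals the
        minimum over sets containing \<open>u\<close>. The former is the same for both strings; the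
        latter is the weight of \<open>u\<close> plus a minimum that is also the same. So the two
        weights of \<open>u\<close> agree.\<close>
      have "r xs u = r ys u"
        using A(5) A(6)[OF A'(1)] A(6)[OF A'(2)] A'(5) A'(6)[OF A(1)] A'(6)[OF A(2)]
          same[OF A(2,4)] same[OF A'(2,4)] sp[OF A(1,3)] sp[OF A'(1,3)] by linarith
      then have inner: "xs ! (u * m + i) = ys ! (u * m + i)" if "i < m" for i
        using block_inj[of "nth xs" "u * m" m "nth ys" i] that by (simp add: r_def)
      show "xs = ys"
      proof (rule nth_equalityI)
        fix i assume i: "i < length xs"
        show "xs ! i = ys ! i"
        proof (cases "i < u * m \<or> u * m + m \<le> i")
          case True
          then show ?thesis using out[of i] i len by simp
        next
          case False
          then have "i - u * m < m" "u * m + (i - u * m) = i" by linarith+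
          then show ?thesis using inner[of "i - u * m"] by simp
        qed
      qed (use len in simp)
    qed
    moreover have "?g ` amb u \<subseteq> {xs. set xs \<subseteq> UNIV \<and> length xs = n * m - m}"
      using um by (auto simp: amb_def)
    ultimately have "card (amb u) \<le> card {xs :: bool list. set xs \<subseteq> UNIV \<and> length xs = n * m - m}"
      by (intro card_inj_on_le[of ?g] finite_lists_length_eq) auto
    also have "\<dots> = 2 ^ (n * m - m)" by (subst card_lists_length_eq) auto
    finally have "card (amb u) * 2 ^ m \<le> 2 ^ (n * m - m) * 2 ^ m" by simp
    also have "\<dots> = 2 ^ (n * m)" using um by (simp flip: power_add)
    finally show ?thesis .
  qed
  have fin: "finite (amb u)" for u
    by (rule finite_subset[OF _ finite_lists_length_eq[of "UNIV :: bool set" "n * m"]]) (auto simp: amb_def)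
  have "card {xs. length xs = n * m \<and> \<not> isolated F (r xs)} * 2 ^ m \<le> (\<Sum>u<n. card (amb u)) * 2 ^ m"
    using card_mono[OF _ bad] card_UN_le[of "{..<n}" amb] fin by (simp add: order_trans)
  also have "\<dots> \<le> (\<Sum>u<n. 2 ^ (n * m))"
    unfolding sum_distrib_right by (intro sum_mono card_amb) auto
  finally show ?thesis by (simp add: r_def[abs_def])
qed

section \<open>Events determined by finitely many coin tosses\<close>

lemma sets_coin_tosses: "sets coin_tosses = sets (stream_space (count_space UNIV))"
  unfolding coin_tosses_def by (intro sets_stream_space_cong) simp

lemma space_coin_tosses: "space coin_tosses = UNIV"
  unfolding coin_tosses_def by (simp add: space_stream_space)

lemma prob_space_coin_tosses: "prob_space coin_tosses"
  unfolding coin_tosses_def by (intro prob_space.prob_space_stream_space measure_pmf.prob_space_axioms)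

lemma sets_stake: "{\<omega>. P (stake n \<omega>)} \<in> sets coin_tosses"
proof -
  have "stake n -` {xs. P xs} \<inter> space (stream_space (count_space (UNIV :: bool set)))
      \<in> sets (stream_space (count_space UNIV))"
    by (rule measurable_sets[OF measurable_stake]) simp
  then show ?thesis by (simp add: sets_coin_tosses space_stream_space vimage_def)
qed

lemma measure_stake_eq:
  "emeasure coin_tosses {\<omega>. stake (length xs) \<omega> = xs} = ennreal (1 / 2 ^ length xs)"
proof (induction xs)
  case Nil
  then show ?case
    using prob_space.emeasure_space_1[OF prob_space_coin_tosses] by (simp add: space_coin_tosses)
next
  case (Cons x xs)
  let ?M = "measure_pmf (bernoulli_pmf (1 / 2))"
  let ?X = "{\<omega>. stake (length (x # xs)) \<omega> = x # xs}"
  have "emeasure coin_tosses ?X =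
      (\<integral>\<^sup>+ t. emeasure coin_tosses {\<omega> \<in> space coin_tosses. t ## \<omega> \<in> ?X} \<partial>?M)"
    unfolding coin_tosses_def
    by (rule prob_space.emeasure_stream_space[OF measure_pmf.prob_space_axioms])
       (use sets_stake[of "\<lambda>ys. ys = x # xs" "length (x # xs)"] in \<open>simp add: coin_tosses_def\<close>)
  also have "\<dots> = (\<integral>\<^sup>+ t. ennreal (1 / 2 ^ length xs) * indicator {x} t \<partial>?M)"
    by (intro nn_integral_cong) (auto simp: space_coin_tosses Cons.IH split: split_indicator)
  also have "\<dots> = ennreal (1 / 2 ^ length xs) * emeasure ?M {x}"
    by (subst nn_integral_cmult_indicator) auto
  also have "emeasure ?M {x} = ennreal (1 / 2)"
    by (cases x) (auto simp: emeasure_pmf_single)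
  also have "ennreal (1 / 2 ^ length xs) * ennreal (1 / 2) = ennreal (1 / 2 ^ length (x # xs))"
    by (subst ennreal_mult[symmetric]) (auto simp: mult.commute)
  finally show ?case .
qed

text \<open>Reduces probabilities to counting strings, the form in which the isolation lemma is
  stated.\<close>

lemma measure_stake:
  "measure coin_tosses {\<omega>. P (stake n \<omega>)} = real (card {xs. length xs = n \<and> P xs}) / 2 ^ n"
proof -
  interpret prob_space coin_tosses by (rule prob_space_coin_tosses)
  let ?A = "{xs :: bool list. length xs = n \<and> P xs}"
  have fin: "finite ?A"
    by (rule finite_subset[OF _ finite_lists_length_eq[of "UNIV :: bool set" n]]) auto
  have "{\<omega>. P (stake n \<omega>)} = (\<Union>xs\<in>?A. {\<omega>. stake n \<omega> = xs})" by auto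
  also have "measure coin_tosses \<dots> = (\<Sum>xs\<in>?A. measure coin_tosses {\<omega>. stake n \<omega> = xs})"
    using sets_stake[of "\<lambda>ys. ys = _" n] fin
    by (intro finite_measure_finite_Union) (auto simp: disjoint_family_on_def)
  also have "\<dots> = (\<Sum>xs\<in>?A. 1 / 2 ^ n)"
    using measure_stake_eq by (intro sum.cong) (auto simp: measure_def)
  finally show ?thesis by simp
qed

section \<open>Ternary codes\<close>

lemma div_power_digit:
  fixes c :: nat
  assumes "lo < 3 ^ r" "x < 3" "c = (hi * 3 + x) * 3 ^ r + lo"
  shows "c div 3 ^ r mod 3 = x"
    and "r' < r \<Longrightarrow> c div 3 ^ r' mod 3 = lo div 3 ^ r' mod 3"
    and "r < r' \<Longrightarrow> c div 3 ^ r' = hi div 3 ^ (r' - Suc r)"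
proof -
  have q: "c div 3 ^ r = hi * 3 + x" using assms by simp
  then show "c div 3 ^ r mod 3 = x" using assms(2) by simp
  show "c div 3 ^ r' mod 3 = lo div 3 ^ r' mod 3" if r: "r' < r"
  proof -
    have "(3::nat) ^ r = 3 ^ r' * (3 * 3 ^ (r - Suc r'))"
      using r by (simp flip: power_add power_Suc)
    then have "c = lo + 3 ^ r' * (3 * ((hi * 3 + x) * 3 ^ (r - Suc r')))" using assms(3) by simp
    then show ?thesis by simp
  qed
  show "c div 3 ^ r' = hi div 3 ^ (r' - Suc r)" if r: "r < r'"
  proof -
    have "(3::nat) ^ r' = 3 ^ r * (3 * 3 ^ (r' - Suc r))"
      using r by (simp flip: power_add power_Suc)
    then have "c div 3 ^ r' = (hi * 3 + x) div 3 div 3 ^ (r' - Suc r)"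
      using q by (simp add: div_mult2_eq)
    then show ?thesis using assms(2) by simp
  qed
qed

text \<open>With c = (hi * 3 + x) * 3^r + lo, the update replaces x by \<open>a\<close>. The old
  digit is subtracted first, so truncated subtraction is exact.\<close>

lemma digit_update:
  fixes c a r :: nat
  assumes "a < 3"
  defines "c' \<equiv> c - (c div 3 ^ r mod 3) * 3 ^ r + a * 3 ^ r"
  shows "c' div 3 ^ r mod 3 = a"
    and "r' \<noteq> r \<Longrightarrow> c' div 3 ^ r' mod 3 = c div 3 ^ r' mod 3"
    and "c < 3 ^ N \<Longrightarrow> r < N \<Longrightarrow> c' < 3 ^ N"
proof -
  define x lo hi where "x = c div 3 ^ r mod 3" and "lo = c mod 3 ^ r" and "hi = c div 3 ^ r div 3"
  have x: "x < 3" and lo: "lo < 3 ^ r" by (auto simp: x_def lo_def)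
  have hx: "hi * 3 + x = c div 3 ^ r" by (simp add: hi_def x_def)
  have c: "c = (hi * 3 + x) * 3 ^ r + lo" unfolding hx lo_def by (rule div_mult_mod_eq[symmetric])
  then have "c = (hi * 3 * 3 ^ r + lo) + x * 3 ^ r" by (simp add: algebra_simps)
  then have "c - x * 3 ^ r = hi * 3 * 3 ^ r + lo" by simp
  then have c': "c' = (hi * 3 + a) * 3 ^ r + lo"
    unfolding c'_def x_def[symmetric] by (simp add: algebra_simps)
  show "c' div 3 ^ r mod 3 = a" by (rule div_power_digit(1)[OF lo assms(1) c'])
  show "c' div 3 ^ r' mod 3 = c div 3 ^ r' mod 3" if "r' \<noteq> r"
    using div_power_digit(2,3)[OF lo assms(1) c', of r'] div_power_digit(2,3)[OF lo x c, of r'] that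
    by (cases "r' < r") auto
  show "c' < 3 ^ N" if "c < 3 ^ N" "r < N"
  proof -
    have N: "(3::nat) ^ N = 3 ^ (N - Suc r) * (3 * 3 ^ r)"
      using that(2) by (simp flip: power_add power_Suc)
    have "hi < 3 ^ (N - Suc r)"
      using that(1) c N by (metis hi_def div_mult2_eq less_mult_imp_div_less mult.commute)
    then have "hi * 3 + a + 1 \<le> 3 ^ (N - Suc r) * 3" using assms(1) by linarith
    then have "(hi * 3 + a + 1) * 3 ^ r \<le> 3 ^ N" unfolding N mult.assoc[symmetric] by (rule mult_le_mono1)
    then show ?thesis using c' lo by (simp add: algebra_simps)
  qed
qed

text \<open>A label that no vertex carries has an empty live class, which every state admits. Codes
  therefore need digits only for labels that occur.\<close>

lemma table_cong:
  assumes "well_formed t" "\<And>l. l \<in> clab t ` cverts t \<Longrightarrow> s l = s' l"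
  shows "table T w t p s = table T w t p s'"
proof -
  have "live t p C l = {} \<or> s l = s' l" for C l
    using assms(2)[of l] live_clab[OF assms(1), of _ p C l] live_subset[of t p C l] sel_subset[of t p C]
    by blast
  then have "admits (s l) (live t p C l) L \<longleftrightarrow> admits (s' l) (live t p C l) L" for C l L
    by (metis admits_empty)
  then show ?thesis unfolding table_def configs_def by simp
qed

text \<open>\<open>pos l\<close> is the power of 3 itself and not its exponent, because the machine
  has no exponentiation.\<close>

definition digit :: "(nat \<Rightarrow> nat) \<Rightarrow> nat \<Rightarrow> nat \<Rightarrow> nat" where
  "digit pos c l = c div pos l mod 3"

definition upd :: "(nat \<Rightarrow> nat) \<Rightarrow> nat \<Rightarrow> nat \<Rightarrow> nat \<Rightarrow> nat" where
  "upd pos c l a = c - digit pos c l * pos l + a * pos l"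

text \<open>
  Labels outside \<open>D\<close> have position 0. Since \<open>c div 0 = 0\<close>, reading their digit yields 0 and
  changing it has no effect.
\<close>

definition positions :: "nat set \<Rightarrow> (nat \<Rightarrow> nat) \<Rightarrow> bool" where
  "positions D pos \<longleftrightarrow> (\<exists>r. bij_betw r D {..<card D} \<and> pos = (\<lambda>x. if x \<in> D then 3 ^ r x else 0))"

lemma digit_less: "digit pos c l < 3"
  by (simp add: digit_def)

lemma positions_upd:
  assumes "positions D pos" "a < 3" "c < 3 ^ card D"
  shows "upd pos c l a < 3 ^ card D"
    and "digit pos (upd pos c l a) = (if l \<in> D then (digit pos c)(l := a) else digit pos c)"
proof -
  obtain r where r: "bij_betw r D {..<card D}" "pos = (\<lambda>x. if x \<in> D then 3 ^ r x else 0)"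
    using assms(1) by (auto simp: positions_def)
  have rl: "x \<in> D \<Longrightarrow> r x < card D" for x using bij_betwE[OF r(1)] by blast
  have inj: "x \<in> D \<Longrightarrow> y \<in> D \<Longrightarrow> x \<noteq> y \<Longrightarrow> r x \<noteq> r y" for x y
    using bij_betw_imp_inj_on[OF r(1)] by (auto dest: inj_onD)
  show "upd pos c l a < 3 ^ card D"
    using digit_update(3)[OF assms(2), of c "card D" "r l"] rl[of l] assms(3)
    by (simp add: upd_def digit_def r(2))
  show "digit pos (upd pos c l a) = (if l \<in> D then (digit pos c)(l := a) else digit pos c)"
  proof
    fix x
    show "digit pos (upd pos c l a) x = (if l \<in> D then (digit pos c)(l := a) else digit pos c) x"
      using digit_update(1)[OF assms(2), of c "r l"] digit_update(2)[OF assms(2), of "r x" "r l" c] inj[of x l]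
      by (auto simp: upd_def digit_def r(2))
  qed
qed

lemma table_upd:
  assumes "positions D pos" "a < 3" "c < 3 ^ card D" "well_formed t" "clab t ` cverts t \<subseteq> D"
    and "\<And>l. l \<in> D \<Longrightarrow> f l = digit pos c l"
  shows "table T w t p (f(l := a)) = table T w t p (digit pos (upd pos c l a))"
  using assms(5,6) by (intro table_cong[OF assms(4)]) (auto simp: positions_upd(2)[OF assms(1-3)])

lemma clab_postfix: "well_formed t \<Longrightarrow> x \<in> cverts t \<Longrightarrow> clab t x \<in> set (postfix t)"
proof (induction t)
  case (Oplus t u)
  then show ?case by simp blast
qed simp_all

section \<open>Subexpressions in postfix order\<close>

text \<open>Entry q is the subexpression whose root is node q (relative to the first node), paired
  with the number of its own first node.\<close>

fun occs :: "'v cexpr \<Rightarrow> nat \<Rightarrow> ('v cexpr \<times> nat) list" where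
  "occs (Introduce i v) p = [(Introduce i v, p)]"
| "occs (Oplus t u) p = occs t p @ occs u (p + nodes t) @ [(Oplus t u, p)]"
| "occs (Relabel i j t) p = occs t p @ [(Relabel i j t, p)]"
| "occs (Join i j t) p = occs t p @ [(Join i j t, p)]"

lemma length_occs: "length (occs t p) = nodes t"
  by (induction t arbitrary: p) auto

text \<open>The node list and the token list are cut at corresponding places. The factor 3 aligns
  them, every node being written as three numbers.\<close>

definition occurs :: "nat cexpr \<Rightarrow> nat \<Rightarrow> nat \<Rightarrow> nat cexpr \<Rightarrow> nat \<Rightarrow> bool" where
  "occurs t o1 p x o2 \<longleftrightarrow> x \<in> subexprs t \<and> o2 + nodes x = Suc (o1 + p) \<and>
     (\<exists>pre post pp pq. occs t o1 = pre @ occs x o2 @ post \<and> o1 + length pre = o2 \<and>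
        postfix t = pp @ postfix x @ pq \<and> length pp = 3 * length pre)"

lemma subexprs_refl: "t \<in> subexprs t"
  by (cases t) auto

lemma occurs_refl: "Suc p = nodes t \<Longrightarrow> occurs t o1 p t o1"
  unfolding occurs_def using subexprs_refl[of t] by (auto intro!: exI[of _ "[]"])

lemma occurs_append:
  assumes "occurs t m p x q" "occs u n = A @ occs t m @ B" "n + length A = m"
    "postfix u = P @ postfix t @ P'" "length P = 3 * length A" "subexprs t \<subseteq> subexprs u" "n + r = m + p"
  shows "occurs u n r x q"
proof -
  obtain pre post pp pq where *: "occs t m = pre @ occs x q @ post" "m + length pre = q"
     "postfix t = pp @ postfix x @ pq" "length pp = 3 * length pre"
    using assms(1) unfolding occurs_def by blast
  have "occs u n = (A @ pre) @ occs x q @ (post @ B) \<and> n + length (A @ pre) = q \<and>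
     postfix u = (P @ pp) @ postfix x @ (pq @ P') \<and> length (P @ pp) = 3 * length (A @ pre)"
    using * assms(2-5) by auto
  moreover have "x \<in> subexprs u" "q + nodes x = Suc (n + r)"
    using assms(1,6,7) unfolding occurs_def by auto
  ultimately show ?thesis unfolding occurs_def by blast
qed

lemma occs_nth: "p < nodes t \<Longrightarrow> occurs t o1 p (fst (occs t o1 ! p)) (snd (occs t o1 ! p))"
proof (induction t arbitrary: o1 p)
  case (Introduce i v)
  then show ?case using occurs_refl[of p "Introduce i v" o1] by simp
next
  case (Oplus t u)
  consider "p < nodes t" | "nodes t \<le> p" "p < nodes t + nodes u" | "p = nodes t + nodes u"
    using Oplus.prems by fastforce
  then show ?case
  proof cases
    case 1
    have "occurs (Oplus t u) o1 p (fst (occs t o1 ! p)) (snd (occs t o1 ! p))"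
      by (rule occurs_append[OF Oplus.IH(1)[OF 1], where A = "[]" and P = "[]"
            and B = "occs u (o1 + nodes t) @ [(Oplus t u, o1)]" and P' = "postfix u @ [1, 0, 0]"]) auto
    then show ?thesis using 1 by (simp add: nth_append length_occs)
  next
    case 2
    let ?q = "p - nodes t"
    have "?q < nodes u" using 2 by linarith
    have "occurs (Oplus t u) o1 p (fst (occs u (o1 + nodes t) ! ?q)) (snd (occs u (o1 + nodes t) ! ?q))"
      by (rule occurs_append[OF Oplus.IH(2)[OF \<open>?q < nodes u\<close>], where A = "occs t o1"
            and P = "postfix t" and B = "[(Oplus t u, o1)]" and P' = "[1, 0, 0]"])
         (use 2 in \<open>auto simp: length_occs length_postfix\<close>)
    then show ?thesis using 2 \<open>?q < nodes u\<close> by (simp add: nth_append length_occs)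
  next
    case 3
    then show ?thesis using occurs_refl[of p "Oplus t u" o1] by (simp add: nth_append length_occs)
  qed
next
  case (Relabel i j t)
  show ?case
  proof (cases "p < nodes t")
    case True
    have "occurs (Relabel i j t) o1 p (fst (occs t o1 ! p)) (snd (occs t o1 ! p))"
      by (rule occurs_append[OF Relabel.IH[OF True], where A = "[]" and P = "[]"
            and B = "[(Relabel i j t, o1)]" and P' = "[2, i, j]"]) auto
    then show ?thesis using True by (simp add: nth_append length_occs)
  next
    case False
    then have "p = nodes t" using Relabel.prems by simp
    then show ?thesis using occurs_refl[of p "Relabel i j t" o1] by (simp add: nth_append length_occs)
  qed
next
  case (Join i j t)
  show ?case
  proof (cases "p < nodes t")
    case True
    have "occurs (Join i j t) o1 p (fst (occs t o1 ! p)) (snd (occs t o1 ! p))"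
      by (rule occurs_append[OF Join.IH[OF True], where A = "[]" and P = "[]"
            and B = "[(Join i j t, o1)]" and P' = "[3, i, j]"]) auto
    then show ?thesis using True by (simp add: nth_append length_occs)
  next
    case False
    then have "p = nodes t" using Join.prems by simp
    then show ?thesis using occurs_refl[of p "Join i j t" o1] by (simp add: nth_append length_occs)
  qed
qed

lemma nth_middle: "length xs = a \<Longrightarrow> i < length ys \<Longrightarrow> (xs @ ys @ zs) ! (a + i) = ys ! i"
  by (auto simp: nth_append)

lemma last_occs: "occs x q ! (nodes x - 1) = (x, q)"
  by (cases x) (auto simp: nth_append length_occs)

lemma occurs_postfix:
  assumes "occurs t 0 p x q" "e < 3"
  shows "postfix t ! (3 * p + e) = postfix x ! (3 * nodes x - 3 + e)"
proof -
  obtain pp pq where *: "postfix t = pp @ postfix x @ pq" "length pp = 3 * q" "q + nodes x = Suc p"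
    using assms(1) unfolding occurs_def by auto
  have "3 * p + e = 3 * q + (3 * nodes x - 3 + e)" using * nodes_pos[of x] by linarith
  moreover have "(pp @ postfix x @ pq) ! (3 * q + (3 * nodes x - 3 + e)) = postfix x ! (3 * nodes x - 3 + e)"
    by (rule nth_middle[OF *(2)]) (use assms(2) nodes_pos[of x] in \<open>simp add: length_postfix\<close>)
  ultimately show ?thesis unfolding *(1) by (simp only:)
qed

lemma occurs_child:
  assumes "occurs t 0 p x q" "occs x q = A @ occs y o2 @ B" "q + length A = o2"
  shows "occs t 0 ! (o2 + (nodes y - 1)) = (y, o2)"
proof -
  obtain pre post where *: "occs t 0 = pre @ occs x q @ post" "length pre = q"
    using assms(1) unfolding occurs_def by auto
  have l: "occs t 0 = (pre @ A) @ occs y o2 @ (B @ post)" using * assms(2) by simp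
  have "((pre @ A) @ occs y o2 @ (B @ post)) ! (o2 + (nodes y - 1)) = occs y o2 ! (nodes y - 1)"
    by (rule nth_middle) (use * assms(3) nodes_pos[of y] in \<open>simp_all add: length_occs\<close>)
  then show ?thesis unfolding l last_occs .
qed

lemma postfix_subexprs: "x \<in> subexprs t \<Longrightarrow> set (postfix x) \<subseteq> set (postfix t)"
  by (induction t) auto

lemma nodes_subexprs: "x \<in> subexprs t \<Longrightarrow> nodes x \<le> nodes t"
  by (induction t) auto

lemma well_formed_subexprs: "well_formed t \<Longrightarrow> x \<in> subexprs t \<Longrightarrow> well_formed x"
  by (induction t) auto

lemma node_value:
  fixes t :: "nat cexpr" and T :: "nat set" and w pos :: "nat \<Rightarrow> nat"
  defines "V \<equiv> \<lambda>p c. table T w (fst (occs t 0 ! p)) (snd (occs t 0 ! p)) (digit pos c)"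
    and "st \<equiv> \<lambda>p. snd (occs t 0 ! p)" and "E \<equiv> \<lambda>p e. postfix t ! (3 * p + e)"
  assumes wf: "well_formed t" and lab: "\<forall>x\<in>subexprs t. clab x ` cverts x \<subseteq> D"
    and pos: "positions D pos" and p: "p < nodes t" and c: "c < 3 ^ card D"
  shows "E p 0 = 0 \<and> st p = p \<and>
      V p c = of_bool (E p 2 \<notin> T) + 2 * w (2 * p + 1) + of_bool (digit pos c (E p 1) \<noteq> 0) * w (2 * p)
    \<or> E p 0 = 1 \<and> 0 < p \<and> 0 < st (p - 1) \<and> st (p - 1) < p \<and> st p = st (st (p - 1) - 1) \<and>
      V p c = V (st (p - 1) - 1) c * V (p - 1) c
    \<or> E p 0 = 2 \<and> 0 < p \<and> st p = st (p - 1) \<and>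
      V p c = V (p - 1) (upd pos c (E p 1) (digit pos c (E p 2)))
    \<or> E p 0 = 3 \<and> 0 < p \<and> st p = st (p - 1) \<and> E p 1 \<noteq> E p 2 \<and>
      (let x = digit pos c (E p 1); y = digit pos c (E p 2);
           g = (\<lambda>a b. V (p - 1) (upd pos c (E p 1) a - y * pos (E p 2) + b * pos (E p 2)));
           f = (\<lambda>a b. g a b + g 0 0 - (g a 0 + g 0 b)); \<alpha> = w (2 * p); \<beta> = w (2 * p + 1) in
       V p c = V (p - 1) c - of_bool (x * y = 2) * f x y +
         f 1 1 * (\<alpha> * of_bool (y = 1) + \<beta> * of_bool (x = 1) + \<alpha> * \<beta>) +
         f 2 2 * (\<alpha> * of_bool (y = 2) + \<beta> * of_bool (x = 2) + \<alpha> * \<beta>))"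
    (is "?R0 \<or> ?R1 \<or> ?R2 \<or> ?R3")
proof -
  obtain x q where xq: "occs t 0 ! p = (x, q)" by fastforce
  have oc: "occurs t 0 p x q" using occs_nth[OF p, of 0] xq by simp
  have sub: "x \<in> subexprs t" and qx: "q + nodes x = Suc p" using oc by (auto simp: occurs_def)
  note wfs = well_formed_subexprs[OF wf]
  have trans: "y \<in> subexprs t" if "y \<in> subexprs x" for y
    using sub that by (induction t) auto
  have E: "E p e = postfix x ! (3 * nodes x - 3 + e)" if "e < 3" for e
    unfolding E_def by (rule occurs_postfix[OF oc that])
  have E': "E p 0 = postfix x ! (3 * nodes x - 3)" "E p 1 = postfix x ! (3 * nodes x - 3 + 1)"
    "E p 2 = postfix x ! (3 * nodes x - 3 + 2)" using E[of 0] E[of 1] E[of 2] by simp_all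
  note child = occurs_child[OF oc]
  have Vp: "V p c = table T w x q (digit pos c)" for c unfolding V_def xq by simp
  have stp: "st p = q" unfolding st_def xq by simp
  show ?thesis
  proof (cases x)
    case (Introduce i v)
    then have "q = p" "E p 0 = 0" "E p 1 = i" "E p 2 = v" using qx E' by simp_all
    then have ?R0 unfolding Vp Introduce stp by (simp add: table_Introduce)
    then show ?thesis by (rule disjI1)
  next
    case (Oplus a b)
    have e: "E p 0 = 1" using E' Oplus by (simp add: nth_append length_postfix)
    have p': "p = q + nodes a + nodes b" using qx Oplus by simp
    have ch: "occs t 0 ! (q + nodes a + (nodes b - 1)) = (b, q + nodes a)"
      "occs t 0 ! (q + (nodes a - 1)) = (a, q)"
      using child[of "occs a q" b "q + nodes a" "[(Oplus a b, q)]"]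
        child[of "[]" a q "occs b (q + nodes a) @ [(Oplus a b, q)]"] Oplus by (auto simp: length_occs)
    have ix: "q + nodes a + (nodes b - 1) = p - 1" "q + (nodes a - 1) = q + nodes a - 1"
      using p' nodes_pos[of a] nodes_pos[of b] by auto
    have c1: "occs t 0 ! (p - 1) = (b, q + nodes a)" and c2: "occs t 0 ! (q + nodes a - 1) = (a, q)"
      using ch unfolding ix .
    have st1: "st (p - 1) = q + nodes a" unfolding st_def c1 by simp
    have st2: "st (q + nodes a - 1) = q" unfolding st_def c2 by simp
    have "cverts a \<inter> cverts b = {}" using wfs[OF sub] Oplus by simp
    then have "V p c = V (q + nodes a - 1) c * V (p - 1) c"
      unfolding Vp Oplus unfolding V_def c1 c2 by (simp add: table_Oplus)
    then have ?R1 unfolding st1 st2 stp using e p' nodes_pos[of a] nodes_pos[of b] by simp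
    then show ?thesis by (intro disjI2[OF disjI1])
  next
    case (Relabel i j y)
    have e: "E p 0 = 2" "E p 1 = i" "E p 2 = j" using E' Relabel by (simp_all add: nth_append length_postfix)
    have p': "p = q + nodes y" using qx Relabel by simp
    have "q + (nodes y - 1) = p - 1" using p' nodes_pos[of y] by simp
    then have c1: "occs t 0 ! (p - 1) = (y, q)"
      using child[of "[]" y q "[(Relabel i j y, q)]"] Relabel by simp
    have y: "y \<in> subexprs t" using trans[of y] Relabel subexprs_refl[of y] by simp
    have "V p c = table T w y q ((digit pos c)(i := digit pos c j))"
      unfolding Vp Relabel by (rule table_Relabel)
    also have "\<dots> = V (p - 1) (upd pos c i (digit pos c j))"
      unfolding V_def c1 fst_conv snd_conv
      by (rule table_upd[OF pos digit_less c wfs[OF y] bspec[OF lab y] refl])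
    finally have "V p c = V (p - 1) (upd pos c i (digit pos c j))" .
    moreover have "st (p - 1) = q" unfolding st_def c1 by simp
    moreover have "0 < p" using p' nodes_pos[of y] by simp
    ultimately have ?R2 unfolding e using stp by blast
    then show ?thesis by (intro disjI2[OF disjI2[OF disjI1]])
  next
    case (Join i j y)
    have e: "E p 0 = 3" "E p 1 = i" "E p 2 = j" using E' Join by (simp_all add: nth_append length_postfix)
    have p': "p = q + nodes y" using qx Join by simp
    have "q + (nodes y - 1) = p - 1" using p' nodes_pos[of y] by simp
    then have c1: "occs t 0 ! (p - 1) = (y, q)"
      using child[of "[]" y q "[(Join i j y, q)]"] Join by simp
    have y: "y \<in> subexprs t" using trans[of y] Join subexprs_refl[of y] by simp
    have ij: "i \<noteq> j" using wfs[OF sub] Join by simp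
    let ?g = "\<lambda>a b. V (p - 1) (upd pos c i a - digit pos c j * pos j + b * pos j)"
    have g: "table T w y q ((digit pos c)(i := a, j := b)) = ?g a b" if "a < 3" "b < 3" for a b
    proof -
      let ?c = "upd pos c i a"
      note u = positions_upd[OF pos that(1) c, of i]
      \<comment> \<open>As the two labels differ, the first update leaves the digit of
        \<open>j\<close> alone. The program may thus read both old digits from the original
        code.\<close>
      have dj: "digit pos ?c j = digit pos c j" using u(2) ij by simp
      have "table T w y q ((digit pos c)(i := a, j := b)) = table T w y q (digit pos (upd pos ?c j b))"
        by (rule table_upd[OF pos that(2) u(1) wfs[OF y] bspec[OF lab y]]) (use u(2) in auto)
      then show ?thesis unfolding V_def c1 upd_def[of pos ?c] dj by simp
    qed
    have V1: "V (p - 1) c = table T w y q (digit pos c)" unfolding V_def c1 by simp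
    have two: "2 * (q + nodes y) = 2 * p" "2 * (q + nodes y) + 1 = 2 * p + 1" using p' by auto
    have d3: "digit pos c i < 3" "digit pos c j < 3" by (rule digit_less)+
    have "V p c = V (p - 1) c - of_bool (digit pos c i * digit pos c j = 2) *
           (?g (digit pos c i) (digit pos c j) + ?g 0 0 - (?g (digit pos c i) 0 + ?g 0 (digit pos c j))) +
         (?g 1 1 + ?g 0 0 - (?g 1 0 + ?g 0 1)) *
           (w (2 * p) * of_bool (digit pos c j = 1) + w (2 * p + 1) * of_bool (digit pos c i = 1) + w (2 * p) * w (2 * p + 1)) +
         (?g 2 2 + ?g 0 0 - (?g 2 0 + ?g 0 2)) *
           (w (2 * p) * of_bool (digit pos c j = 2) + w (2 * p + 1) * of_bool (digit pos c i = 2) + w (2 * p) * w (2 * p + 1))"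
      unfolding Vp Join V1 using table_Join[OF ij d3, of T w y q] g[OF d3]
        g[OF d3(1), of 0] g[OF _ d3(2), of 0] g[of 0 0] g[of 1 1] g[of 1 0] g[of 0 1] g[of 2 2] g[of 2 0] g[of 0 2] two
      by (simp only:)
    moreover have "st (p - 1) = q" unfolding st_def c1 by simp
    moreover have "0 < p" using p' nodes_pos[of y] by simp
    ultimately have ?R3 unfolding e Let_def using stp ij by blast
    then show ?thesis by (intro disjI2[OF disjI2[OF disjI2]])
  qed
qed

section \<open>The algorithm\<close>

abbreviation V :: "name \<Rightarrow> aexp" where
  "V x \<equiv> Load x (Const 0)"

text \<open>With truncated subtraction, (a - b) + (b - a) is the distance of a and b.\<close>

definition eq_exp :: "aexp \<Rightarrow> aexp \<Rightarrow> aexp" where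
  "eq_exp a b = Sub (Const 1) (Add (Sub a b) (Sub b a))"

fun pow_exp :: "aexp \<Rightarrow> nat \<Rightarrow> aexp" where
  "pow_exp e 0 = Const 1"
| "pow_exp e (Suc n) = Mul e (pow_exp e n)"

lemma aval_eq_exp [simp]: "aval (eq_exp a b) s = of_bool (aval a s = aval b s)"
  by (auto simp: eq_exp_def)

lemma aval_pow_exp [simp]: "aval (pow_exp e n) s = aval e s ^ n"
  by (induction n) auto

text \<open>
  At the end of the first loop, \<open>R = 2 ^ m \<ge> len\<close>, \<open>Z = 2 ^ len\<close> and \<open>Y = Z ^ len\<close>, the last one
  by \<open>(q + 1)\<^sup>2 = q\<^sup>2 + 2 q + 1\<close>.
\<close>

definition new_label :: aexp where
  "new_label = (let x = Load ''expr'' (V ''c1'') in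
     Mul x (Mul (Sub (Add (V ''k'') (Const 1)) x) (Sub (Const 1) (Load ''pos'' x))))"

definition prep_body :: com where
  "prep_body = (let x = Load ''expr'' (V ''c1'') in
     Seq (If new_label
            (Seq (Store ''pos'' x (V ''Q'')) (Store ''Q'' (Const 0) (Mul (Const 3) (V ''Q''))))
            Skip)
    (Seq (If (Sub (V ''len'') (V ''R''))
            (Seq (Store ''R'' (Const 0) (Mul (Const 2) (V ''R'')))
                 (Store ''m'' (Const 0) (Add (V ''m'') (Const 1))))
            Skip)
    (Seq (Store ''Y'' (Const 0) (Mul (Const 2) (Mul (V ''Y'') (Mul (V ''Z'') (V ''Z'')))))
    (Seq (Store ''Z'' (Const 0) (Mul (Const 2) (V ''Z'')))
         (Store ''c1'' (Const 0) (Add (V ''c1'') (Const 1)))))))"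

definition init_com :: com where
  "init_com = Seq (Store ''Q'' (Const 0) (Const 1)) (Seq (Store ''R'' (Const 0) (Const 1))
     (Seq (Store ''Z'' (Const 0) (Const 1)) (Store ''Y'' (Const 0) (Const 1))))"

text \<open>Square and multiply: the powers \<open>Z ^ r\<close> are computed while the bits of the random numbers \<open>r\<close> are tossed.\<close>

definition weight_bits :: "nat \<Rightarrow> aexp" where
  "weight_bits d = Mul (V ''m'') (Const (Suc d))"

text \<open>\<open>c2\<close> runs through all pairs of a choice and a bit position. At the first
  bit the power starts with exponent 0, or with exponent \<open>len\<close> at an introduction.
  Every toss squares it, so this initial exponent ends up multiplied by \<open>2 ^ bits\<close>,
  above the random bits.\<close>

definition weight_body :: "nat \<Rightarrow> com" where
  "weight_body d = (let u = Quot (V ''c2'') (weight_bits d) in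
     Seq (Toss ''t'')
    (Seq (If (Rem (V ''c2'') (weight_bits d)) Skip
            (If (Load ''expr'' (Mul (Const 3) (Quot u (Const 2))))
               (Store ''w'' u (Const 1)) (Store ''w'' u (V ''Y''))))
    (Seq (Store ''w'' u (Mul (Mul (Load ''w'' u) (Load ''w'' u))
             (Add (Const 1) (Mul (V ''t'') (Sub (V ''Z'') (Const 1))))))
         (Store ''c2'' (Const 0) (Add (V ''c2'') (Const 1))))))"

definition weight_count :: "nat \<Rightarrow> aexp" where
  "weight_count d = Mul (Mul (Const 2) (Quot (V ''len'') (Const 3))) (weight_bits d)"

text \<open>\<open>A\<close> consists of the variables used as arrays; all other ones are scalars.\<close>

definition unchanged :: "name set \<Rightarrow> name set \<Rightarrow> state \<Rightarrow> state \<Rightarrow> bool" where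
  "unchanged W A s s' \<longleftrightarrow> (\<forall>x i. x \<notin> W \<or> x \<notin> A \<and> i \<noteq> 0 \<longrightarrow> s' x i = s x i)"

lemma unchangedD: "unchanged W A s s' \<Longrightarrow> x \<notin> W \<or> x \<notin> A \<and> i \<noteq> 0 \<Longrightarrow> s' x i = s x i"
  by (simp add: unchanged_def)

abbreviation prep_vars :: "name set" where
  "prep_vars \<equiv> {''pos'', ''Q'', ''R'', ''m'', ''Y'', ''Z'', ''c1''}"

abbreviation weight_vars :: "name set" where
  "weight_vars \<equiv> {''t'', ''w'', ''c2''}"

abbreviation dp_vars :: "name set" where
  "dp_vars \<equiv> {''tab'', ''start'', ''c3''}"

abbreviation digit_vars :: "name set" where
  "digit_vars \<equiv> {''G'', ''out'', ''c4''}"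

section \<open>Sizes of numbers and the preparatory loop for a fixed input\<close>

locale steiner_input =
  fixes d n b k N :: nat and t :: "nat cexpr" and T :: "nat set" and s0 :: state
  assumes wf: "well_formed t" and cv: "cverts t = {..<n}" and T: "T \<subseteq> {..<n}"
    and lab: "\<And>x. x \<in> subexprs t \<Longrightarrow> clab x ` cverts x \<subseteq> {1..k}"
    and s0_n: "s0 ''n'' 0 = n" and s0_b: "s0 ''b'' 0 = b" and s0_k: "s0 ''k'' 0 = k"
    and s0_term: "\<And>i. s0 ''term'' i = of_bool (i \<in> T)"
    and s0_len: "s0 ''len'' 0 = length (postfix t)"
    and s0_expr: "\<And>i. i < length (postfix t) \<Longrightarrow> s0 ''expr'' i = postfix t ! i"
    and s0_zero: "\<And>x i. x \<in> {''pos'', ''Q'', ''R'', ''m'', ''Y'', ''Z'', ''c1'', ''c2'', ''c3'', ''c4'', ''t'',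
       ''w'', ''tab'', ''start'', ''G'', ''out''} \<Longrightarrow> s0 x i = 0"
    and s0_bound: "mem_bound (k + N) s0"
    and len_N: "length (postfix t) \<le> N"
begin

abbreviation len :: nat where "len \<equiv> length (postfix t)"

definition lg :: nat where "lg = (LEAST j. len \<le> 2 ^ j)"

text \<open>Isolation fails with probability at most \<open>2 * nodes t / 2 ^ bits\<close>. Since
  \<open>2 ^ bits\<close> is at least \<open>len ^ Suc d\<close>, this is at most
  \<open>1 / (n + 1) ^ d\<close>.\<close>

definition bits :: nat where "bits = lg * Suc d"

text \<open>The loop that assigns positions does not parse, so operation codes and vertices are
  collected as well. Intersecting with \<open>{1..k}\<close> keeps the number of digits at most
  \<open>k\<close>.\<close>

definition labels :: "nat \<Rightarrow> nat set" where "labels q = set (take q (postfix t)) \<inter> {1..k}"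

text \<open>\<open>k + N\<close> covers the input. A table entry counts fewer than
  \<open>2 ^ len\<close> configurations, each a product of at most \<open>len\<close> weights of bit
  length about \<open>len * (len + 1) * 2 ^ bits\<close>; this accounts for the cube. The factor
  \<open>n + 2\<close> leaves room for the counter of the last loop.\<close>

definition \<beta> :: nat where "\<beta> = k + N + (len + 2) ^ 3 * 2 ^ bits * (n + 2)"

lemma len_eq: "len = 3 * nodes t"
  by (rule length_postfix)

lemma len_ge: "len \<ge> 3"
  using len_eq nodes_pos[of t] by simp

lemma lg: "len \<le> 2 ^ lg" "j < lg \<Longrightarrow> 2 ^ j < len"
proof -
  have "len \<le> 2 ^ len" by (simp add: less_imp_le)
  then show "len \<le> 2 ^ lg" unfolding lg_def by (rule LeastI)
  show "2 ^ j < len" if "j < lg" using not_less_Least[of j "\<lambda>j. len \<le> 2 ^ j"] that by (auto simp: lg_def)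
qed

lemma lg_le: "lg \<le> len"
  unfolding lg_def by (rule Least_le) (simp add: less_imp_le)

lemma lg_pos: "lg > 0"
  using lg(1) len_ge by (cases lg) auto

lemma bits_pos: "bits > 0"
  using lg_pos by (simp add: bits_def)

lemma exponent_bounds:
  "len * len < \<beta>" "k + N \<le> \<beta>" "1 \<le> \<beta>" "3 * len < \<beta>" "len * ((len + 1) * 2 ^ bits) < \<beta>"
  "len + len * (len * ((len + 1) * 2 ^ bits)) < \<beta>" "len * 2 ^ bits * (n + 1) < \<beta>" "lg < \<beta>"
proof -
  let ?r = "2 ^ bits :: nat"
  have r: "?r \<ge> 1" by simp
  have b: "(len + 2) ^ 3 * ?r \<le> \<beta>"
    unfolding \<beta>_def by (simp add: trans_le_add2)
  have "len + len * (len * ((len + 1) * ?r)) < (len + 2) ^ 3 * ?r"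
  proof -
    have "len + len * (len * ((len + 1) * ?r)) \<le> (len + len * (len * (len + 1))) * ?r"
      using r by (simp add: algebra_simps)
    also have "\<dots> < (len + 2) ^ 3 * ?r"
      by (rule mult_strict_right_mono) (auto simp: power3_eq_cube algebra_simps)
    finally show ?thesis .
  qed
  then show a: "len + len * (len * ((len + 1) * ?r)) < \<beta>" using b by linarith
  have l: "len * ((len + 1) * ?r) \<le> len * (len * ((len + 1) * ?r))"
    using mult_le_mono1[of 1 len "len * ((len + 1) * ?r)"] len_ge by simp
  show c: "len * ((len + 1) * ?r) < \<beta>" using a l by linarith
  have "len * 1 \<le> (len + 1) * ?r" using r by (intro mult_le_mono) auto
  then have "len * len \<le> len * ((len + 1) * ?r)" by (intro mult_le_mono2) simp
  then show d: "len * len < \<beta>" using c by linarith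
  have "3 * len \<le> len * len" using len_ge by simp
  then show "3 * len < \<beta>" using d by linarith
  show "k + N \<le> \<beta>" by (simp add: \<beta>_def)
  show "1 \<le> \<beta>" using d by linarith
  have "len * ?r * (n + 1) < (len + 2) ^ 3 * ?r * (n + 2)"
  proof -
    have "len \<le> (len + 2) ^ 3" by (simp add: power3_eq_cube algebra_simps)
    then have "len * ?r * (n + 1) \<le> (len + 2) ^ 3 * ?r * (n + 1)" by (intro mult_le_mono) auto
    also have "\<dots> < (len + 2) ^ 3 * ?r * (n + 2)" by simp
    finally show ?thesis .
  qed
  then show "len * ?r * (n + 1) < \<beta>" unfolding \<beta>_def by linarith
  have "len \<le> len * len" using len_ge by simp
  then show "lg < \<beta>" using lg_le d by linarith
qed

lemma less_power_\<beta>: "v \<le> 2 ^ e \<Longrightarrow> e < \<beta> \<Longrightarrow> v < (2::nat) ^ \<beta>"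
  by (meson le_less_trans one_less_numeral_iff power_strict_increasing semiring_norm(76))

lemma small_less_power_\<beta>: "v \<le> e \<Longrightarrow> e < \<beta> \<Longrightarrow> v < (2::nat) ^ \<beta>"
  by (meson less_exp less_imp_le less_power_\<beta> order_trans)

lemma card_labels_le: "card (labels q) \<le> q" "card (labels q) \<le> k" "card (labels q) \<le> len"
proof -
  have "card (labels q) \<le> card (set (take q (postfix t)))" by (auto simp: labels_def intro: card_mono)
  also have "\<dots> \<le> length (take q (postfix t))" by (rule card_length)
  finally show "card (labels q) \<le> q" "card (labels q) \<le> len" by auto
  have "card (labels q) \<le> card {1..k}" by (rule card_mono) (auto simp: labels_def)
  then show "card (labels q) \<le> k" by simp
qed

lemma power3_le: "x \<le> len \<Longrightarrow> (3::nat) ^ x \<le> 2 ^ (2 * len)"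
proof -
  assume "x \<le> len"
  then have "(3::nat) ^ x \<le> 3 ^ len" by (intro power_increasing) auto
  also have "\<dots> \<le> 4 ^ len" by (intro power_mono) auto
  also have "\<dots> = 2 ^ (2 * len)" by (simp add: power_mult)
  finally show ?thesis .
qed

lemma positions_le:
  assumes "positions D p"
  shows "p x \<le> 3 ^ card D"
proof -
  obtain r where "bij_betw r D {..<card D}" "p = (\<lambda>x. if x \<in> D then 3 ^ r x else 0)"
    using assms by (auto simp: positions_def)
  moreover from this have "x \<in> D \<Longrightarrow> r x < card D" using bij_betwE by fastforce
  ultimately show ?thesis by (auto intro: power_increasing)
qed

lemma positions_insert:
  assumes "positions D p" "x \<notin> D" "finite D"
  shows "positions (insert x D) (p(x := 3 ^ card D))"
proof -
  obtain r where r: "bij_betw r D {..<card D}" "p = (\<lambda>x. if x \<in> D then 3 ^ r x else 0)"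
    using assms by (auto simp: positions_def)
  have "bij_betw (r(x := card D)) (insert x D) {..<Suc (card D)}"
  proof -
    have "bij_betw (r(x := card D)) D {..<card D}"
      using r(1) assms(2) by (subst bij_betw_cong[of D _ r]) auto
    then show ?thesis
      using notIn_Un_bij_betw[of x D "r(x := card D)" "{..<card D}"] assms(2) by (simp add: lessThan_Suc)
  qed
  then show ?thesis unfolding positions_def using assms r(2)
    by (intro exI[of _ "r(x := card D)"]) auto
qed

definition prep_inv :: "bool stream \<Rightarrow> nat \<Rightarrow> state \<Rightarrow> bool stream \<Rightarrow> bool" where
  "prep_inv \<omega>0 q s \<omega> \<longleftrightarrow> \<omega> = \<omega>0 \<and>
     unchanged prep_vars {''pos''} s0 s \<and>
     s ''c1'' 0 = q \<and> positions (labels q) (s ''pos'') \<and> s ''Q'' 0 = 3 ^ card (labels q) \<and>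
     s ''m'' 0 = min q lg \<and> s ''R'' 0 = 2 ^ min q lg \<and> s ''Z'' 0 = 2 ^ q \<and> s ''Y'' 0 = 2 ^ (q * q)"

lemma finite_labels: "finite (labels q)"
  by (simp add: labels_def)

lemma prep_init:
  "prep_inv \<omega> 0 (fst (run init_com (s0, \<omega>))) (snd (run init_com (s0, \<omega>)))"
proof -
  have "s0 ''pos'' = (\<lambda>i. 0)" "s0 ''c1'' 0 = 0" "s0 ''m'' 0 = 0" using s0_zero by auto
  then show ?thesis
    by (simp add: prep_inv_def init_com_def labels_def positions_def unchanged_def bij_betw_def)
qed

lemma prep_step:
  assumes "q < len" "prep_inv \<omega>0 q s \<omega>"
  shows "prep_inv \<omega>0 (Suc q) (fst (run prep_body (s, \<omega>))) (snd (run prep_body (s, \<omega>)))"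
proof -
  let ?x = "postfix t ! q" and ?p = "s ''pos''"
  have fr: "unchanged prep_vars {''pos''} s0 s"
    using assms(2) unfolding prep_inv_def by (elim conjE) assumption
  have st: "s ''c1'' 0 = q" "positions (labels q) ?p" "s ''Q'' 0 = 3 ^ card (labels q)"
     "s ''m'' 0 = min q lg" "s ''R'' 0 = 2 ^ min q lg" "s ''Z'' 0 = 2 ^ q" "s ''Y'' 0 = 2 ^ (q * q)" "\<omega> = \<omega>0"
    using assms(2) unfolding prep_inv_def by - (elim conjE, assumption)+
  have inp: "s ''k'' 0 = k" "s ''len'' 0 = len" "s ''expr'' q = ?x"
    using unchangedD[OF fr, of "''k''" 0] unchangedD[OF fr, of "''len''" 0] unchangedD[OF fr, of "''expr''" q]
      s0_k s0_len s0_expr[OF assms(1)] by simp_all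
  have tk: "take (Suc q) (postfix t) = take q (postfix t) @ [?x]"
    using assms(1) by (rule take_Suc_conv_app_nth)
  have lab': "labels (Suc q) = (if ?x \<in> {1..k} then insert ?x (labels q) else labels q)"
    unfolding labels_def tk by auto
  have p0: "?p ?x = 0 \<longleftrightarrow> ?x \<notin> labels q"
    using st(2) by (auto simp: positions_def)
  define new where "new \<longleftrightarrow> ?x \<in> {1..k} \<and> ?x \<notin> labels q"
  have cond: "aval new_label s = 0 \<longleftrightarrow> \<not> new"
    using p0 inp st(1) by (auto simp: new_label_def new_def Let_def)
  \<comment> \<open>Once \<open>R\<close> has reached the least power of 2 not below
    \<open>len\<close>, the doubling stops and the remaining rounds leave \<open>R\<close> and
    \<open>m\<close> alone.\<close>
  have lg_cond: "2 ^ min q lg < len \<longleftrightarrow> q < lg"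
    using lg(1) lg(2)[of q] by (cases "q < lg") (auto simp: min_def)
  have sq: "2 * (2 ^ (q * q) * (2 ^ q * 2 ^ q)) = (2::nat) ^ (Suc q * Suc q)"
    by (simp add: power_add algebra_simps)
  have P: "positions (labels (Suc q)) (if new then ?p(?x := 3 ^ card (labels q)) else ?p)"
    using positions_insert[OF st(2) _ finite_labels, of ?x] st(2) lab' by (auto simp: insert_absorb new_def)
  have C: "card (labels (Suc q)) = (if new then Suc (card (labels q)) else card (labels q))"
    using finite_labels[of q] lab' by (auto simp: insert_absorb new_def)
  let ?s1 = "if new
     then s(''pos'' := ?p(?x := 3 ^ card (labels q)), ''Q'' := (s ''Q'')(0 := 3 * 3 ^ card (labels q))) else s"
  let ?s2 = "if q < lg then ?s1(''R'' := (s ''R'')(0 := 2 * 2 ^ q), ''m'' := (s ''m'')(0 := Suc q)) else ?s1"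
  let ?s3 = "?s2(''Y'' := (s ''Y'')(0 := 2 ^ (Suc q * Suc q)), ''Z'' := (s ''Z'')(0 := 2 * 2 ^ q), ''c1'' := (s ''c1'')(0 := Suc q))"
  have "run prep_body (s, \<omega>) = (?s3, \<omega>)"
    using cond lg_cond sq st inp unfolding prep_body_def Let_def
    by (cases new; cases "q < lg") (simp_all del: power_Suc mult_Suc mult_Suc_right)
  moreover have "unchanged prep_vars {''pos''} s0 ?s3"
    using fr by (simp add: unchanged_def)
  moreover have "?s3 ''pos'' = (if new then ?p(?x := 3 ^ card (labels q)) else ?p)"
    by simp
  moreover have "?s3 ''Q'' 0 = 3 ^ card (labels (Suc q))" unfolding C using st by simp
  moreover have "?s3 ''m'' 0 = min (Suc q) lg" "?s3 ''R'' 0 = 2 ^ min (Suc q) lg" using st by (simp_all add: min_def)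
  ultimately show ?thesis unfolding prep_inv_def using P st(8) by simp
qed

lemma prep_bound: "q \<le> len \<Longrightarrow> prep_inv \<omega>0 q s \<omega> \<Longrightarrow> mem_bound \<beta> s"
proof -
  assume q: "q \<le> len" and inv: "prep_inv \<omega>0 q s \<omega>"
  note eb = exponent_bounds
  have fr: "unchanged prep_vars {''pos''} s0 s"
    and st: "s ''c1'' 0 = q" "positions (labels q) (s ''pos'')" "s ''Q'' 0 = 3 ^ card (labels q)"
     "s ''m'' 0 = min q lg" "s ''R'' 0 = 2 ^ min q lg" "s ''Z'' 0 = 2 ^ q" "s ''Y'' 0 = 2 ^ (q * q)"
    using inv unfolding prep_inv_def by - (elim conjE, assumption)+
  have old: "s0 x i < 2 ^ \<beta>" for x i
    using mem_boundD[OF mem_bound_mono[OF s0_bound]] eb by simp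
  have Q: "(3::nat) ^ card (labels q) < 2 ^ \<beta>"
    by (rule less_power_\<beta>[OF power3_le[OF card_labels_le(3)]]) (use eb in linarith)
  have "q < 2 ^ \<beta>" by (rule small_less_power_\<beta>[of _ "3 * len"]) (use q eb in auto)
  moreover have "min q lg < 2 ^ \<beta>" by (rule small_less_power_\<beta>[of _ lg]) (use eb in auto)
  moreover have "(2::nat) ^ min q lg < 2 ^ \<beta>" by (rule less_power_\<beta>[of _ "min q lg"]) (use eb in auto)
  moreover have "(2::nat) ^ q < 2 ^ \<beta>" by (rule less_power_\<beta>[of _ q]) (use q eb in auto)
  moreover have "(2::nat) ^ (q * q) < 2 ^ \<beta>"
    by (rule less_power_\<beta>[of _ "len * len"]) (use q eb in \<open>auto intro: power_increasing mult_le_mono\<close>)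
  moreover have "s ''pos'' i < 2 ^ \<beta>" for i
    using positions_le[OF st(2), of i] Q by linarith
  ultimately have new: "x \<in> prep_vars \<Longrightarrow> x \<in> {''pos''} \<or> i = 0 \<Longrightarrow> s x i < 2 ^ \<beta>" for x i
    using st Q by (elim insertE disjE) simp_all
  show ?thesis unfolding mem_bound_def
  proof (intro allI)
    fix x i
    show "s x i < 2 ^ \<beta>"
      using new[of x i] unchangedD[OF fr, of x i] old[of x i] by metis
  qed
qed

section \<open>Tossing the random weights\<close>

definition init_weight :: "nat \<Rightarrow> nat" where
  "init_weight u = (if postfix t ! (3 * (u div 2)) = 0 then len else 0)"

definition partial_weight :: "bool stream \<Rightarrow> nat \<Rightarrow> nat \<Rightarrow> nat" where
  "partial_weight \<omega> u l = init_weight u * 2 ^ l + block (snth \<omega>) (u * bits) l"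

definition weight_inv :: "state \<Rightarrow> bool stream \<Rightarrow> nat \<Rightarrow> state \<Rightarrow> bool stream \<Rightarrow> bool" where
  "weight_inv s1 \<omega>0 c s \<omega> \<longleftrightarrow> \<omega> = sdrop c \<omega>0 \<and> unchanged weight_vars {''w''} s1 s \<and>
     s ''c2'' 0 = c \<and> s ''t'' 0 \<le> 1 \<and>
     (\<forall>u. s ''w'' u = (if u * bits < c then 2 ^ (len * partial_weight \<omega>0 u (min bits (c - u * bits))) else 0))"

lemma partial_weight_le: "l \<le> bits \<Longrightarrow> partial_weight \<omega> u l \<le> (len + 1) * 2 ^ bits"
proof -
  assume l: "l \<le> bits"
  have "init_weight u * 2 ^ l \<le> len * 2 ^ bits"
    using l by (intro mult_le_mono power_increasing) (auto simp: init_weight_def)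
  moreover have "block (snth \<omega>) (u * bits) l \<le> 2 ^ bits"
    using block_less[of "snth \<omega>" "u * bits" l] power_increasing[OF l, of "2::nat"] by linarith
  ultimately show ?thesis by (simp add: partial_weight_def algebra_simps)
qed

lemma prep_facts:
  assumes "prep_inv \<omega>0 len s1 \<omega>1"
  shows "s1 ''n'' 0 = n" "s1 ''b'' 0 = b" "s1 ''len'' 0 = len" "\<And>i. s1 ''term'' i = of_bool (i \<in> T)"
    "\<And>i. i < len \<Longrightarrow> s1 ''expr'' i = postfix t ! i"
    "\<And>x i. x \<in> {''c2'', ''c3'', ''c4'', ''t'', ''w'', ''tab'', ''start'', ''G'', ''out''} \<Longrightarrow> s1 x i = 0"
    "s1 ''m'' 0 = lg" "s1 ''R'' 0 = 2 ^ lg" "s1 ''Z'' 0 = 2 ^ len" "s1 ''Y'' 0 = 2 ^ (len * len)"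
    "s1 ''Q'' 0 = 3 ^ card (labels len)" "positions (labels len) (s1 ''pos'')" "\<omega>1 = \<omega>0"
proof -
  have fr: "unchanged prep_vars {''pos''} s0 s1"
    and st: "positions (labels len) (s1 ''pos'')" "s1 ''Q'' 0 = 3 ^ card (labels len)"
     "s1 ''m'' 0 = min len lg" "s1 ''R'' 0 = 2 ^ min len lg" "s1 ''Z'' 0 = 2 ^ len" "s1 ''Y'' 0 = 2 ^ (len * len)"
     "\<omega>1 = \<omega>0"
    using assms unfolding prep_inv_def by - (elim conjE, assumption)+
  have "min len lg = lg" using lg_le by simp
  with st show "s1 ''m'' 0 = lg" "s1 ''R'' 0 = 2 ^ lg" "s1 ''Z'' 0 = 2 ^ len" "s1 ''Y'' 0 = 2 ^ (len * len)"
    "s1 ''Q'' 0 = 3 ^ card (labels len)" "positions (labels len) (s1 ''pos'')" "\<omega>1 = \<omega>0" by simp_all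
  note un = unchangedD[OF fr]
  show "s1 ''n'' 0 = n" "s1 ''b'' 0 = b" "s1 ''len'' 0 = len" "\<And>i. s1 ''term'' i = of_bool (i \<in> T)"
    "\<And>i. i < len \<Longrightarrow> s1 ''expr'' i = postfix t ! i"
    using un[of "''n''" 0] un[of "''b''" 0] un[of "''len''" 0] un[of "''term''"] un[of "''expr''"]
      s0_n s0_b s0_len s0_term s0_expr by simp_all
  show "s1 x i = 0" if "x \<in> {''c2'', ''c3'', ''c4'', ''t'', ''w'', ''tab'', ''start'', ''G'', ''out''}" for x i
  proof -
    have "x \<notin> prep_vars" using that by (elim insertE) simp_all
    then have "s1 x i = s0 x i" using un[of x i] by blast
    also have "\<dots> = 0" by (rule s0_zero) (use that in \<open>elim insertE; simp\<close>)
    finally show ?thesis .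
  qed
qed

lemma weight_init:
  assumes "prep_inv \<omega>0 len s1 \<omega>0"
  shows "weight_inv s1 \<omega>0 0 s1 \<omega>0"
  using prep_facts(6)[OF assms] by (simp add: weight_inv_def unchanged_def)

lemma weight_bits_aval: "s ''m'' 0 = lg \<Longrightarrow> aval (weight_bits d) s = bits"
  by (simp add: weight_bits_def bits_def)

lemma weight_step:
  assumes pi: "prep_inv \<omega>0 len s1 \<omega>0" and c: "c < 2 * nodes t * bits" and inv: "weight_inv s1 \<omega>0 c s \<omega>"
  shows "weight_inv s1 \<omega>0 (Suc c) (fst (run (weight_body d) (s, \<omega>))) (snd (run (weight_body d) (s, \<omega>)))"
proof -
  define u l where "u = c div bits" and "l = c mod bits"
  have cul: "c = u * bits + l" unfolding u_def l_def by (rule div_mult_mod_eq[symmetric])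
  have l: "l < bits" using bits_pos by (simp add: l_def)
  have u: "u < 2 * nodes t" using c unfolding u_def by (simp add: less_mult_imp_div_less)
  note pf = prep_facts[OF pi]
  have fr: "unchanged weight_vars {''w''} s1 s" and st: "s ''c2'' 0 = c" "\<omega> = sdrop c \<omega>0"
    and w: "\<forall>u. s ''w'' u = (if u * bits < c then 2 ^ (len * partial_weight \<omega>0 u (min bits (c - u * bits))) else 0)"
    using inv unfolding weight_inv_def by - (elim conjE, assumption)+
  note un = unchangedD[OF fr]
  have s: "s ''m'' 0 = lg" "s ''Z'' 0 = 2 ^ len" "s ''Y'' 0 = 2 ^ (len * len)" "s ''len'' 0 = len"
    using un[of "''m''" 0] un[of "''Z''" 0] un[of "''Y''" 0] un[of "''len''" 0] pf by simp_all
  have "3 * (u div 2) < len" using u len_eq by simp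
  then have ex: "s ''expr'' (3 * (u div 2)) = postfix t ! (3 * (u div 2))"
    using un[of "''expr''"] pf(5) by simp
  let ?W = "\<lambda>l. (2::nat) ^ (len * partial_weight \<omega>0 u l)"
  let ?t = "of_bool (\<omega>0 !! c) :: nat"
  have W0: "?W 0 = (if postfix t ! (3 * (u div 2)) = 0 then 2 ^ (len * len) else 1)"
    by (simp add: partial_weight_def init_weight_def)
  \<comment> \<open>Before the first bit the cell still holds 0; there the initialization supplies
    \<open>?W 0\<close>.\<close>
  have wu: "s ''w'' u = ?W l" if "l \<noteq> 0" using spec[OF w, of u] that l by (simp add: cul)
  have WS: "?W l * ?W l * (1 + ?t * (2 ^ len - 1)) = ?W (Suc l)"
  proof -
    have "len * partial_weight \<omega>0 u (Suc l) = len * partial_weight \<omega>0 u l + len * partial_weight \<omega>0 u l + len * ?t"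
      by (simp add: partial_weight_def algebra_simps cul)
    moreover have "1 + ?t * (2 ^ len - 1) = (2::nat) ^ (len * ?t)" by (simp add: of_bool_def)
    ultimately show ?thesis by (simp add: power_add)
  qed
  let ?s = "s(''t'' := (s ''t'')(0 := ?t), ''w'' := (s ''w'')(u := ?W (Suc l)), ''c2'' := (s ''c2'')(0 := Suc c))"
  have sh: "shd \<omega> = \<omega>0 !! c" "stl \<omega> = sdrop (Suc c) \<omega>0" using st by simp_all
  have r: "run (weight_body d) (s, \<omega>) = (?s, sdrop (Suc c) \<omega>0)"
  proof (cases "l = 0")
    case True
    show ?thesis
      using True st s ex sh WS W0 unfolding weight_body_def Let_def
      by (cases "postfix t ! (3 * (u div 2)) = 0")
        (simp_all add: u_def[symmetric] l_def[symmetric] weight_bits_aval del: sdrop.simps)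
  next
    case False
    then show ?thesis
      using st s ex sh WS wu unfolding weight_body_def Let_def
      by (simp add: u_def[symmetric] l_def[symmetric] weight_bits_aval del: sdrop.simps)
  qed
  have "?s ''w'' v = (if v * bits < Suc c then 2 ^ (len * partial_weight \<omega>0 v (min bits (Suc c - v * bits))) else 0)" for v
  proof (cases v u rule: linorder_cases)
    case less
    then have "Suc v * bits \<le> u * bits" by (intro mult_le_mono1) simp
    then have "v * bits + bits \<le> c" by (simp add: cul)
    then have "min bits (Suc c - v * bits) = bits" "min bits (c - v * bits) = bits" "v * bits < c"
      using bits_pos by linarith+
    then show ?thesis using spec[OF w, of v] less by simp
  next
    case equal
    have "min bits (Suc c - u * bits) = Suc l" using l by (simp add: cul Suc_diff_le)
    then show ?thesis using equal by (simp add: cul)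
  next
    case greater
    then have "Suc u * bits \<le> v * bits" by (intro mult_le_mono1) simp
    then have "\<not> v * bits < Suc c" using l by (simp add: cul)
    then show ?thesis using spec[OF w, of v] greater by simp
  qed
  moreover have "unchanged weight_vars {''w''} s1 ?s" using fr by (simp add: unchanged_def)
  moreover have "?s ''c2'' 0 = Suc c" "?s ''t'' 0 \<le> 1" by simp_all
  ultimately show ?thesis unfolding r weight_inv_def fst_conv snd_conv by blast
qed

lemma unchanged_bound:
  assumes "unchanged W A s s'" "mem_bound \<beta> s" "\<And>x i. x \<in> W \<Longrightarrow> x \<in> A \<or> i = 0 \<Longrightarrow> s' x i < 2 ^ \<beta>"
  shows "mem_bound \<beta> s'"
  unfolding mem_bound_def
proof (intro allI)
  fix x i
  show "s' x i < 2 ^ \<beta>"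
    using unchangedD[OF assms(1), of x i] mem_boundD[OF assms(2), of x i] assms(3)[of x i] by metis
qed

lemma weight_bound:
  assumes "prep_inv \<omega>0 len s1 \<omega>0" "c \<le> 2 * nodes t * bits" "weight_inv s1 \<omega>0 c s \<omega>"
  shows "mem_bound \<beta> s"
proof -
  note eb = exponent_bounds
  have fr: "unchanged weight_vars {''w''} s1 s" and st: "s ''c2'' 0 = c" "s ''t'' 0 \<le> 1"
    and w: "\<forall>u. s ''w'' u = (if u * bits < c then 2 ^ (len * partial_weight \<omega>0 u (min bits (c - u * bits))) else 0)"
    using assms(3) unfolding weight_inv_def by - (elim conjE, assumption)+
  have "c < 2 ^ \<beta>"
  proof (rule small_less_power_\<beta>[of _ "len * ((len + 1) * 2 ^ bits)"])
    have "2 * nodes t * bits \<le> len * bits" by (intro mult_le_mono1) (simp add: len_eq)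
    then have "c \<le> len * bits" using assms(2) by linarith
    also have "bits \<le> 1 * 2 ^ bits" by (simp add: less_imp_le)
    also have "1 * 2 ^ bits \<le> (len + 1) * (2::nat) ^ bits" by (intro mult_le_mono1) simp
    finally show "c \<le> len * ((len + 1) * 2 ^ bits)" by simp
  qed (use eb in simp)
  moreover have "s ''t'' 0 < 2 ^ \<beta>" using st(2) one_less_power[of "2::nat" \<beta>] eb by simp
  moreover have "s ''w'' u < 2 ^ \<beta>" for u
  proof -
    have "s ''w'' u \<le> 2 ^ (len * ((len + 1) * 2 ^ bits))"
      using spec[OF w, of u] partial_weight_le[of "min bits (c - u * bits)" \<omega>0 u]
      by (auto intro!: power_increasing mult_le_mono2)
    then show ?thesis by (rule less_power_\<beta>) (use eb in simp)
  qed
  ultimately show ?thesis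
    using st(1) by (intro unchanged_bound[OF fr prep_bound[OF order_refl assms(1)]]) (elim insertE; simp)
qed

end

section \<open>The table computation\<close>

abbreviation node_exp :: aexp where "node_exp \<equiv> Quot (V ''c3'') (V ''Q'')"
abbreviation code_exp :: aexp where "code_exp \<equiv> Rem (V ''c3'') (V ''Q'')"

definition arg_exp :: "nat \<Rightarrow> aexp" where
  "arg_exp e = Load ''expr'' (Add (Mul (Const 3) node_exp) (Const e))"

definition digit_exp :: "nat \<Rightarrow> aexp" where
  "digit_exp e = Rem (Quot code_exp (Load ''pos'' (arg_exp e))) (Const 3)"

text \<open>The digit removed is read from the original code even if \<open>c\<close> has already
  been updated at another label; for the two distinct labels of a join this is the same
  digit.\<close>

definition upd_exp :: "aexp \<Rightarrow> nat \<Rightarrow> aexp \<Rightarrow> aexp" where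
  "upd_exp c e a = Add (Sub c (Mul (digit_exp e) (Load ''pos'' (arg_exp e)))) (Mul a (Load ''pos'' (arg_exp e)))"

definition prev_exp :: "aexp \<Rightarrow> aexp" where
  "prev_exp c = Load ''tab'' (Add (Mul (Sub node_exp (Const 1)) (V ''Q'')) c)"

definition weight_exp :: "nat \<Rightarrow> aexp" where
  "weight_exp e = Load ''w'' (Add (Mul (Const 2) node_exp) (Const e))"

definition incl_excl_exp :: "aexp \<Rightarrow> aexp \<Rightarrow> aexp" where
  "incl_excl_exp a b = (let g = (\<lambda>a b. prev_exp (upd_exp (upd_exp code_exp 1 a) 2 b)) in
     Sub (Add (g a b) (g (Const 0) (Const 0))) (Add (g a (Const 0)) (g (Const 0) b)))"

definition side_exp :: "nat \<Rightarrow> aexp" where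
  "side_exp a = Mul (incl_excl_exp (Const a) (Const a))
     (Add (Add (Mul (weight_exp 0) (eq_exp (digit_exp 2) (Const a)))
               (Mul (weight_exp 1) (eq_exp (digit_exp 1) (Const a))))
          (Mul (weight_exp 0) (weight_exp 1)))"

text \<open>The nested \<open>Sub (Const 1) (Sub (Const 1) _)\<close> maps the digits 0, 1, 2 to 0,
  1, 1.\<close>

definition introduce_exp :: aexp where
  "introduce_exp = Add (Add (Sub (Const 1) (Load ''term'' (arg_exp 2))) (Mul (Const 2) (weight_exp 1)))
     (Mul (Sub (Const 1) (Sub (Const 1) (digit_exp 1))) (weight_exp 0))"

definition oplus_exp :: aexp where
  "oplus_exp = Mul (Load ''tab'' (Add (Mul (Sub (Load ''start'' (Sub node_exp (Const 1))) (Const 1)) (V ''Q'')) code_exp))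
     (prev_exp code_exp)"

definition relabel_exp :: aexp where
  "relabel_exp = prev_exp (upd_exp code_exp 1 (digit_exp 2))"

definition join_exp :: aexp where
  "join_exp = Add (Add (Sub (prev_exp code_exp)
       (Mul (eq_exp (Mul (digit_exp 1) (digit_exp 2)) (Const 2)) (incl_excl_exp (digit_exp 1) (digit_exp 2))))
     (side_exp 1)) (side_exp 2)"

definition dp_node :: "aexp \<Rightarrow> aexp \<Rightarrow> com" where
  "dp_node v a = Seq (Store ''tab'' (V ''c3'') v) (Store ''start'' node_exp a)"

definition dp_body :: com where
  "dp_body = (let prev_start = Load ''start'' (Sub node_exp (Const 1)) in
     Seq (If (arg_exp 0)
           (If (Sub (arg_exp 0) (Const 1))
              (If (Sub (arg_exp 0) (Const 2))
                 (dp_node join_exp prev_start)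
                 (dp_node relabel_exp prev_start))
              (dp_node oplus_exp (Load ''start'' (Sub prev_start (Const 1)))))
           (dp_node introduce_exp node_exp))
         (Store ''c3'' (Const 0) (Add (V ''c3'') (Const 1))))"

lemma run_dp_node:
  "run (dp_node v a) (s, \<omega>) =
     (let s1 = s(''tab'' := (s ''tab'')(s ''c3'' 0 := aval v s)) in
      s1(''start'' := (s ''start'')(s ''c3'' 0 div s ''Q'' 0 := aval a s1)), \<omega>)"
  by (simp add: dp_node_def Let_def)

lemma card_cverts_le: "card (cverts t) \<le> nodes t"
proof (induction t)
  case (Oplus t u)
  then show ?case using card_Un_le[of "cverts t" "cverts u"] by simp
qed auto

text \<open>The first node in postfix order is always an introduction, which cannot make its vertex
  both live and dead.\<close>

lemma valid_first: "valid T t p C \<Longrightarrow> \<not> (2 * p \<in> C \<and> 2 * p + 1 \<in> C)"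
  by (induction t arbitrary: p) auto

text \<open>There are \<open>2 * nodes t\<close> choices and at most \<open>nodes t\<close>
  vertices, so at most \<open>2 ^ (3 * nodes t)\<close> pairs, which is \<open>2 ^ len\<close> for
  the whole expression. The inequality is strict because the full choice set is invalid; strictness
  is what prevents a carry out of a digit in base \<open>2 ^ len\<close>.\<close>

lemma card_configs_less: "card (configs T t p s) < 2 ^ (3 * nodes t)"
proof -
  let ?P = "Pow (choices t p) \<times> Pow (cverts t)"
  have fin: "finite ?P" by (simp add: finite_choices finite_cverts)
  have "2 * p \<in> choices t p" "2 * p + 1 \<in> choices t p" using nodes_pos[of t] by (auto simp: choices_def)
  then have "(choices t p, {}) \<notin> configs T t p s" using valid_first[of T t p "choices t p"] by (auto simp: configs_def)
  then have "configs T t p s \<subset> ?P" using configs_subset[of T t p s] by auto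
  then have "card (configs T t p s) < card ?P" by (rule psubset_card_mono[OF fin])
  also have "\<dots> = 2 ^ (2 * nodes t) * 2 ^ card (cverts t)"
    by (simp add: card_cartesian_product card_Pow finite_choices finite_cverts, simp add: choices_def)
  also have "\<dots> \<le> 2 ^ (3 * nodes t)"
    using card_cverts_le[of t] by (simp flip: power_add)
  finally show ?thesis .
qed

lemma table_le:
  assumes "\<And>u. w u \<le> 2 ^ B"
  shows "table T w t p s \<le> 2 ^ (3 * nodes t + 2 * nodes t * B)"
proof -
  have "(\<Prod>u\<in>C. w u) \<le> 2 ^ (2 * nodes t * B)" if "(C, L) \<in> configs T t p s" for C L
  proof -
    have C: "C \<subseteq> choices t p" using that by (simp add: configs_def)
    have "(\<Prod>u\<in>C. w u) \<le> (\<Prod>u\<in>C. 2 ^ B)" by (rule prod_mono) (use assms in auto)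
    also have "\<dots> = 2 ^ (card C * B)" by (simp add: power_mult mult.commute)
    also have "card C \<le> card (choices t p)" using C finite_choices by (rule card_mono[rotated])
    then have "(2::nat) ^ (card C * B) \<le> 2 ^ (2 * nodes t * B)"
      by (intro power_increasing mult_le_mono1) (auto simp: choices_def)
    finally show ?thesis .
  qed
  then have "table T w t p s \<le> (\<Sum>x\<in>configs T t p s. 2 ^ (2 * nodes t * B))"
    unfolding table_def weight_sum_def by (intro sum_mono) auto
  also have "\<dots> = card (configs T t p s) * 2 ^ (2 * nodes t * B)" by simp
  also have "card (configs T t p s) \<le> 2 ^ (3 * nodes t)" using card_configs_less by (rule less_imp_le)
  finally show ?thesis by (simp add: power_add)
qed

context steiner_input
begin

definition final_weight :: "bool stream \<Rightarrow> nat \<Rightarrow> nat" where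
  "final_weight \<omega> u = (if u < 2 * nodes t then (2 ^ len) ^ partial_weight \<omega> u bits else 0)"

lemma weight_facts:
  assumes "prep_inv \<omega>0 len s1 \<omega>0" "weight_inv s1 \<omega>0 (2 * nodes t * bits) s \<omega>"
  shows "s ''w'' = final_weight \<omega>0" "s ''n'' 0 = n" "s ''b'' 0 = b" "s ''len'' 0 = len"
    "\<And>i. s ''term'' i = of_bool (i \<in> T)" "\<And>i. i < len \<Longrightarrow> s ''expr'' i = postfix t ! i"
    "\<And>x i. x \<in> {''c3'', ''c4'', ''tab'', ''start'', ''G'', ''out''} \<Longrightarrow> s x i = 0"
    "s ''R'' 0 = 2 ^ lg" "s ''Z'' 0 = 2 ^ len"
    "s ''Q'' 0 = 3 ^ card (labels len)" "positions (labels len) (s ''pos'')"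
proof -
  note pf = prep_facts[OF assms(1)]
  have fr: "unchanged weight_vars {''w''} s1 s"
    and w: "\<forall>u. s ''w'' u = (if u * bits < 2 * nodes t * bits
       then 2 ^ (len * partial_weight \<omega>0 u (min bits (2 * nodes t * bits - u * bits))) else 0)"
    using assms(2) unfolding weight_inv_def by - (elim conjE, assumption)+
  note un = unchangedD[OF fr]
  show "s ''w'' = final_weight \<omega>0"
  proof
    fix u
    show "s ''w'' u = final_weight \<omega>0 u"
    proof (cases "u < 2 * nodes t")
      case True
      then have "Suc u * bits \<le> 2 * nodes t * bits" by (intro mult_le_mono1) simp
      then have "min bits (2 * nodes t * bits - u * bits) = bits" "u * bits < 2 * nodes t * bits"
        using bits_pos True by simp_all
      then show ?thesis using spec[OF w, of u] True by (simp add: final_weight_def power_mult)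
    next
      case False
      then have "2 * nodes t * bits \<le> u * bits" by (intro mult_le_mono1) simp
      then show ?thesis using spec[OF w, of u] False by (simp add: final_weight_def)
    qed
  qed
  show "s ''n'' 0 = n" "s ''b'' 0 = b" "s ''len'' 0 = len" "s ''R'' 0 = 2 ^ lg" "s ''Z'' 0 = 2 ^ len"
    "s ''Q'' 0 = 3 ^ card (labels len)"
    using un[of "''n''" 0] un[of "''b''" 0] un[of "''len''" 0] un[of "''R''" 0] un[of "''Z''" 0] un[of "''Q''" 0] pf
    by simp_all
  show "\<And>i. s ''term'' i = of_bool (i \<in> T)" using un[of "''term''"] pf(4) by simp
  show "\<And>i. i < len \<Longrightarrow> s ''expr'' i = postfix t ! i" using un[of "''expr''"] pf(5) by simp
  have "s ''pos'' = s1 ''pos''" using un[of "''pos''"] by auto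
  then show "positions (labels len) (s ''pos'')" using pf(12) by simp
  show "s x i = 0" if "x \<in> {''c3'', ''c4'', ''tab'', ''start'', ''G'', ''out''}" for x i
  proof -
    have "x \<notin> weight_vars" using that by (elim insertE) simp_all
    then have "s x i = s1 x i" using un[of x i] by blast
    also have "\<dots> = 0" by (rule pf(6)) (use that in \<open>elim insertE; simp\<close>)
    finally show ?thesis .
  qed
qed

lemma final_weight_le: "final_weight \<omega> u \<le> 2 ^ (len * ((len + 1) * 2 ^ bits))"
  using partial_weight_le[of bits \<omega> u]
  by (auto simp: final_weight_def power_mult[symmetric] intro!: power_increasing mult_le_mono2)

definition node_table :: "(nat \<Rightarrow> nat) \<Rightarrow> (nat \<Rightarrow> nat) \<Rightarrow> nat \<Rightarrow> nat \<Rightarrow> nat" where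
  "node_table w pos p c = table T w (fst (occs t 0 ! p)) (snd (occs t 0 ! p)) (digit pos c)"

definition node_start :: "nat \<Rightarrow> nat" where
  "node_start p = snd (occs t 0 ! p)"

abbreviation codes :: nat where "codes \<equiv> 3 ^ card (labels len)"

text \<open>A single counter enumerates node and code together, the node being the leading part.
  Rows are thus filled in postfix order, and \<open>start\<close> of a node is rewritten with the
  same value for each code.\<close>

definition dp_inv :: "state \<Rightarrow> bool stream \<Rightarrow> nat \<Rightarrow> state \<Rightarrow> bool stream \<Rightarrow> bool" where
  "dp_inv s2 \<omega>2 c s \<omega> \<longleftrightarrow> \<omega> = \<omega>2 \<and> unchanged dp_vars {''tab'', ''start''} s2 s \<and>
     s ''c3'' 0 = c \<and>
     (\<forall>e. s ''tab'' e = (if e < c then node_table (s2 ''w'') (s2 ''pos'') (e div codes) (e mod codes) else 0)) \<and>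
     (\<forall>p. s ''start'' p = (if p * codes < c then node_start p else 0))"

lemma labels_subexprs: "x \<in> subexprs t \<Longrightarrow> clab x ` cverts x \<subseteq> labels len"
  using lab[of x] clab_postfix[of x] postfix_subexprs[of x t] well_formed_subexprs[OF wf]
  by (fastforce simp: labels_def)

lemma dp_step:
  assumes "prep_inv \<omega>0 len s1 \<omega>0" "weight_inv s1 \<omega>0 (2 * nodes t * bits) s2 \<omega>2"
    and c: "c < nodes t * codes" and inv: "dp_inv s2 \<omega>2 c s \<omega>"
  shows "dp_inv s2 \<omega>2 (Suc c) (fst (run dp_body (s, \<omega>))) (snd (run dp_body (s, \<omega>)))"
proof -
  define w pos p e where "w = s2 ''w''" and "pos = s2 ''pos''" and "p = c div codes" and "e = c mod codes"
  note wf2 = weight_facts[OF assms(1,2)]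
  have lb: "\<forall>x\<in>subexprs t. clab x ` cverts x \<subseteq> labels len" using labels_subexprs by blast
  have Q: "codes > 0" by simp
  have ce: "c = p * codes + e" unfolding p_def e_def by (rule div_mult_mod_eq[symmetric])
  have e: "e < codes" by (simp add: e_def)
  have p: "p < nodes t" using c unfolding p_def by (simp add: less_mult_imp_div_less)
  have fr: "unchanged dp_vars {''tab'', ''start''} s2 s"
    and st: "s ''c3'' 0 = c" "\<omega> = \<omega>2"
    and tab: "\<forall>e. s ''tab'' e = (if e < c then node_table (s2 ''w'') (s2 ''pos'') (e div codes) (e mod codes) else 0)"
    and start: "\<forall>p. s ''start'' p = (if p * codes < c then node_start p else 0)"
    using inv unfolding dp_inv_def by - (elim conjE, assumption)+
  note un = unchangedD[OF fr]
  have s: "s ''Q'' 0 = codes" "s ''w'' = w" "s ''pos'' = pos" "\<And>i. s ''term'' i = of_bool (i \<in> T)"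
    using un[of "''Q''" 0] un[of "''w''"] un[of "''pos''"] un[of "''term''"] wf2 by (auto simp: w_def pos_def)
  have pos: "positions (labels len) pos" using wf2 by (simp add: pos_def)
  let ?E = "\<lambda>a. postfix t ! (3 * p + a)"
  have ar: "s ''expr'' (3 * p + a) = ?E a" if "a < 3" for a
  proof -
    have "3 * p + a < len" using p that len_eq by simp
    then show ?thesis using un[of "''expr''"] wf2(6) by simp
  qed
  \<comment> \<open>Rows of earlier nodes are complete, so even a code larger than the current one
    may be looked up in them.\<close>
  have look: "s ''tab'' (q * codes + f) = node_table w pos q f" if "q < p" "f < codes" for q f
  proof -
    have "Suc q * codes \<le> p * codes" using that(1) by (intro mult_le_mono1) simp
    then have "q * codes + f < c" using that(2) ce by simp
    then show ?thesis using spec[OF tab, of "q * codes + f"] that(2) by (simp add: w_def pos_def)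
  qed
  have look_st: "s ''start'' q = node_start q" if "q < p" for q
  proof -
    have "Suc q * codes \<le> p * codes" using that(1) by (intro mult_le_mono1) simp
    moreover have "q * codes < Suc q * codes" by simp
    ultimately have "q * codes < c" using ce by linarith
    then show ?thesis using spec[OF start, of q] by simp
  qed
  note av = st(1) s p_def[symmetric] e_def[symmetric]
  have a_arg: "aval (arg_exp a) s = ?E a" if "a < 3" for a
    using ar[OF that] by (simp add: arg_exp_def av)
  have a_dig: "aval (digit_exp a) s = digit pos e (?E a)" if "a < 3" for a
    using a_arg[OF that] by (simp add: digit_exp_def digit_def av)
  have a_upd: "aval (upd_exp x a y) s = aval x s - digit pos e (?E a) * pos (?E a) + aval y s * pos (?E a)"
    if "a < 3" for a x y
    using a_arg[OF that] a_dig[OF that] by (simp add: upd_exp_def av)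
  have a_prev: "aval (prev_exp x) s = s ''tab'' ((p - 1) * codes + aval x s)" for x
    by (simp add: prev_exp_def av)
  have a_w: "aval (weight_exp a) s = w (2 * p + a)" for a
    by (simp add: weight_exp_def av)
  have a_code: "aval code_exp s = e" by (simp add: av)
  note nv = node_value[OF wf lb pos p e, where T = T and w = w, folded node_table_def node_start_def]
  define val nst where "val = node_table w pos p e" and "nst = node_start p"
  let ?s = "s(''tab'' := (s ''tab'')(c := val), ''start'' := (s ''start'')(p := nst), ''c3'' := (s ''c3'')(0 := Suc c))"
  have r: "run dp_body (s, \<omega>) = (?s, \<omega>)"
    using nv
  proof (elim disjE, goal_cases)
    case nv: 1
    have 1: "aval introduce_exp s = val"
      using nv by (simp add: introduce_exp_def a_arg a_dig a_w s val_def)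
    show ?case using nv a_arg[of 0]
      by (simp add: dp_body_def Let_def run_dp_node 1 av nst_def)
  next
    case nv: 2
    have p0: "p - 1 < p" "node_start (p - 1) - 1 < p" using nv by linarith+
    have 1: "aval oplus_exp s = val"
      using nv look[OF p0(2) e] look[OF p0(1) e] look_st[OF p0(1)]
      by (simp add: oplus_exp_def a_prev a_code val_def av)
    show ?case using nv a_arg[of 0] look_st[OF p0(1)] look_st[OF p0(2)]
      by (simp add: dp_body_def Let_def run_dp_node 1 av nst_def)
  next
    case nv: 3
    have p0: "p - 1 < p" using nv by linarith
    have 1: "aval relabel_exp s = val"
      using nv look[OF p0 positions_upd(1)[OF pos digit_less e, of "?E 1" pos e "?E 2"]]
      by (simp add: relabel_exp_def a_prev a_upd a_dig val_def upd_def[symmetric] av)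
    show ?case using nv a_arg[of 0] look_st[OF p0]
      by (simp add: dp_body_def Let_def run_dp_node 1 av nst_def)
  next
    case nv: 4
    have p0: "p - 1 < p" and ij: "?E 1 \<noteq> ?E 2" using nv by auto
    let ?g = "\<lambda>a b. upd pos e (?E 1) a - digit pos e (?E 2) * pos (?E 2) + b * pos (?E 2)"
    have g: "s ''tab'' ((p - 1) * codes + ?g a b) = node_table w pos (p - 1) (?g a b)" if "a < 3" "b < 3" for a b
    proof (rule look[OF p0])
      note u = positions_upd[OF pos that(1) e, of "?E 1"]
      have "digit pos (upd pos e (?E 1) a) (?E 2) = digit pos e (?E 2)" using u(2) ij by simp
      then have "?g a b = upd pos (upd pos e (?E 1) a) (?E 2) b" 
        unfolding upd_def[of pos "upd pos e (?E 1) a"] by (simp only:)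
      then show "?g a b < codes" using positions_upd(1)[OF pos that(2) u(1), of "?E 2"] by simp
    qed
    have lt: "(0::nat) < 3" "(1::nat) < 3" "(2::nat) < 3" by simp_all
    have a_ie: "aval (incl_excl_exp x y) s =
        node_table w pos (p - 1) (?g (aval x s) (aval y s)) + node_table w pos (p - 1) (?g 0 0) -
        (node_table w pos (p - 1) (?g (aval x s) 0) + node_table w pos (p - 1) (?g 0 (aval y s)))"
      if "aval x s < 3" "aval y s < 3" for x y
      by (simp only: incl_excl_exp_def Let_def aval.simps(1,3,4) a_prev a_upd[OF lt(2)] a_upd[OF lt(3)]
        a_code upd_def[symmetric] g[OF that] g[OF lt(1) lt(1)] g[OF that(1) lt(1)] g[OF lt(1) that(2)])
    define dx dy h where "dx = digit pos e (?E 1)" and "dy = digit pos e (?E 2)"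
      and "h = (\<lambda>a b. node_table w pos (p - 1) (?g a b))"
    have ie: "aval (incl_excl_exp x y) s = h (aval x s) (aval y s) + h 0 0 - (h (aval x s) 0 + h 0 (aval y s))"
      if "aval x s < 3" "aval y s < 3" for x y
      unfolding h_def by (rule a_ie[OF that])
    have d3: "dx < 3" "dy < 3" by (auto simp: dx_def dy_def digit_less)
    have av1: "aval (digit_exp 1) s = dx" "aval (digit_exp 2) s = dy"
      using a_dig[OF lt(2)] a_dig[OF lt(3)] by (simp_all only: dx_def dy_def)
    have lk: "s ''tab'' ((p - 1) * codes + e) = node_table w pos (p - 1) e" by (rule look[OF p0 e])
    have "val = node_table w pos (p - 1) e - of_bool (dx * dy = 2) * (h dx dy + h 0 0 - (h dx 0 + h 0 dy)) +
       (h 1 1 + h 0 0 - (h 1 0 + h 0 1)) * (w (2 * p) * of_bool (dy = 1) + w (2 * p + 1) * of_bool (dx = 1) + w (2 * p) * w (2 * p + 1)) +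
       (h 2 2 + h 0 0 - (h 2 0 + h 0 2)) * (w (2 * p) * of_bool (dy = 2) + w (2 * p + 1) * of_bool (dx = 2) + w (2 * p) * w (2 * p + 1))"
      using nv unfolding val_def Let_def dx_def dy_def h_def by blast
    then have 1: "aval join_exp s = val"
      by (simp add: join_exp_def side_exp_def ie d3 av1[simplified] a_w a_prev av lk[simplified])
    show ?case using nv a_arg[of 0] look_st[OF p0]
      by (simp add: dp_body_def Let_def run_dp_node 1 av nst_def)
  qed
  have "?s ''tab'' f = (if f < Suc c then node_table (s2 ''w'') (s2 ''pos'') (f div codes) (f mod codes) else 0)" for f
    using spec[OF tab, of f] by (auto simp: val_def w_def pos_def p_def e_def less_Suc_eq)
  moreover have "?s ''start'' q = (if q * codes < Suc c then node_start q else 0)" for q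
  proof (cases q p rule: linorder_cases)
    case less
    then have "Suc q * codes \<le> p * codes" by (intro mult_le_mono1) simp
    then have "q * codes < Suc c" using ce Q by simp
    then show ?thesis using look_st[OF less] less by simp
  next
    case equal
    then show ?thesis using ce by (simp add: nst_def)
  next
    case greater
    then have "Suc p * codes \<le> q * codes" by (intro mult_le_mono1) simp
    then have "\<not> q * codes < Suc c" using ce e by simp
    then show ?thesis using spec[OF start, of q] greater by simp
  qed
  moreover have "unchanged dp_vars {''tab'', ''start''} s2 ?s" using fr by (simp add: unchanged_def)
  moreover have "?s ''c3'' 0 = Suc c" by simp
  ultimately show ?thesis unfolding r dp_inv_def fst_conv snd_conv using st(2) by blast
qed

lemma node_table_le:
  assumes "p < nodes t"
  shows "node_table (final_weight \<omega>) pos p c \<le> 2 ^ (len + len * (len * ((len + 1) * 2 ^ bits)))"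
proof -
  let ?B = "len * ((len + 1) * 2 ^ bits)" and ?x = "fst (occs t 0 ! p)"
  have "?x \<in> subexprs t" using occs_nth[OF assms, of 0] by (simp add: occurs_def)
  then have "nodes ?x \<le> nodes t" by (rule nodes_subexprs)
  then have "3 * nodes ?x + 2 * nodes ?x * ?B \<le> len + len * ?B"
    unfolding len_eq by (intro add_mono mult_le_mono) auto
  then have "(2::nat) ^ (3 * nodes ?x + 2 * nodes ?x * ?B) \<le> 2 ^ (len + len * ?B)"
    by (rule power_increasing) simp
  then show ?thesis
    unfolding node_table_def using table_le[of "final_weight \<omega>" ?B, OF final_weight_le] le_trans by blast
qed

lemma dp_init:
  assumes "prep_inv \<omega>0 len s1 \<omega>0" "weight_inv s1 \<omega>0 (2 * nodes t * bits) s2 \<omega>2"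
  shows "dp_inv s2 \<omega>2 0 s2 \<omega>2"
  using weight_facts(7)[OF assms] by (simp add: dp_inv_def unchanged_def)

lemma dp_bound:
  assumes pi: "prep_inv \<omega>0 len s1 \<omega>0" and wi: "weight_inv s1 \<omega>0 (2 * nodes t * bits) s2 \<omega>2"
    and c: "c \<le> nodes t * codes" and inv: "dp_inv s2 \<omega>2 c s \<omega>"
  shows "mem_bound \<beta> s"
proof -
  note eb = exponent_bounds and wf2 = weight_facts[OF pi wi]
  have fr: "unchanged dp_vars {''tab'', ''start''} s2 s"
    and st: "s ''c3'' 0 = c"
    and tab: "\<forall>e. s ''tab'' e = (if e < c then node_table (s2 ''w'') (s2 ''pos'') (e div codes) (e mod codes) else 0)"
    and start: "\<forall>p. s ''start'' p = (if p * codes < c then node_start p else 0)"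
    using inv unfolding dp_inv_def by - (elim conjE, assumption)+
  have "c < 2 ^ \<beta>"
  proof (rule less_power_\<beta>[of _ "3 * len"])
    have "c \<le> len * 2 ^ (2 * len)"
      using c mult_le_mono[OF _ power3_le[OF card_labels_le(3)], of "nodes t" len len] len_eq by linarith
    also have "\<dots> \<le> 2 ^ len * 2 ^ (2 * len)" by (intro mult_le_mono1) (simp add: less_imp_le)
    finally show "c \<le> 2 ^ (3 * len)" by (simp flip: power_add)
  qed (use eb in simp)
  moreover have "s ''tab'' e < 2 ^ \<beta>" for e
  proof (cases "e < c")
    case True
    then have "e div codes < nodes t" using c by (simp add: less_mult_imp_div_less)
    then have "s ''tab'' e \<le> 2 ^ (len + len * (len * ((len + 1) * 2 ^ bits)))"
      using spec[OF tab, of e] True wf2(1) node_table_le by simp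
    then show ?thesis by (rule less_power_\<beta>) (use eb in simp)
  next
    case False
    then show ?thesis using spec[OF tab, of e] by simp
  qed
  moreover have "s ''start'' p < 2 ^ \<beta>" for p
  proof (cases "p * codes < c")
    case True
    then have p: "p < nodes t" using c by (metis less_le_trans mult_less_cancel2)
    have "node_start p \<le> p"
      using occs_nth[OF p, of 0] nodes_pos[of "fst (occs t 0 ! p)"] by (simp add: occurs_def node_start_def)
    then have "s ''start'' p \<le> len" using spec[OF start, of p] True p len_eq by simp
    then show ?thesis by (rule small_less_power_\<beta>) (use eb in simp)
  next
    case False
    then show ?thesis using spec[OF start, of p] by simp
  qed
  ultimately show ?thesis
    using st by (intro unchanged_bound[OF fr weight_bound[OF pi order_refl wi]]) (elim insertE; simp)
qed

end

section \<open>Reading off the answer digit by digit\<close>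

definition separator_exp :: "nat \<Rightarrow> aexp" where
  "separator_exp d = Mul (V ''len'') (pow_exp (V ''R'') (Suc d))"

text \<open>Code 0 at the root puts every class into state 0: all of them must be dead.\<close>

definition load_com :: com where
  "load_com = Store ''G'' (Const 0)
     (Load ''tab'' (Mul (Sub (Quot (V ''len'') (Const 3)) (Const 1)) (V ''Q'')))"

text \<open>As 4 divides \<open>2 ^ len\<close>, the remainder modulo 4 of the shifted number is
  that of its lowest digit. The quotient of the weight by the separator is the size of
  \<open>X\<close>, and the factor \<open>b\<close> rules out the empty set, which does not count as
  connected.\<close>

definition digit_body :: "nat \<Rightarrow> com" where
  "digit_body d =
     Seq (If (Mul (V ''b'') (Mul (eq_exp (Rem (V ''G'') (Const 4)) (Const 2))
                               (eq_exp (Quot (V ''c4'') (separator_exp d)) (V ''b''))))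
            (Store ''out'' (Const 0) (Const 1)) Skip)
    (Seq (Store ''G'' (Const 0) (Quot (V ''G'') (V ''Z'')))
         (Store ''c4'' (Const 0) (Add (V ''c4'') (Const 1))))"

abbreviation prep_test :: aexp where
  "prep_test \<equiv> Sub (V ''len'') (V ''c1'')"

abbreviation weight_test :: "nat \<Rightarrow> aexp" where
  "weight_test d \<equiv> Sub (weight_count d) (V ''c2'')"

abbreviation dp_test :: aexp where
  "dp_test \<equiv> Sub (Mul (Quot (V ''len'') (Const 3)) (V ''Q'')) (V ''c3'')"

abbreviation digit_test :: "nat \<Rightarrow> aexp" where
  "digit_test d \<equiv> Sub (Mul (separator_exp d) (Add (V ''n'') (Const 1))) (V ''c4'')"

definition prep_loop :: com where
  "prep_loop = While prep_test prep_body"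

definition weight_loop :: "nat \<Rightarrow> com" where
  "weight_loop d = While (weight_test d) (weight_body d)"

definition dp_loop :: com where
  "dp_loop = While dp_test dp_body"

definition digit_loop :: "nat \<Rightarrow> com" where
  "digit_loop d = While (digit_test d) (digit_body d)"

definition steiner_prog :: "nat \<Rightarrow> com" where
  "steiner_prog d = Seq init_com (Seq prep_loop (Seq (weight_loop d) (Seq dp_loop (Seq load_com (digit_loop d)))))"

lemma loop_free_bodies:
  "loop_free init_com" "loop_free prep_body" "loop_free (weight_body d)" "loop_free dp_body"
  "loop_free load_com" "loop_free (digit_body d)"
  by (simp_all add: init_com_def prep_body_def weight_body_def dp_body_def load_com_def digit_body_def
      dp_node_def Let_def)

context steiner_input
begin

definition separator :: nat where "separator = len * 2 ^ bits"

definition total :: "bool stream \<Rightarrow> nat" where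
  "total \<omega> = table T (final_weight \<omega>) t 0 (\<lambda>_. 0)"

definition hit :: "bool stream \<Rightarrow> nat \<Rightarrow> bool" where
  "hit \<omega> v \<longleftrightarrow> 0 < b \<and> total \<omega> div (2 ^ len) ^ v mod 4 = 2 \<and> v div separator = b"

definition digit_inv :: "state \<Rightarrow> bool stream \<Rightarrow> nat \<Rightarrow> state \<Rightarrow> bool stream \<Rightarrow> bool" where
  "digit_inv s3 \<omega>0 v s \<omega> \<longleftrightarrow> unchanged digit_vars {} s3 s \<and> s ''c4'' 0 = v \<and>
     s ''G'' 0 = total \<omega>0 div (2 ^ len) ^ v \<and> s ''out'' 0 = of_bool (\<exists>v'<v. hit \<omega>0 v')"

lemma separator_aval:
  "s ''len'' 0 = len \<Longrightarrow> s ''R'' 0 = 2 ^ lg \<Longrightarrow> aval (separator_exp d) s = separator"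
  by (simp add: separator_exp_def separator_def bits_def power_mult del: power_Suc mult_Suc_right pow_exp.simps)

lemma digit_step:
  assumes s3: "s3 ''len'' 0 = len" "s3 ''R'' 0 = 2 ^ lg" "s3 ''b'' 0 = b" "s3 ''Z'' 0 = 2 ^ len"
    and inv: "digit_inv s3 \<omega>0 v s \<omega>"
  shows "digit_inv s3 \<omega>0 (Suc v) (fst (run (digit_body d) (s, \<omega>))) (snd (run (digit_body d) (s, \<omega>)))"
proof -
  have fr: "unchanged digit_vars {} s3 s" and st: "s ''c4'' 0 = v"
     "s ''G'' 0 = total \<omega>0 div (2 ^ len) ^ v" "s ''out'' 0 = of_bool (\<exists>v'<v. hit \<omega>0 v')"
    using inv unfolding digit_inv_def by - (elim conjE, assumption)+
  note un = unchangedD[OF fr]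
  have s: "s ''len'' 0 = len" "s ''R'' 0 = 2 ^ lg" "s ''b'' 0 = b" "s ''Z'' 0 = 2 ^ len"
    using un[of "''len''" 0] un[of "''R''" 0] un[of "''b''" 0] un[of "''Z''" 0] s3 by simp_all
  let ?s = "(if hit \<omega>0 v then s(''out'' := (s ''out'')(0 := 1)) else s)
     (''G'' := (s ''G'')(0 := total \<omega>0 div (2 ^ len) ^ v div 2 ^ len), ''c4'' := (s ''c4'')(0 := Suc v))"
  have r: "run (digit_body d) (s, \<omega>) = (?s, \<omega>)"
    using st s separator_aval[of s, OF s(1,2)] by (auto simp: digit_body_def hit_def)
  have "?s ''out'' 0 = of_bool (\<exists>v'<Suc v. hit \<omega>0 v')"
    using st(3) by (auto simp: less_Suc_eq)
  moreover have "?s ''G'' 0 = total \<omega>0 div (2 ^ len) ^ Suc v"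
    by (simp add: div_mult2_eq[symmetric] mult.commute)
  moreover have "unchanged digit_vars {} s3 ?s" using fr by (simp add: unchanged_def)
  moreover have "?s ''c4'' 0 = Suc v" by simp
  ultimately show ?thesis unfolding r digit_inv_def fst_conv snd_conv by blast
qed

lemma occs_root: "occs t 0 ! (nodes t - 1) = (t, 0)"
  by (rule last_occs)

lemma total_le: "total \<omega> \<le> 2 ^ (len + len * (len * ((len + 1) * 2 ^ bits)))"
proof -
  have "digit (\<lambda>_. 0) 0 = (\<lambda>_. 0)" by (simp add: digit_def fun_eq_iff)
  then have "total \<omega> = node_table (final_weight \<omega>) (\<lambda>_. 0) (nodes t - 1) 0"
    unfolding total_def node_table_def occs_root by simp
  then show ?thesis using node_table_le[of "nodes t - 1" \<omega> "\<lambda>_. 0" 0] nodes_pos[of t] by simp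
qed

lemma digit_bound:
  assumes "mem_bound \<beta> s3" "v \<le> separator * (n + 1)" "digit_inv s3 \<omega>0 v s \<omega>"
  shows "mem_bound \<beta> s"
proof -
  note eb = exponent_bounds
  have fr: "unchanged digit_vars {} s3 s" and st: "s ''c4'' 0 = v"
     "s ''G'' 0 = total \<omega>0 div (2 ^ len) ^ v" "s ''out'' 0 = of_bool (\<exists>v'<v. hit \<omega>0 v')"
    using assms(3) unfolding digit_inv_def by - (elim conjE, assumption)+
  have "v < 2 ^ \<beta>"
    by (rule small_less_power_\<beta>[of _ "separator * (n + 1)"]) (use assms(2) eb in \<open>auto simp: separator_def\<close>)
  moreover have "total \<omega>0 div (2 ^ len) ^ v < 2 ^ \<beta>"
  proof (rule less_power_\<beta>)
    show "total \<omega>0 div (2 ^ len) ^ v \<le> 2 ^ (len + len * (len * ((len + 1) * 2 ^ bits)))"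
      using total_le[of \<omega>0] div_le_dividend le_trans by blast
  qed (use eb in simp)
  moreover have "s ''out'' 0 < 2 ^ \<beta>" using st(3) one_less_power[of "2::nat" \<beta>] eb by (simp add: of_bool_def)
  ultimately show ?thesis
    using st by (intro unchanged_bound[OF fr assms(1)]) (elim insertE; simp)
qed

end

definition prog_time :: "nat \<Rightarrow> nat" where
  "prog_time d = ctime init_com + ctime load_com +
     while_time prep_test prep_body +
     while_time (weight_test d) (weight_body d) +
     while_time dp_test dp_body +
     while_time (digit_test d) (digit_body d)"

context steiner_input
begin

lemma steiner_prog_run:
  "\<exists>m s' \<omega>'. big_step (steiner_prog d) s0 \<omega> m s' \<omega>' \<and>
     m \<le> prog_time d * \<beta> * Suc (len + 2 * nodes t * bits + nodes t * codes + separator * (n + 1)) \<and>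
     (s' ''out'' 0 \<noteq> 0 \<longleftrightarrow> (\<exists>v < separator * (n + 1). hit \<omega> v))"
proof -
  note lf = loop_free_bodies and b1 = exponent_bounds(3)
  let ?X = "Suc (len + 2 * nodes t * bits + nodes t * codes + separator * (n + 1))"
  have bd0: "mem_bound \<beta> s0" using mem_bound_mono[OF s0_bound] exponent_bounds by blast
  obtain m0 where m0: "big_step init_com s0 \<omega> m0 (fst (run init_com (s0, \<omega>))) (snd (run init_com (s0, \<omega>)))"
      "m0 \<le> ctime init_com * \<beta>"
    using loop_free_run[OF lf(1) bd0 b1, of \<omega>] by blast
  have "\<exists>m s' \<omega>'. big_step prep_loop (fst (run init_com (s0, \<omega>))) (snd (run init_com (s0, \<omega>))) m s' \<omega>' \<and>
      prep_inv \<omega> len s' \<omega>' \<and> m \<le> while_time prep_test prep_body * \<beta> * Suc len"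
    unfolding prep_loop_def
  proof (rule counted_while[where I = "prep_inv \<omega>" and n = len, OF lf(2) b1])
    have tst: "aval prep_test s = len - i" if "prep_inv \<omega> i s \<omega>'" for i s \<omega>'
    proof -
      have fr: "unchanged prep_vars {''pos''} s0 s" and c: "s ''c1'' 0 = i"
        using that unfolding prep_inv_def by - (elim conjE, assumption)+
      show ?thesis using unchangedD[OF fr, of "''len''" 0] s0_len c by simp
    qed
    show "aval prep_test s \<noteq> 0 \<and>
        prep_inv \<omega> (Suc i) (fst (run prep_body (s, \<omega>'))) (snd (run prep_body (s, \<omega>')))"
      if i: "i < len" "prep_inv \<omega> i s \<omega>'" for i s \<omega>'
      using prep_step[OF i] tst[OF i(2)] i(1) by simp
    show "aval prep_test s = 0" if "prep_inv \<omega> len s \<omega>'" for s \<omega>'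
      using tst[OF that] by simp
  qed (use prep_bound prep_init in blast)+
  then obtain m1 s1 \<omega>1 where m1: "big_step prep_loop (fst (run init_com (s0, \<omega>))) (snd (run init_com (s0, \<omega>))) m1 s1 \<omega>1"
      "prep_inv \<omega> len s1 \<omega>1" "m1 \<le> while_time prep_test prep_body * \<beta> * Suc len"
    by blast
  have w1: "\<omega>1 = \<omega>" using prep_facts(13)[OF m1(2)] .
  note pi = m1(2)[unfolded w1]
  have M: "len div 3 = nodes t" by (simp add: len_eq)
  have "\<exists>m s' \<omega>'. big_step (weight_loop d) s1 \<omega> m s' \<omega>' \<and> weight_inv s1 \<omega> (2 * nodes t * bits) s' \<omega>' \<and>
      m \<le> while_time (weight_test d) (weight_body d) * \<beta> * Suc (2 * nodes t * bits)"
    unfolding weight_loop_def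
  proof (rule counted_while[where I = "weight_inv s1 \<omega>" and n = "2 * nodes t * bits", OF lf(3) b1])
    have tst: "aval (weight_test d) s = 2 * nodes t * bits - i" if "weight_inv s1 \<omega> i s \<omega>'" for i s \<omega>'
    proof -
      have fr: "unchanged weight_vars {''w''} s1 s" and c: "s ''c2'' 0 = i"
        using that unfolding weight_inv_def by - (elim conjE, assumption)+
      have "s ''len'' 0 = len" "s ''m'' 0 = lg"
        using unchangedD[OF fr, of "''len''" 0] unchangedD[OF fr, of "''m''" 0] prep_facts(3,7)[OF pi] by simp_all
      then show ?thesis using M weight_bits_aval c by (simp add: weight_count_def)
    qed
    show "aval (weight_test d) s \<noteq> 0 \<and>
        weight_inv s1 \<omega> (Suc i) (fst (run (weight_body d) (s, \<omega>'))) (snd (run (weight_body d) (s, \<omega>')))"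
      if i: "i < 2 * nodes t * bits" "weight_inv s1 \<omega> i s \<omega>'" for i s \<omega>'
      using weight_step[OF pi i] tst[OF i(2)] i(1) by simp
    show "aval (weight_test d) s = 0" if "weight_inv s1 \<omega> (2 * nodes t * bits) s \<omega>'" for s \<omega>'
      using tst[OF that] by simp
  qed (use weight_bound[OF pi] weight_init[OF pi] in blast)+
  then obtain m2 s2 \<omega>2 where m2: "big_step (weight_loop d) s1 \<omega> m2 s2 \<omega>2"
      "weight_inv s1 \<omega> (2 * nodes t * bits) s2 \<omega>2"
      "m2 \<le> while_time (weight_test d) (weight_body d) * \<beta> * Suc (2 * nodes t * bits)"
    by blast
  note wi = m2(2) and wfc = weight_facts[OF pi m2(2)]
  have "\<exists>m s' \<omega>'. big_step dp_loop s2 \<omega>2 m s' \<omega>' \<and> dp_inv s2 \<omega>2 (nodes t * codes) s' \<omega>' \<and>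
      m \<le> while_time dp_test dp_body * \<beta> * Suc (nodes t * codes)"
    unfolding dp_loop_def
  proof (rule counted_while[where I = "dp_inv s2 \<omega>2" and n = "nodes t * codes", OF lf(4) b1])
    have tst: "aval dp_test s = nodes t * codes - i" if "dp_inv s2 \<omega>2 i s \<omega>'" for i s \<omega>'
    proof -
      have fr: "unchanged dp_vars {''tab'', ''start''} s2 s" and c: "s ''c3'' 0 = i"
        using that unfolding dp_inv_def by - (elim conjE, assumption)+
      have "s ''len'' 0 = len" "s ''Q'' 0 = codes"
        using unchangedD[OF fr, of "''len''" 0] unchangedD[OF fr, of "''Q''" 0] wfc by simp_all
      then show ?thesis using c M by simp
    qed
    show "aval dp_test s \<noteq> 0 \<and>
        dp_inv s2 \<omega>2 (Suc i) (fst (run dp_body (s, \<omega>'))) (snd (run dp_body (s, \<omega>')))"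
      if i: "i < nodes t * codes" "dp_inv s2 \<omega>2 i s \<omega>'" for i s \<omega>'
      using dp_step[OF pi wi i] tst[OF i(2)] i(1) by simp
    show "aval dp_test s = 0" if "dp_inv s2 \<omega>2 (nodes t * codes) s \<omega>'" for s \<omega>'
      using tst[OF that] by simp
  qed (use dp_bound[OF pi wi] dp_init[OF pi wi] in blast)+
  then obtain m3 s3 \<omega>3 where m3: "big_step dp_loop s2 \<omega>2 m3 s3 \<omega>3" "dp_inv s2 \<omega>2 (nodes t * codes) s3 \<omega>3"
      "m3 \<le> while_time dp_test dp_body * \<beta> * Suc (nodes t * codes)"
    by blast
  have fr: "unchanged dp_vars {''tab'', ''start''} s2 s3"
    and tab: "\<forall>e. s3 ''tab'' e = (if e < nodes t * codes then node_table (s2 ''w'') (s2 ''pos'') (e div codes) (e mod codes) else 0)"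
    using m3(2) unfolding dp_inv_def by - (elim conjE, assumption)+
  note un = unchangedD[OF fr]
  have s3: "s3 ''len'' 0 = len" "s3 ''Q'' 0 = codes" "s3 ''R'' 0 = 2 ^ lg" "s3 ''b'' 0 = b" "s3 ''Z'' 0 = 2 ^ len"
      "s3 ''n'' 0 = n" "s3 ''c4'' 0 = 0" "s3 ''out'' 0 = 0"
    using un[of "''len''" 0] un[of "''Q''" 0] un[of "''R''" 0] un[of "''b''" 0] un[of "''Z''" 0] un[of "''n''" 0]
      un[of "''c4''" 0] un[of "''out''" 0] wfc by simp_all
  have bd3: "mem_bound \<beta> s3" using dp_bound[OF pi wi order_refl m3(2)] .
  have "(nodes t - 1) * codes < nodes t * codes" using nodes_pos[of t] by simp
  then have "s3 ''tab'' ((nodes t - 1) * codes) = node_table (final_weight \<omega>) (s2 ''pos'') (nodes t - 1) 0"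
    using spec[OF tab, of "(nodes t - 1) * codes"] wfc(1) by simp
  also have "\<dots> = total \<omega>"
  proof -
    have "digit (s2 ''pos'') 0 = (\<lambda>_. 0)" by (simp add: digit_def fun_eq_iff)
    then show ?thesis unfolding node_table_def total_def occs_root by simp
  qed
  finally have G: "s3 ''tab'' ((nodes t - 1) * codes) = total \<omega>" .
  define s4 where "s4 = fst (run load_com (s3, \<omega>3))"
  obtain m4 where m4: "big_step load_com s3 \<omega>3 m4 s4 \<omega>3" "m4 \<le> ctime load_com * \<beta>"
    using loop_free_run[OF lf(5) bd3 b1, of \<omega>3] by (auto simp: s4_def load_com_def)
  have s4: "s4 = s3(''G'' := (s3 ''G'')(0 := total \<omega>))"
    unfolding s4_def load_com_def using s3 G M by simp
  have di: "digit_inv s4 \<omega> 0 s4 \<omega>3"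
    using s3 by (simp add: digit_inv_def unchanged_def s4)
  have s4f: "s4 ''len'' 0 = len" "s4 ''R'' 0 = 2 ^ lg" "s4 ''b'' 0 = b" "s4 ''Z'' 0 = 2 ^ len" "s4 ''n'' 0 = n"
    using s3 by (simp_all add: s4)
  have "total \<omega> < 2 ^ \<beta>" by (rule less_power_\<beta>[OF total_le exponent_bounds(6)])
  then have bd4: "mem_bound \<beta> s4" using bd3 by (simp add: mem_bound_def s4)
  have tst: "aval (digit_test d) s = separator * (n + 1) - i" if "digit_inv s4 \<omega> i s \<omega>'" for i s \<omega>'
  proof -
    have fr: "unchanged digit_vars {} s4 s" and c: "s ''c4'' 0 = i"
      using that unfolding digit_inv_def by - (elim conjE, assumption)+
    have "s ''len'' 0 = len" "s ''R'' 0 = 2 ^ lg" "s ''n'' 0 = n"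
      using unchangedD[OF fr, of "''len''" 0] unchangedD[OF fr, of "''R''" 0] unchangedD[OF fr, of "''n''" 0] s4f by simp_all
    then show ?thesis using c separator_aval by simp
  qed
  have "\<exists>m s' \<omega>'. big_step (digit_loop d) s4 \<omega>3 m s' \<omega>' \<and> digit_inv s4 \<omega> (separator * (n + 1)) s' \<omega>' \<and>
      m \<le> while_time (digit_test d) (digit_body d) * \<beta> * Suc (separator * (n + 1))"
    unfolding digit_loop_def
  proof (rule counted_while[where I = "digit_inv s4 \<omega>" and n = "separator * (n + 1)", OF lf(6) b1])
    fix i s \<omega>' assume i: "i < separator * (n + 1)" "digit_inv s4 \<omega> i s \<omega>'"
    show "aval (digit_test d) s \<noteq> 0 \<and> digit_inv s4 \<omega> (Suc i) (fst (run (digit_body d) (s, \<omega>'))) (snd (run (digit_body d) (s, \<omega>')))"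
      using digit_step[OF s4f(1-4) i(2)] tst[OF i(2)] i(1) by simp
  next
    fix s \<omega>' assume i: "digit_inv s4 \<omega> (separator * (n + 1)) s \<omega>'"
    show "aval (digit_test d) s = 0" using tst[OF i] by simp
  qed (use digit_bound[OF bd4] di in blast)+
  then obtain m5 s5 \<omega>5 where m5: "big_step (digit_loop d) s4 \<omega>3 m5 s5 \<omega>5" "digit_inv s4 \<omega> (separator * (n + 1)) s5 \<omega>5"
      "m5 \<le> while_time (digit_test d) (digit_body d) * \<beta> * Suc (separator * (n + 1))"
    by blast
  have "big_step (steiner_prog d) s0 \<omega> (m0 + (m1 + (m2 + (m3 + (m4 + m5))))) s5 \<omega>5"
    unfolding steiner_prog_def
    using m0(1) m1(1)[unfolded w1] m2(1) m3(1) m4(1) m5(1) by (intro big_step.Seq)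
  moreover have "m0 + (m1 + (m2 + (m3 + (m4 + m5)))) \<le> prog_time d * \<beta> * ?X"
  proof -
    have up: "a * \<beta> * x \<le> a * \<beta> * ?X" if "x \<le> ?X" for a x using that by (rule mult_le_mono2)
    have "m0 \<le> ctime init_com * \<beta> * ?X" using m0(2) up[of 1 "ctime init_com"] by simp
    moreover have "m4 \<le> ctime load_com * \<beta> * ?X" using m4(2) up[of 1 "ctime load_com"] by simp
    moreover note order_trans[OF m1(3) up] order_trans[OF m2(3) up] order_trans[OF m3(3) up] order_trans[OF m5(3) up]
    ultimately show ?thesis unfolding prog_time_def add_mult_distrib by simp
  qed
  moreover have "s5 ''out'' 0 \<noteq> 0 \<longleftrightarrow> (\<exists>v < separator * (n + 1). hit \<omega> v)"
  proof -
    have "s5 ''out'' 0 = of_bool (\<exists>v < separator * (n + 1). hit \<omega> v)"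
      using m5(2) unfolding digit_inv_def by (elim conjE) assumption
    then show ?thesis by simp
  qed
  ultimately show ?thesis by blast
qed

end

section \<open>Correctness and running time\<close>

lemma valid_terminals: "valid T t p C \<Longrightarrow> T \<inter> cverts t \<subseteq> sel t p C"
proof (induction t arbitrary: p)
  case (Oplus t u)
  then have "T \<inter> cverts t \<subseteq> sel t p C" "T \<inter> cverts u \<subseteq> sel u (p + nodes t) C" by simp_all
  then show ?case by auto
qed auto

text \<open>All multiplicities together stay below the base, so no digit carries: the terms of
  weight below \<open>v\<close> sum to less than \<open>Z ^ v\<close>, and those above contribute
  multiples of \<open>Z ^ Suc v\<close>.\<close>

lemma weighted_digit:
  fixes Z :: nat
  assumes "finite F" "(\<Sum>C\<in>F. a C) < Z"
  shows "(\<Sum>C\<in>F. a C * Z ^ wt C) div Z ^ v mod Z = (\<Sum>C\<in>{C \<in> F. wt C = v}. a C)"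
proof -
  let ?L = "{C \<in> F. wt C < v}" and ?E = "{C \<in> F. wt C = v}" and ?H = "{C \<in> F. v < wt C}"
  define low rest where "low = (\<Sum>C\<in>?L. a C * Z ^ wt C)" and "rest = (\<Sum>C\<in>?H. a C * Z ^ (wt C - Suc v))"
  have Z: "Z > 0" using assms(2) by simp
  have "F = (?L \<union> ?E) \<union> ?H" by auto
  then have "(\<Sum>C\<in>F. a C * Z ^ wt C) = (\<Sum>C\<in>(?L \<union> ?E) \<union> ?H. a C * Z ^ wt C)" by simp
  also have "\<dots> = low + (\<Sum>C\<in>?E. a C * Z ^ wt C) + (\<Sum>C\<in>?H. a C * Z ^ wt C)"
    using assms(1) unfolding low_def by (subst sum.union_disjoint; (subst sum.union_disjoint)?) auto
  also have "(\<Sum>C\<in>?E. a C * Z ^ wt C) = Z ^ v * (\<Sum>C\<in>?E. a C)"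
    by (simp add: sum_distrib_left mult.commute)
  also have "(\<Sum>C\<in>?H. a C * Z ^ wt C) = Z ^ v * (Z * rest)"
    unfolding rest_def sum_distrib_left
  proof (rule sum.cong[OF refl])
    fix C assume "C \<in> ?H"
    then have "Z ^ wt C = Z ^ v * (Z * Z ^ (wt C - Suc v))" by (simp flip: power_add power_Suc)
    then show "a C * Z ^ wt C = Z ^ v * (Z * (a C * Z ^ (wt C - Suc v)))" by simp
  qed
  finally have eq: "(\<Sum>C\<in>F. a C * Z ^ wt C) = low + Z ^ v * ((\<Sum>C\<in>?E. a C) + Z * rest)"
    by (simp add: algebra_simps)
  have "low < Z ^ v"
  proof (cases v)
    case 0
    then show ?thesis by (simp add: low_def)
  next
    case (Suc v')
    have "low \<le> (\<Sum>C\<in>?L. a C * Z ^ v')"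
      unfolding low_def using Z Suc by (intro sum_mono mult_le_mono2 power_increasing) auto
    also have "\<dots> = (\<Sum>C\<in>?L. a C) * Z ^ v'" by (simp add: sum_distrib_right)
    also have "\<dots> \<le> (\<Sum>C\<in>F. a C) * Z ^ v'" using assms(1) by (intro mult_le_mono1 sum_mono2) auto
    also have "\<dots> < Z * Z ^ v'" using assms(2) Z by simp
    finally show ?thesis using Suc by simp
  qed
  then have "(\<Sum>C\<in>F. a C * Z ^ wt C) div Z ^ v = (\<Sum>C\<in>?E. a C) + Z * rest"
    unfolding eq using Z by simp
  moreover have "(\<Sum>C\<in>?E. a C) < Z"
    using assms(1) by (intro le_less_trans[OF _ assms(2)] sum_mono2) auto
  ultimately show ?thesis by simp
qed

text \<open>Paths must stay inside \<open>X\<close>; this is connectedness of the subgraph induced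
  by \<open>X\<close>.\<close>

definition connected_in :: "'v set set \<Rightarrow> 'v set \<Rightarrow> bool" where
  "connected_in E X \<longleftrightarrow> X \<noteq> {} \<and>
     (\<forall>x\<in>X. \<forall>y\<in>X. (x, y) \<in> {(x, y). x \<in> X \<and> y \<in> X \<and> {x, y} \<in> E}\<^sup>*)"

context steiner_input
begin

definition complete_choices :: "nat set set" where
  "complete_choices = {C. C \<subseteq> choices t 0 \<and> valid T t 0 C \<and> (\<forall>l. live t 0 C l = {})}"

definition cut_count :: "nat set \<Rightarrow> nat" where
  "cut_count C = card (cuts (sel t 0 C) (used_edges t 0 C))"

definition choice_weight :: "bool stream \<Rightarrow> nat set \<Rightarrow> nat" where
  "choice_weight \<omega> C = (\<Sum>u\<in>C. partial_weight \<omega> u bits)"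

lemma len_pos: "0 < len"
  using len_ge by linarith

lemma choices_root: "choices t 0 = {..<2 * nodes t}"
  by (auto simp: choices_def)

lemma finite_complete_choices: "finite complete_choices"
  by (rule finite_subset[of _ "Pow (choices t 0)"]) (auto simp: complete_choices_def finite_choices)

lemma finite_sel: "finite (sel t 0 C)"
  by (rule finite_subset[OF sel_subset finite_cverts])

text \<open>With all states 0, \<open>admits\<close> only says that the live classes are empty and
  no longer involves \<open>L\<close>, which then ranges over all cuts.\<close>

lemma configs_root: "configs T t 0 (\<lambda>_. 0) = Sigma complete_choices (\<lambda>C. cuts (sel t 0 C) (used_edges t 0 C))"
  by (auto simp: configs_def complete_choices_def cuts_def admits_def)

lemma total_eq: "total \<omega> = (\<Sum>C\<in>complete_choices. cut_count C * (2 ^ len) ^ choice_weight \<omega> C)"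
proof -
  have "total \<omega> = (\<Sum>C\<in>complete_choices. \<Sum>L\<in>cuts (sel t 0 C) (used_edges t 0 C). \<Prod>u\<in>C. final_weight \<omega> u)"
    unfolding total_def table_def weight_sum_def configs_root
    by (subst sum.Sigma) (auto simp: finite_complete_choices finite_cuts finite_sel)
  also have "\<dots> = (\<Sum>C\<in>complete_choices. cut_count C * (2 ^ len) ^ choice_weight \<omega> C)"
  proof (rule sum.cong[OF refl])
    fix C assume "C \<in> complete_choices"
    then have "u < 2 * nodes t" if "u \<in> C" for u using that by (auto simp: complete_choices_def choices_root)
    then have "(\<Prod>u\<in>C. final_weight \<omega> u) = (\<Prod>u\<in>C. (2 ^ len) ^ partial_weight \<omega> u bits)"
      by (intro prod.cong) (auto simp: final_weight_def)
    also have "\<dots> = (2 ^ len) ^ choice_weight \<omega> C" unfolding choice_weight_def by (rule power_sum[symmetric])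
    finally show "(\<Sum>L\<in>cuts (sel t 0 C) (used_edges t 0 C). \<Prod>u\<in>C. final_weight \<omega> u) =
        cut_count C * (2 ^ len) ^ choice_weight \<omega> C" by (simp add: cut_count_def)
  qed
  finally show ?thesis .
qed

lemma sum_cut_count_less: "(\<Sum>C\<in>complete_choices. cut_count C) < 2 ^ len"
proof -
  have "(\<Sum>C\<in>complete_choices. cut_count C) = card (configs T t 0 (\<lambda>_. 0))"
    unfolding configs_root cut_count_def
    by (subst card_SigmaI) (auto simp: finite_complete_choices finite_cuts finite_sel)
  then show ?thesis using card_configs_less[of T t 0 "\<lambda>_. 0"] len_eq by simp
qed

definition choice_count :: "bool stream \<Rightarrow> nat \<Rightarrow> nat" where
  "choice_count \<omega> v = (\<Sum>C\<in>{C \<in> complete_choices. choice_weight \<omega> C = v}. cut_count C)"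

lemma total_digit:
  "total \<omega> div (2 ^ len) ^ v mod 4 = choice_count \<omega> v mod 4"
proof -
  have "(2::nat) ^ len = 4 * 2 ^ (len - 2)"
  proof -
    obtain j where "len = 2 + j" using le_Suc_ex[of 2 len] len_ge by auto
    then show ?thesis by (simp add: power_add)
  qed
  then have "total \<omega> div (2 ^ len) ^ v mod 4 = total \<omega> div (2 ^ len) ^ v mod 2 ^ len mod 4"
    by (metis dvd_triv_left mod_mod_cancel)
  then show ?thesis
    unfolding total_eq choice_count_def using weighted_digit[OF finite_complete_choices sum_cut_count_less] by simp
qed

lemma card_sel:
  assumes "C \<in> complete_choices"
  shows "card {u \<in> C. postfix t ! (3 * (u div 2)) = 0} = card (sel t 0 C)"
proof -
  have C: "C \<subseteq> choices t 0" "valid T t 0 C" using assms by (auto simp: complete_choices_def)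
  have "{u \<in> C. postfix t ! (3 * (u div 2)) = 0} = {u \<in> C \<inter> choices t 0. u div 2 \<in> intro_pos t 0}"
    using C(1) postfix_intro_pos[of _ t 0] by (auto simp: choices_root)
  then show ?thesis using card_intro_choices[OF wf C(2)] by simp
qed

definition random_weight :: "bool stream \<Rightarrow> nat \<Rightarrow> nat" where
  "random_weight \<omega> u = block (snth \<omega>) (u * bits) bits"

text \<open>A choice set has at most \<open>2 * nodes t \<le> len\<close> elements with random
  weights below \<open>2 ^ bits\<close> each. Their sum stays below the separator, so the size of
  \<open>X\<close> and the random part can be told apart.\<close>

lemma choice_weight_eq:
  assumes "C \<in> complete_choices"
  shows "choice_weight \<omega> C = separator * card (sel t 0 C) + sum (random_weight \<omega>) C"
    and "sum (random_weight \<omega>) C < separator"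
proof -
  have C: "C \<subseteq> {..<2 * nodes t}" using assms by (auto simp: complete_choices_def choices_root)
  then have fin: "finite C" by (rule finite_subset) simp
  have "(\<Sum>u\<in>C. init_weight u * 2 ^ bits) = (\<Sum>u\<in>{u \<in> C. postfix t ! (3 * (u div 2)) = 0}. len * 2 ^ bits)"
    using fin by (intro sum.mono_neutral_cong_right) (auto simp: init_weight_def)
  then have "(\<Sum>u\<in>C. init_weight u * 2 ^ bits) = separator * card (sel t 0 C)"
    using card_sel[OF assms] by (simp add: separator_def)
  then show "choice_weight \<omega> C = separator * card (sel t 0 C) + sum (random_weight \<omega>) C"
    by (simp add: choice_weight_def partial_weight_def sum.distrib random_weight_def)
  have "sum (random_weight \<omega>) C \<le> (\<Sum>u\<in>C. 2 ^ bits - 1)"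
  proof (rule sum_mono)
    fix u
    show "random_weight \<omega> u \<le> 2 ^ bits - 1"
      using block_less[of "snth \<omega>" "u * bits" bits] by (simp add: random_weight_def)
  qed
  also have "\<dots> = card C * (2 ^ bits - 1)" by simp
  also have "\<dots> \<le> len * (2 ^ bits - 1)"
    using card_mono[OF _ C] len_eq by (intro mult_le_mono1) simp
  also have "\<dots> < len * 2 ^ bits" using len_pos by simp
  finally show "sum (random_weight \<omega>) C < separator" by (simp add: separator_def)
qed

lemma choice_weight_div:
  assumes "C \<in> complete_choices"
  shows "choice_weight \<omega> C div separator = card (sel t 0 C)"
  using choice_weight_eq[OF assms, of \<omega>] by simp

lemma card_sel_le: "card (sel t 0 C) \<le> n"
  using card_mono[OF _ sel_subset, of t 0 C] cv by simp

text \<open>A digit that is 2 modulo 4 is nonzero, so some choice set has that weight. As it selects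
  at most \<open>n\<close> vertices, the loop inspects every relevant weight.\<close>

lemma hit_iff:
  "(\<exists>v < separator * (n + 1). hit \<omega> v) \<longleftrightarrow> 0 < b \<and>
     (\<exists>v. choice_count \<omega> v mod 4 = 2 \<and> v div separator = b)"
proof
  assume "0 < b \<and> (\<exists>v. choice_count \<omega> v mod 4 = 2 \<and> v div separator = b)"
  then obtain v where v: "0 < b" "choice_count \<omega> v mod 4 = 2" "v div separator = b"
    by blast
  then obtain C where C: "C \<in> complete_choices" "choice_weight \<omega> C = v"
    unfolding choice_count_def by (metis (mono_tags, lifting) empty_Collect_eq mod_0 sum.empty zero_neq_numeral)
  have "v div separator \<le> n" using choice_weight_div[OF C(1), of \<omega>] C(2) card_sel_le[of C] by simp
  then have "v div separator < n + 1" by simp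
  moreover have "separator > 0" using len_pos by (simp add: separator_def)
  ultimately have "v < separator * (n + 1)" by (metis div_less_iff_less_mult mult.commute)
  moreover have "hit \<omega> v" using v total_digit by (simp add: hit_def)
  ultimately show "\<exists>v < separator * (n + 1). hit \<omega> v" by blast
next
  assume "\<exists>v < separator * (n + 1). hit \<omega> v"
  then show "0 < b \<and> (\<exists>v. choice_count \<omega> v mod 4 = 2 \<and> v div separator = b)"
    unfolding hit_def total_digit by blast
qed

definition solvable :: bool where
  "solvable \<longleftrightarrow> (\<exists>X. X \<subseteq> {..<n} \<and> card X = b \<and> T \<subseteq> X \<and> connected_in (cedges t) X)"

text \<open>If the cut counts at some weight do not sum to a multiple of 4, then one of them is not
  a multiple of 4. The set selected there is connected by used edges, which are real. No randomness
  enters, hence no false positives.\<close>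

lemma hit_sound:
  assumes "\<exists>v < separator * (n + 1). hit \<omega> v"
  shows solvable
proof -
  obtain v where v: "0 < b" "choice_count \<omega> v mod 4 = 2"
      "v div separator = b"
    using assms hit_iff by blast
  have "\<exists>C\<in>{C \<in> complete_choices. choice_weight \<omega> C = v}. \<not> 4 dvd cut_count C"
  proof (rule ccontr)
    assume "\<not> ?thesis"
    then have "4 dvd choice_count \<omega> v"
      unfolding choice_count_def by (intro dvd_sum) blast
    then show False using v(2) by simp
  qed
  then obtain C where C: "C \<in> complete_choices" "choice_weight \<omega> C = v" "\<not> 4 dvd cut_count C" by blast
  let ?X = "sel t 0 C" and ?E = "used_edges t 0 C"
  have card: "card ?X = b" using choice_weight_div[OF C(1), of \<omega>] C(2) v(3) by simp
  have "T \<subseteq> ?X" using valid_terminals[of T t 0 C] C(1) T cv by (auto simp: complete_choices_def)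
  moreover have "connected_in (cedges t) ?X"
    unfolding connected_in_def
  proof (intro conjI ballI)
    show "?X \<noteq> {}" using card v(1) by auto
    fix x y assume xy: "x \<in> ?X" "y \<in> ?X"
    let ?R = "{(x, y). x \<in> ?X \<and> y \<in> ?X \<and> {x, y} \<in> cedges t}"
    have "(x, y) \<in> (?E \<union> ?E\<inverse>)\<^sup>*"
      using card_cuts_disconnected[OF finite_sel used_edges_subset xy] C(3) by (auto simp: cut_count_def)
    moreover have "?E \<union> ?E\<inverse> \<subseteq> ?R"
    proof clarify
      fix a b assume "(a, b) \<in> ?E \<union> ?E\<inverse>"
      then show "a \<in> ?X \<and> b \<in> ?X \<and> {a, b} \<in> cedges t"
        using used_edges_subset[of t 0 C] used_edges_cedges[OF wf, of a b 0 C] used_edges_cedges[OF wf, of b a 0 C]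
        by (auto simp: insert_commute)
    qed
    ultimately show "(x, y) \<in> ?R\<^sup>*" using rtrancl_mono by blast
  qed
  moreover have "?X \<subseteq> {..<n}" using sel_subset[of t 0 C] cv by simp
  ultimately show ?thesis unfolding solvable_def using card by blast
qed

text \<open>The family to be isolated is determined by the input alone, before any coin is tossed.
  The odd half of \<open>cut_count C\<close> is what survives modulo 4.\<close>

definition odd_choices :: "nat set set" where
  "odd_choices = {C \<in> complete_choices. card (sel t 0 C) = b \<and> cut_count C mod 4 = 2}"

lemma odd_choices_nonempty:
  assumes solvable
  shows "odd_choices \<noteq> {}" "0 < b"
proof -
  obtain X where X: "X \<subseteq> {..<n}" "card X = b" "T \<subseteq> X" "connected_in (cedges t) X"
    using assms unfolding solvable_def by blast
  let ?C = "canonical X t 0 {}"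
  have "T \<inter> cverts t \<subseteq> X" using X(3) by blast
  note can = canonical_correct[OF wf this, of 0 "{}"]
  have sel: "sel t 0 ?C = X" using can X(1) cv by auto
  let ?E = "used_edges t 0 ?C"
  have ne: "X \<noteq> {}" using X(4) by (simp add: connected_in_def)
  then show "0 < b" using X(1,2) finite_subset[of X "{..<n}"] by (auto simp: card_gt_0_iff)
  have "(x, y) \<in> (?E \<union> ?E\<inverse>)\<^sup>*" if "x \<in> X" "y \<in> X" for x y
  proof -
    have "{(x, y). x \<in> X \<and> y \<in> X \<and> {x, y} \<in> cedges t} \<subseteq> ?E \<union> ?E\<inverse>" using can by blast
    then show ?thesis using X(4) that rtrancl_mono unfolding connected_in_def by blast
  qed
  then have "cut_count ?C = 2"
    unfolding cut_count_def sel using ne used_edges_subset[of t 0 ?C] sel by (intro card_cuts_connected) auto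
  moreover have "?C \<in> complete_choices"
    using can canonical_subset[of X t 0 "{}"] by (simp add: complete_choices_def)
  ultimately have "?C \<in> odd_choices" using sel X(2) by (simp add: odd_choices_def)
  then show "odd_choices \<noteq> {}" by blast
qed

text \<open>A choice set of the same weight as the isolated one selects equally many vertices and
  has the same random weight. It therefore lies outside \<open>odd_choices\<close>, and its cut
  count, being even, is divisible by 4. Only the isolated set contributes modulo 4.\<close>

lemma hit_complete:
  assumes solvable "isolated odd_choices (random_weight \<omega>)"
  shows "\<exists>v < separator * (n + 1). hit \<omega> v"
proof -
  obtain A where A: "A \<in> odd_choices" "\<And>B. B \<in> odd_choices \<Longrightarrow> B \<noteq> A \<Longrightarrow> sum (random_weight \<omega>) A < sum (random_weight \<omega>) B"
    using assms(2) unfolding isolated_def by blast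
  have b: "0 < b" using odd_choices_nonempty(2)[OF assms(1)] .
  have Ac: "A \<in> complete_choices" "card (sel t 0 A) = b" "cut_count A mod 4 = 2" using A(1) by (auto simp: odd_choices_def)
  let ?v = "choice_weight \<omega> A"
  let ?S = "{C \<in> complete_choices. choice_weight \<omega> C = ?v}"
  have "4 dvd cut_count C" if C: "C \<in> ?S - {A}" for C
  proof -
    have Cc: "C \<in> complete_choices" "choice_weight \<omega> C = ?v" "C \<noteq> A" using C by auto
    have cb: "card (sel t 0 C) = b"
      using choice_weight_div[OF Cc(1), of \<omega>] choice_weight_div[OF Ac(1), of \<omega>] Cc(2) Ac(2) by simp
    then have "sum (random_weight \<omega>) C = sum (random_weight \<omega>) A"
      using choice_weight_eq(1)[OF Cc(1), of \<omega>] choice_weight_eq(1)[OF Ac(1), of \<omega>] Cc(2) Ac(2) by simp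
    then have "C \<notin> odd_choices" using A(2)[of C] Cc(3) by auto
    then have "cut_count C mod 4 \<noteq> 2" using Cc(1) cb by (simp add: odd_choices_def)
    moreover have "even (cut_count C)"
      unfolding cut_count_def using cb b by (intro even_card_cuts finite_sel used_edges_subset) auto
    ultimately show ?thesis by presburger
  qed
  then have "4 dvd (\<Sum>C\<in>?S - {A}. cut_count C)" by (rule dvd_sum)
  moreover have "(\<Sum>C\<in>?S. cut_count C) = cut_count A + (\<Sum>C\<in>?S - {A}. cut_count C)"
    using Ac(1) finite_complete_choices by (intro sum.remove) auto
  ultimately have "(\<Sum>C\<in>?S. cut_count C) mod 4 = 2"
    using Ac(3) by presburger
  then show ?thesis unfolding hit_iff choice_count_def using b choice_weight_div[OF Ac(1), of \<omega>] Ac(2) by blast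
qed

text \<open>\<open>accepts\<close> asks for some halting run; by determinism the run already
  constructed decides it.\<close>

lemma accepts_iff: "accepts (steiner_prog d) s0 \<omega> \<longleftrightarrow> (\<exists>v < separator * (n + 1). hit \<omega> v)"
proof -
  obtain m s' \<omega>' where r: "big_step (steiner_prog d) s0 \<omega> m s' \<omega>'"
      "s' ''out'' 0 \<noteq> 0 \<longleftrightarrow> (\<exists>v < separator * (n + 1). hit \<omega> v)"
    using steiner_prog_run[of \<omega>] by blast
  then show ?thesis unfolding accepts_def using big_step_deterministic by metis
qed

lemma random_weight_stake:
  assumes "u < 2 * nodes t"
  shows "block (nth (stake (2 * nodes t * bits) \<omega>)) (u * bits) bits = random_weight \<omega> u"
  unfolding random_weight_def
proof (rule block_cong)
  fix i assume i: "u * bits \<le> i" "i < u * bits + bits"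
  have "Suc u * bits \<le> 2 * nodes t * bits" using assms by (intro mult_le_mono1) simp
  then show "stake (2 * nodes t * bits) \<omega> ! i = \<omega> !! i" using i by (simp add: stake_nth)
qed

lemma total_cong:
  assumes "stake (2 * nodes t * bits) \<omega> = stake (2 * nodes t * bits) \<omega>'"
  shows "total \<omega> = total \<omega>'"
proof -
  have "final_weight \<omega> = final_weight \<omega>'"
  proof
    fix u
    show "final_weight \<omega> u = final_weight \<omega>' u"
      using random_weight_stake[of u \<omega>] random_weight_stake[of u \<omega>'] assms
      by (simp add: final_weight_def partial_weight_def random_weight_def)
  qed
  then show ?thesis by (simp add: total_def)
qed

lemma n_less_len: "n + 1 \<le> len"
  using card_cverts_le[of t] cv len_eq nodes_pos[of t] by simp

text \<open>\<open>bits\<close> contains one factor \<open>lg\<close> for the number of choices and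
  \<open>d\<close> more for \<open>(n + 1) ^ d\<close>, both bases being at most
  \<open>len \<le> 2 ^ lg\<close>.\<close>

lemma failure_le: "2 * nodes t * (n + 1) ^ d \<le> 2 ^ bits"
proof -
  have "2 * nodes t * (n + 1) ^ d \<le> len * len ^ d"
    using n_less_len len_eq by (intro mult_le_mono power_mono) auto
  also have "\<dots> = len ^ Suc d" by simp
  also have "\<dots> \<le> (2 ^ lg) ^ Suc d" by (rule power_mono[OF lg(1)]) simp
  finally show ?thesis by (simp add: bits_def power_mult del: power_Suc mult_Suc_right)
qed

lemma accept_prob_ge:
  assumes solvable
  shows "accept_prob (steiner_prog d) s0 \<ge> 1 - 1 / (real n + 1) ^ d"
proof -
  let ?M = "2 * nodes t * bits"
  \<comment> \<open>Padding with an arbitrary constant stream turns acceptance into a property of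
    the finite prefix that was actually tossed.\<close>
  define P where "P xs \<longleftrightarrow> (\<exists>v < separator * (n + 1). hit (xs @- sconst False) v)" for xs
  have acc: "accepts (steiner_prog d) s0 \<omega> \<longleftrightarrow> P (stake ?M \<omega>)" for \<omega>
  proof -
    have "stake ?M (stake ?M \<omega> @- sconst False) = stake ?M \<omega>" by (simp add: stake_shift)
    then have "total (stake ?M \<omega> @- sconst False) = total \<omega>" by (rule total_cong)
    then show ?thesis unfolding accepts_iff P_def hit_def by simp
  qed
  let ?good = "{xs. length xs = ?M \<and> P xs}" and ?bad = "{xs. length xs = ?M \<and> \<not> P xs}"
  let ?iso = "{xs :: bool list. length xs = ?M \<and> \<not> isolated odd_choices (\<lambda>u. block (nth xs) (u * bits) bits)}"
  have sub: "A \<subseteq> {..<2 * nodes t}" if "A \<in> odd_choices" for A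
    using that by (auto simp: odd_choices_def complete_choices_def choices_root)
  have fin: "finite {xs :: bool list. length xs = ?M \<and> R xs}" for R
    by (rule finite_subset[OF _ finite_lists_length_eq[of "UNIV :: bool set" ?M]]) auto
  have "?bad \<subseteq> ?iso"
  proof clarify
    fix xs assume xs: "length xs = ?M" "\<not> P xs" "isolated odd_choices (\<lambda>u. block ((!) xs) (u * bits) bits)"
    let ?\<omega> = "xs @- sconst False"
    have "stake ?M ?\<omega> = xs" using xs(1) by (simp add: stake_shift)
    then have "sum (random_weight ?\<omega>) A = (\<Sum>u\<in>A. block ((!) xs) (u * bits) bits)" if "A \<in> odd_choices" for A
      using sub[OF that] random_weight_stake[of _ ?\<omega>] by (intro sum.cong) auto
    then have "isolated odd_choices (random_weight ?\<omega>)" using xs(3) by (simp add: isolated_def)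
    then show False using hit_complete[OF assms] xs(2) by (simp add: P_def)
  qed
  then have "card ?bad * 2 ^ bits \<le> card ?iso * 2 ^ bits" by (intro mult_le_mono1 card_mono fin)
  also have "\<dots> \<le> 2 * nodes t * 2 ^ ?M"
    by (rule isolation[OF odd_choices_nonempty(1)[OF assms] sub])
  finally have bad: "card ?bad * 2 ^ bits \<le> 2 * nodes t * 2 ^ ?M" .
  have "card (?good \<union> ?bad) = card ?good + card ?bad" by (rule card_Un_disjoint) (use fin in auto)
  moreover have "?good \<union> ?bad = {xs. set xs \<subseteq> UNIV \<and> length xs = ?M}" by auto
  moreover have "card {xs :: bool list. set xs \<subseteq> UNIV \<and> length xs = ?M} = 2 ^ ?M"
    by (subst card_lists_length_eq) auto
  ultimately have tot: "card ?good + card ?bad = 2 ^ ?M" by simp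
  have "card ?bad * (n + 1) ^ d * 2 ^ bits \<le> 2 * nodes t * (n + 1) ^ d * 2 ^ ?M"
    using mult_le_mono1[OF bad, of "(n + 1) ^ d"] by (simp add: algebra_simps)
  also have "\<dots> \<le> 2 ^ bits * 2 ^ ?M" by (rule mult_le_mono1[OF failure_le])
  finally have "card ?bad * (n + 1) ^ d \<le> 2 ^ ?M" by simp
  then have "real (card ?bad) * (real n + 1) ^ d \<le> 2 ^ ?M"
    by (metis (mono_tags, lifting) of_nat_1 of_nat_add of_nat_le_iff of_nat_mult of_nat_numeral of_nat_power)
  then have "real (card ?bad) / 2 ^ ?M \<le> 1 / (real n + 1) ^ d"
    by (simp add: field_simps)
  moreover have "accept_prob (steiner_prog d) s0 = real (card ?good) / 2 ^ ?M"
    unfolding accept_prob_def acc by (rule measure_stake)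
  moreover have "real (card ?good) = 2 ^ ?M - real (card ?bad)"
    using arg_cong[OF tot, of real] by simp
  ultimately show ?thesis by (simp add: diff_divide_distrib)
qed

lemma lg_double: "2 ^ lg \<le> 2 * len"
  using lg(2)[of "lg - 1"] lg_pos by (cases lg) auto

text \<open>The numbers of rounds and \<open>\<beta>\<close> multiply. The rounds contribute
  \<open>codes * N ^ (2 * d + 7)\<close>, and \<open>codes * \<beta>\<close> is at most
  \<open>3 ^ k * N ^ (2 * d + 12)\<close>, so the factor \<open>codes\<close> occurs once. The
  constant \<open>prog_time d\<close> is absorbed by the power
  \<open>N ^ prog_time d\<close>.\<close>

lemma steiner_prog_time:
  assumes "4 \<le> N" "n \<le> N"
  shows "runs_within (steiner_prog d) s0 (3 ^ k * N ^ (prog_time d + 4 * d + 19))"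
proof -
  let ?r = "2 ^ bits :: nat"
  have N2: "2 * x \<le> N * N" if "x \<le> N" for x using that assms(1) mult_le_mono[of 2 N x N] by simp
  have r: "?r \<le> N ^ (2 * d + 2)"
  proof -
    have "?r = (2 ^ lg) ^ Suc d" by (simp add: bits_def power_mult del: power_Suc mult_Suc_right)
    also have "\<dots> \<le> (N * N) ^ Suc d"
      using lg_double N2[OF len_N] by (intro power_mono) auto
    also have "\<dots> = N ^ (2 * d + 2)" by (simp only: power2_eq_square[symmetric] power_mult[symmetric]) simp
    finally show ?thesis .
  qed
  have lenN: "len \<le> N" "len + 2 \<le> N ^ 2" "n + 2 \<le> N ^ 2" "n + 1 \<le> N ^ 2"
    using len_N assms N2[OF order_refl] unfolding power2_eq_square by linarith+
  have pw: "N ^ a \<le> N ^ b" if "a \<le> b" for a b using that assms(1) by (intro power_increasing) auto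
  have dbl: "2 * N ^ a \<le> N ^ b" if "b = Suc a" for a b
    using that mult_le_mono1[of 2 N "N ^ a"] assms(1) by simp
  have "(len + 2) ^ 3 * ?r * (n + 2) \<le> (N ^ 2) ^ 3 * N ^ (2 * d + 2) * N ^ 2"
    using lenN r by (intro mult_le_mono power_mono) auto
  also have "\<dots> = N ^ (2 * d + 10)" by (simp add: power_add eval_nat_numeral algebra_simps)
  finally have "\<beta> \<le> k + (N + N ^ (2 * d + 10))" by (simp add: \<beta>_def)
  also have "N + N ^ (2 * d + 10) \<le> 2 * N ^ (2 * d + 10)" using pw[of 1 "2 * d + 10"] by simp
  also have "\<dots> \<le> N ^ (2 * d + 11)" by (rule dbl) simp
  finally have \<beta>: "\<beta> \<le> k + N ^ (2 * d + 11)" by simp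
  \<comment> \<open>\<open>\<beta>\<close> contains \<open>k\<close>, which \<open>N\<close> need
    not bound. If \<open>k\<close> exceeds \<open>N\<close>, at most \<open>N\<close> labels have
    digits, and the surplus \<open>3 ^ (k - N)\<close> pays for the factor \<open>k\<close>.\<close>
  have codes: "codes * k \<le> 3 ^ k * N"
  proof (cases "k \<le> N")
    case True
    have "codes \<le> 3 ^ k" by (intro power_increasing card_labels_le) simp
    then show ?thesis using True by (rule mult_le_mono)
  next
    case False
    define j where "j = k - N"
    have k: "k = N + j" using False by (simp add: j_def)
    have "1 + j \<le> 3 ^ j" by (induction j) auto
    then have "N * (1 + j) \<le> N * 3 ^ j" by (rule mult_le_mono2)
    moreover have "N + j \<le> N * (1 + j)" using assms(1) by simp
    ultimately have "k \<le> N * 3 ^ j" using k by linarith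
    moreover have "codes \<le> 3 ^ N" using card_labels_le(3)[of len] len_N by (intro power_increasing) auto
    ultimately have "codes * k \<le> 3 ^ N * (N * 3 ^ j)" by (rule mult_le_mono[rotated])
    also have "\<dots> = 3 ^ k * N" unfolding k power_add by simp
    finally show ?thesis .
  qed
  have "codes \<le> 3 ^ k" by (intro power_increasing card_labels_le) simp
  then have cb: "codes * \<beta> \<le> 3 ^ k * N ^ (2 * d + 12)"
  proof -
    have "codes * \<beta> \<le> codes * k + codes * N ^ (2 * d + 11)" using mult_le_mono2[OF \<beta>, of codes] by (simp add: algebra_simps)
    also have "\<dots> \<le> 3 ^ k * N + 3 ^ k * N ^ (2 * d + 11)" using codes \<open>codes \<le> 3 ^ k\<close> by (intro add_mono mult_le_mono1)
    also have "\<dots> \<le> 3 ^ k * (2 * N ^ (2 * d + 11))"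
      using mult_le_mono2[OF pw[of 1 "2 * d + 11"], of "3 ^ k"] by simp
    also have "\<dots> \<le> 3 ^ k * N ^ (2 * d + 12)" by (intro mult_le_mono2 dbl) simp
    finally show ?thesis .
  qed
  let ?X = "Suc (len + 2 * nodes t * bits + nodes t * codes + separator * (n + 1))"
  have X: "?X \<le> codes * N ^ (2 * d + 7)"
  proof -
    let ?A = "N ^ (2 * d + 5)"
    have c1: "1 \<le> codes" by simp
    have a1: "1 \<le> ?A" and lA: "len \<le> ?A" using pw[of 0 "2 * d + 5"] pw[of 1 "2 * d + 5"] lenN(1) by simp_all
    have "2 * nodes t * bits \<le> len * ?r" using len_eq by (intro mult_le_mono) (auto simp: less_imp_le)
    also have "\<dots> \<le> N * N ^ (2 * d + 2)" using lenN(1) r by (rule mult_le_mono)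
    also have "\<dots> = N ^ Suc (2 * d + 2)" by simp
    also have "\<dots> \<le> ?A" by (rule pw) simp
    finally have b: "2 * nodes t * bits \<le> ?A" .
    have "separator * (n + 1) \<le> N * N ^ (2 * d + 2) * N ^ 2"
      unfolding separator_def using lenN r by (intro mult_le_mono) auto
    also have "\<dots> = ?A" by (simp add: power_add eval_nat_numeral algebra_simps)
    finally have s: "separator * (n + 1) \<le> ?A" .
    have nA: "nodes t \<le> ?A" using lA len_eq by linarith
    have n: "nodes t * codes \<le> codes * ?A" using mult_le_mono1[OF nA, of codes] by (simp add: mult.commute)
    have up: "x \<le> codes * ?A" if "x \<le> ?A" for x using that mult_le_mono[OF c1 that] by simp
    have "?X \<le> 5 * (codes * ?A)" using up[OF a1] up[OF lA] up[OF b] n up[OF s] by linarith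
    also have "\<dots> \<le> N ^ 2 * (codes * ?A)"
      using mult_le_mono[OF assms(1) assms(1)] by (intro mult_le_mono1) (simp add: power2_eq_square)
    also have "\<dots> = codes * N ^ (2 * d + 7)" by (simp add: power_add eval_nat_numeral algebra_simps)
    finally show ?thesis .
  qed
  have "prog_time d * \<beta> * ?X \<le> prog_time d * \<beta> * (codes * N ^ (2 * d + 7))" by (rule mult_le_mono2[OF X])
  also have "\<dots> = prog_time d * ((codes * \<beta>) * N ^ (2 * d + 7))" by simp
  also have "\<dots> \<le> N ^ prog_time d * ((3 ^ k * N ^ (2 * d + 12)) * N ^ (2 * d + 7))"
  proof (rule mult_le_mono[OF _ mult_le_mono1[OF cb]])
    have "prog_time d \<le> 2 ^ prog_time d" by (simp add: less_imp_le)
    also have "\<dots> \<le> N ^ prog_time d" using assms(1) by (intro power_mono) auto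
    finally show "prog_time d \<le> N ^ prog_time d" .
  qed
  also have "\<dots> = 3 ^ k * (N ^ prog_time d * N ^ (2 * d + 12) * N ^ (2 * d + 7))" by simp
  also have "N ^ prog_time d * N ^ (2 * d + 12) * N ^ (2 * d + 7) = N ^ (prog_time d + 4 * d + 19)"
    by (simp add: ac_simps flip: power_add)
  finally have "prog_time d * \<beta> * ?X \<le> 3 ^ k * N ^ (prog_time d + 4 * d + 19)" .
  then show ?thesis
    unfolding runs_within_def using steiner_prog_run by (meson le_trans)
qed

end

section \<open>Renaming vertices and transporting solutions\<close>

lemma cverts_map: "cverts (map_cexpr f t) = f ` cverts t"
  by (induction t) auto

lemma cedges_subset: "e \<in> cedges t \<Longrightarrow> e \<subseteq> cverts t"
  by (induction t) auto

lemma clab_map: "inj_on f (cverts t) \<Longrightarrow> x \<in> cverts t \<Longrightarrow> clab (map_cexpr f t) (f x) = clab t x"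
proof (induction t)
  case (Oplus t u)
  have inj: "inj_on f (cverts t)" "inj_on f (cverts u)"
    using Oplus.prems(1) by (auto intro: inj_on_subset)
  have "f x \<in> f ` cverts t \<longleftrightarrow> x \<in> cverts t"
    using Oplus.prems by (intro inj_on_image_mem_iff[of f "cverts t \<union> cverts u"]) auto
  then show ?case using Oplus.IH(1)[OF inj(1)] Oplus.IH(2)[OF inj(2)] Oplus.prems by (auto simp: cverts_map)
qed auto

lemma well_formed_map: "inj_on f (cverts t) \<Longrightarrow> well_formed t \<Longrightarrow> well_formed (map_cexpr f t)"
proof (induction t)
  case (Oplus t u)
  have "inj_on f (cverts t)" "inj_on f (cverts u)"
    using Oplus.prems(1) by (auto intro: inj_on_subset)
  moreover have "f ` cverts t \<inter> f ` cverts u = f ` (cverts t \<inter> cverts u)"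
    using Oplus.prems(1) by (intro inj_on_image_Int[symmetric]) auto
  ultimately show ?case using Oplus by (simp add: cverts_map)
qed auto

lemma cedges_map: "inj_on f (cverts t) \<Longrightarrow> cedges (map_cexpr f t) = (`) f ` cedges t"
proof (induction t)
  case (Oplus t u)
  have "inj_on f (cverts t)" "inj_on f (cverts u)"
    using Oplus.prems(1) by (auto intro: inj_on_subset)
  then show ?case using Oplus.IH by (simp add: image_Un)
next
  case (Join i j t)
  have inj: "inj_on f (cverts t)" using Join.prems by simp
  have "{{x, y} |x y. x \<in> f ` cverts t \<and> y \<in> f ` cverts t \<and> clab (map_cexpr f t) x = i \<and> clab (map_cexpr f t) y = j} =
      (`) f ` {{x, y} |x y. x \<in> cverts t \<and> y \<in> cverts t \<and> clab t x = i \<and> clab t y = j}" (is "?A = ?B")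
  proof
    show "?A \<subseteq> ?B"
    proof clarify
      fix x y assume "x \<in> cverts t" "y \<in> cverts t"
      then have "f ` {x, y} \<in> ?B" if "i = clab t x" "j = clab t y"
        using that by blast
      then show "{f x, f y} \<in> (`) f ` {{x', y'} |x' y'. x' \<in> cverts t \<and> y' \<in> cverts t \<and>
          clab t x' = clab (map_cexpr f t) (f x) \<and> clab t y' = clab (map_cexpr f t) (f y)}"
        using clab_map[OF inj \<open>x \<in> cverts t\<close>] clab_map[OF inj \<open>y \<in> cverts t\<close>]
          \<open>x \<in> cverts t\<close> \<open>y \<in> cverts t\<close> by (intro image_eqI[of _ _ "{x, y}"]) auto
    qed
    show "?B \<subseteq> ?A"
    proof clarify
      fix x y assume "x \<in> cverts t" "y \<in> cverts t" "i = clab t x" "j = clab t y"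
      then show "\<exists>x' y'. f ` {x, y} = {x', y'} \<and> x' \<in> f ` cverts t \<and> y' \<in> f ` cverts t \<and>
          clab (map_cexpr f t) x' = clab t x \<and> clab (map_cexpr f t) y' = clab t y"
        using clab_map[OF inj] by (intro exI[of _ "f x"] exI[of _ "f y"]) auto
    qed
  qed
  then show ?case using Join.IH[OF inj] by (simp add: cverts_map image_Un)
qed auto

lemma subexprs_map: "subexprs (map_cexpr f t) = map_cexpr f ` subexprs t"
  by (induction t) auto

lemma cverts_subexprs: "x \<in> subexprs t \<Longrightarrow> cverts x \<subseteq> cverts t"
  by (induction t) auto

lemma rtrancl_image:
  assumes "(x, y) \<in> R\<^sup>*" "\<And>a b. (a, b) \<in> R \<Longrightarrow> (f a, f b) \<in> S"
  shows "(f x, f y) \<in> S\<^sup>*"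
  using assms(1) by induction (auto intro: rtrancl.rtrancl_into_rtrancl assms(2))

text \<open>Only the vertex set of \<open>H\<close> matters: adding edges preserves connectedness,
  so \<open>H\<close> may be replaced by the induced subgraph, which the numbering carries over to
  \<open>E\<close>.\<close>

lemma steiner_solution_iff:
  fixes \<nu> :: "nat \<Rightarrow> nat" and n :: nat
  assumes G: "simple_graph G" and T: "T \<subseteq> fst G" and \<nu>: "bij_betw \<nu> (fst G) {..<n}"
    and E: "\<And>u v. u \<in> fst G \<Longrightarrow> v \<in> fst G \<Longrightarrow> {u, v} \<in> snd G \<longleftrightarrow> {\<nu> u, \<nu> v} \<in> E"
  shows "(\<exists>H. steiner_solution G T b H) \<longleftrightarrow>
    (\<exists>X. X \<subseteq> {..<n} \<and> card X = b \<and> \<nu> ` T \<subseteq> X \<and> connected_in E X)"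
proof
  assume "\<exists>H. steiner_solution G T b H"
  then obtain H where H: "simple_graph H" "fst H \<subseteq> fst G" "snd H \<subseteq> snd G" "fst H \<noteq> {}" "card (fst H) = b" "T \<subseteq> fst H"
    and con: "\<And>u v. u \<in> fst H \<Longrightarrow> v \<in> fst H \<Longrightarrow> (u, v) \<in> {(x, y). {x, y} \<in> snd H}\<^sup>*"
    unfolding steiner_solution_def subgraph_def connected_graph_def by blast
  let ?X = "\<nu> ` fst H"
  have "?X \<subseteq> {..<n}" using \<nu> H(2) bij_betw_imp_surj_on by blast
  moreover have "card ?X = b"
    using H(2,5) bij_betw_imp_inj_on[OF \<nu>] card_image inj_on_subset by metis
  moreover have "connected_in E ?X"
    unfolding connected_in_def
  proof (intro conjI ballI)
    show "?X \<noteq> {}" using H(4) by simp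
    fix x y assume "x \<in> ?X" "y \<in> ?X"
    then obtain u v where uv: "u \<in> fst H" "v \<in> fst H" "x = \<nu> u" "y = \<nu> v" by blast
    have "(\<nu> u, \<nu> v) \<in> {(x, y). x \<in> ?X \<and> y \<in> ?X \<and> {x, y} \<in> E}\<^sup>*"
    proof (rule rtrancl_image[OF con[OF uv(1,2)]])
      fix a b assume "(a, b) \<in> {(x, y). {x, y} \<in> snd H}"
      then have ab: "{a, b} \<in> snd H" by simp
      then have "a \<in> fst H" "b \<in> fst H" using H(1) unfolding simple_graph_def by auto
      moreover from this have "{\<nu> a, \<nu> b} \<in> E" using ab H(2,3) E by blast
      ultimately show "(\<nu> a, \<nu> b) \<in> {(x, y). x \<in> ?X \<and> y \<in> ?X \<and> {x, y} \<in> E}" by simp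
    qed
    then show "(x, y) \<in> {(x, y). x \<in> ?X \<and> y \<in> ?X \<and> {x, y} \<in> E}\<^sup>*" using uv by simp
  qed
  ultimately show "\<exists>X. X \<subseteq> {..<n} \<and> card X = b \<and> \<nu> ` T \<subseteq> X \<and> connected_in E X"
    using H(6) by (intro exI[of _ ?X]) auto
next
  assume "\<exists>X. X \<subseteq> {..<n} \<and> card X = b \<and> \<nu> ` T \<subseteq> X \<and> connected_in E X"
  then obtain X where X: "X \<subseteq> {..<n}" "card X = b" "\<nu> ` T \<subseteq> X" "X \<noteq> {}"
    and con: "\<And>x y. x \<in> X \<Longrightarrow> y \<in> X \<Longrightarrow> (x, y) \<in> {(x, y). x \<in> X \<and> y \<in> X \<and> {x, y} \<in> E}\<^sup>*"
    unfolding connected_in_def by blast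
  define \<mu> where "\<mu> = inv_into (fst G) \<nu>"
  have \<mu>: "\<mu> x \<in> fst G" "\<nu> (\<mu> x) = x" if "x \<in> X" for x
  proof -
    have "x \<in> \<nu> ` fst G" using that X(1) bij_betw_imp_surj_on[OF \<nu>] by auto
    then show "\<mu> x \<in> fst G" "\<nu> (\<mu> x) = x" unfolding \<mu>_def by (simp_all add: inv_into_into f_inv_into_f)
  qed
  have \<mu>\<nu>: "\<mu> (\<nu> u) = u" if "u \<in> fst G" for u
    using that \<nu> unfolding \<mu>_def bij_betw_def by simp
  let ?Y = "\<mu> ` X" and ?H = "(\<mu> ` X, {e \<in> snd G. e \<subseteq> \<mu> ` X})"
  have sub: "subgraph ?H G"
    using G \<mu>(1) finite_subset[OF X(1) finite_lessThan] unfolding subgraph_def simple_graph_def by auto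
  moreover have "connected_graph ?H"
    unfolding connected_graph_def fst_conv snd_conv
  proof (intro conjI ballI)
    show "?Y \<noteq> {}" using X(4) by simp
    fix u v assume "u \<in> ?Y" "v \<in> ?Y"
    then obtain x y where xy: "x \<in> X" "y \<in> X" "u = \<mu> x" "v = \<mu> y" by blast
    have "(\<mu> x, \<mu> y) \<in> {(x, y). {x, y} \<in> {e \<in> snd G. e \<subseteq> ?Y}}\<^sup>*"
    proof (rule rtrancl_image[OF con[OF xy(1,2)]])
      fix a b assume "(a, b) \<in> {(x, y). x \<in> X \<and> y \<in> X \<and> {x, y} \<in> E}"
      then have ab: "a \<in> X" "b \<in> X" "{a, b} \<in> E" by auto
      then have "{\<mu> a, \<mu> b} \<in> snd G" using E[of "\<mu> a" "\<mu> b"] \<mu> by simp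
      then show "(\<mu> a, \<mu> b) \<in> {(x, y). {x, y} \<in> {e \<in> snd G. e \<subseteq> ?Y}}" using ab by simp
    qed
    then show "(u, v) \<in> {(x, y). {x, y} \<in> {e \<in> snd G. e \<subseteq> ?Y}}\<^sup>*" using xy by simp
  qed
  moreover have "card ?Y = b" using X(2) \<mu>(2) by (metis card_image inj_on_inverseI)
  moreover have "T \<subseteq> ?Y"
  proof
    fix u assume "u \<in> T"
    then have "\<nu> u \<in> X" "u = \<mu> (\<nu> u)" using X(3) T \<mu>\<nu> by auto
    then show "u \<in> ?Y" by blast
  qed
  ultimately show "\<exists>H. steiner_solution G T b H"
    unfolding steiner_solution_def by (intro exI[of _ ?H]) simp
qed

lemma bit_size_ge_length: "length xs \<le> bit_size xs"
  unfolding bit_size_def by (induction xs) auto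

lemma less_power_bit_size: "x \<in> set xs \<Longrightarrow> x < 2 ^ bit_size xs"
proof -
  assume "x \<in> set xs"
  then have "floorlog 2 x \<le> bit_size xs"
    unfolding bit_size_def by (induction xs) auto
  then show ?thesis by (rule floorlog_leD) simp
qed

lemma mem_bound_input_state:
  assumes "card (fst G) + bit_size (postfix t) + bit_size [b] \<le> N"
  shows "mem_bound (k + N) (input_state G T b k t \<nu>)"
proof -
  let ?n = "card (fst G)"
  have one: "(1::nat) \<le> bit_size [b]" using bit_size_ge_length[of "[b]"] by simp
  have up: "x < 2 ^ (k + N)" if "x < 2 ^ e" "e \<le> k + N" for x e :: nat using that by (rule less_power_mono)
  have "?n < 2 ^ (k + N)" by (rule up[OF less_exp]) (use assms in simp)
  moreover have "k < 2 ^ (k + N)" by (rule up[OF less_exp]) simp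
  moreover have "b < 2 ^ (k + N)" by (rule up[OF less_power_bit_size[of b "[b]"]]) (use assms in auto)
  moreover have "length (postfix t) < 2 ^ (k + N)"
    by (rule up[OF less_exp]) (use assms bit_size_ge_length[of "postfix t"] in simp)
  moreover have "array_of (postfix t) i < 2 ^ (k + N)" for i
  proof (cases "i < length (postfix t)")
    case True
    have "postfix t ! i < 2 ^ (k + N)"
      by (rule up[OF less_power_bit_size[OF nth_mem[OF True]]]) (use assms in simp)
    then show ?thesis using True by (simp add: array_of_def)
  qed (simp add: array_of_def)
  moreover have "(of_bool P :: nat) < 2 ^ (k + N)" for P
    by (rule up[of _ 1]) (use one assms in \<open>auto simp: of_bool_def\<close>)
  ultimately show ?thesis
    unfolding mem_bound_def input_state_def Let_def by (auto simp: array_of_def)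
qed

theorem theorem1p1:
  fixes d :: nat
  shows "\<exists>(A :: com) (c :: nat).
    \<forall>(G :: nat ugraph) (T :: nat set) (b :: nat) (k :: nat) (t :: nat cexpr)
      (\<phi> :: nat \<Rightarrow> nat) (\<nu> :: nat \<Rightarrow> nat) (t' :: nat cexpr) (n :: nat) (s :: state).
      simple_graph G \<longrightarrow> n = card (fst G) \<longrightarrow> T \<subseteq> fst G \<longrightarrow>
      k_expression k t G \<longrightarrow> graph_isomorphism \<phi> (cgraph t) G \<longrightarrow>
      bij_betw \<nu> (fst G) {..<n} \<longrightarrow>
      t' = map_cexpr (\<nu> \<circ> \<phi>) t \<longrightarrow> s = input_state G T b k t' \<nu> \<longrightarrow>
        runs_within A s (3 ^ k * (n + bit_size (postfix t') + bit_size [b]) ^ c) \<and>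
        ((\<nexists>H. steiner_solution G T b H) \<longrightarrow> (\<forall>\<omega>. \<not> accepts A s \<omega>)) \<and>
        ((\<exists>H. steiner_solution G T b H) \<longrightarrow> accept_prob A s \<ge> 1 - 1 / (real n + 1) ^ d)"
proof (rule exI[of _ "steiner_prog d"], rule exI[of _ "prog_time d + 4 * d + 19"], intro allI impI)
  fix G :: "nat ugraph" and T :: "nat set" and b k :: nat and t :: "nat cexpr"
    and \<phi> \<nu> :: "nat \<Rightarrow> nat" and t' :: "nat cexpr" and n :: nat and s :: state
  assume G: "simple_graph G" and n: "n = card (fst G)" and TG: "T \<subseteq> fst G" and kx: "k_expression k t G"
    and iso: "graph_isomorphism \<phi> (cgraph t) G" and \<nu>: "bij_betw \<nu> (fst G) {..<n}"
    and t': "t' = map_cexpr (\<nu> \<circ> \<phi>) t" and s: "s = input_state G T b k t' \<nu>"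
  define N where "N = n + bit_size (postfix t') + bit_size [b]"
  have bij: "bij_betw \<phi> (cverts t) (fst G)" using iso by (simp add: graph_isomorphism_def cgraph_def)
  have bij': "bij_betw (\<nu> \<circ> \<phi>) (cverts t) {..<n}" by (rule bij_betw_trans[OF bij \<nu>])
  have inj: "inj_on (\<nu> \<circ> \<phi>) (cverts t)" by (rule bij_betw_imp_inj_on[OF bij'])
  have cv: "cverts t' = {..<n}" unfolding t' cverts_map by (rule bij_betw_imp_surj_on[OF bij'])
  have wf: "well_formed t" and lab: "\<And>x. x \<in> subexprs t \<Longrightarrow> clab x ` cverts x \<subseteq> {1..k}"
    using kx by (auto simp: k_expression_def)
  have wf': "well_formed t'" unfolding t' by (rule well_formed_map[OF inj wf])
  have lab': "clab x ` cverts x \<subseteq> {1..k}" if x: "x \<in> subexprs t'" for x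
  proof -
    obtain y where y: "y \<in> subexprs t" "x = map_cexpr (\<nu> \<circ> \<phi>) y" using x unfolding t' subexprs_map by blast
    have "inj_on (\<nu> \<circ> \<phi>) (cverts y)" by (rule inj_on_subset[OF inj cverts_subexprs[OF y(1)]])
    then have "clab x ` cverts x = clab y ` cverts y"
      unfolding y(2) cverts_map image_image by (intro image_cong refl clab_map)
    then show ?thesis using lab[OF y(1)] by simp
  qed
  have T': "\<nu> ` T \<subseteq> {..<n}" using TG bij_betw_imp_surj_on[OF \<nu>] by blast
  have len: "length (postfix t') \<le> N" using bit_size_ge_length[of "postfix t'"] by (simp add: N_def)
  \<comment> \<open>One node already contributes three numbers, and \<open>b\<close> one more; each
    has \<open>bit_size\<close> at least 1.\<close>
  have N4: "4 \<le> N"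
    using bit_size_ge_length[of "postfix t'"] length_postfix[of t'] nodes_pos[of t'] bit_size_ge_length[of "[b]"]
    by (simp add: N_def)
  interpret steiner_input d n b k N t' "\<nu> ` T" s
  proof
    show "mem_bound (k + N) s" unfolding s by (rule mem_bound_input_state) (simp add: N_def n)
    show "s x i = 0" if "x \<in> {''pos'', ''Q'', ''R'', ''m'', ''Y'', ''Z'', ''c1'', ''c2'', ''c3'', ''c4'', ''t'',
       ''w'', ''tab'', ''start'', ''G'', ''out''}" for x i
      using that unfolding s input_state_def Let_def by (elim insertE) simp_all
  qed (use wf' cv T' lab' len n in \<open>simp_all add: s input_state_def Let_def array_of_def\<close>)
  have E: "{u, v} \<in> snd G \<longleftrightarrow> {\<nu> u, \<nu> v} \<in> cedges t'" if uv: "u \<in> fst G" "v \<in> fst G" for u v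
  proof -
    obtain x y where xy: "x \<in> cverts t" "y \<in> cverts t" "u = \<phi> x" "v = \<phi> y"
      using uv bij_betw_imp_surj_on[OF bij] by blast
    have "{u, v} \<in> snd G \<longleftrightarrow> {x, y} \<in> cedges t"
      using iso xy by (simp add: graph_isomorphism_def cgraph_def)
    also have "\<dots> \<longleftrightarrow> (\<nu> \<circ> \<phi>) ` {x, y} \<in> (`) (\<nu> \<circ> \<phi>) ` cedges t"
    proof
      assume "(\<nu> \<circ> \<phi>) ` {x, y} \<in> (`) (\<nu> \<circ> \<phi>) ` cedges t"
      then obtain e where e: "e \<in> cedges t" "(\<nu> \<circ> \<phi>) ` {x, y} = (\<nu> \<circ> \<phi>) ` e" by blast
      then have "{x, y} = e" using inj_on_image_eq_iff[OF inj, of "{x, y}" e] cedges_subset[OF e(1)] xy by simp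
      then show "{x, y} \<in> cedges t" using e(1) by simp
    qed blast
    finally show ?thesis unfolding t' cedges_map[OF inj] using xy by simp
  qed
  have sol: "(\<exists>H. steiner_solution G T b H) \<longleftrightarrow> solvable"
    unfolding solvable_def by (rule steiner_solution_iff[OF G TG \<nu> E])
  have "runs_within (steiner_prog d) s (3 ^ k * N ^ (prog_time d + 4 * d + 19))"
    by (rule steiner_prog_time[OF N4]) (simp add: N_def)
  moreover have "\<not> accepts (steiner_prog d) s \<omega>" if "\<nexists>H. steiner_solution G T b H" for \<omega>
    using that hit_sound sol accepts_iff by blast
  moreover have "accept_prob (steiner_prog d) s \<ge> 1 - 1 / (real n + 1) ^ d" if "\<exists>H. steiner_solution G T b H"
    using that sol accept_prob_ge by blast
  ultimately show "runs_within (steiner_prog d) s (3 ^ k * (n + bit_size (postfix t') + bit_size [b]) ^ (prog_time d + 4 * d + 19)) \<and>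
        ((\<nexists>H. steiner_solution G T b H) \<longrightarrow> (\<forall>\<omega>. \<not> accepts (steiner_prog d) s \<omega>)) \<and>
        ((\<exists>H. steiner_solution G T b H) \<longrightarrow> accept_prob (steiner_prog d) s \<ge> 1 - 1 / (real n + 1) ^ d)"
    unfolding N_def by blast
qed

end
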